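(* The group $\mathrm{Aut}_{C^*(U)}(\mathcal{Q}_2)$ is a maximal abelian subgroup of $\mathrm{Aut}(\mathcal{Q}_2)$.
   Context: The $2$-adic ring $C^*$-algebra $\mathcal{Q}_2$ is the universal (unital) $C^*$-algebra generated by a unitary $U$ and an isometry $S_2$ satisfying $S_2U=U^2S_2$ and $S_2S_2^*+US_2S_2^*U^*=1$. $\mathrm{Aut}_{C^*(U)}(\mathcal{Q}_2)$ is the group of automorphisms $\Lambda$ of $\mathcal{Q}_2$ fixing $C^*(U)$ pointwise, i.e. with $\Lambda(U)=U$. *)

theory Defs
  imports Complex_Main "HOL-Algebra.Module" "HOL-Algebra.Bij"
begin

section \<open>Unital C*-algebras\<close>

definition complex_ring :: "complex ring" where
  "complex_ring = \<lparr>carrier = UNIV, mult = (*), one = 1, zero = 0, add = (+)\<rparr>"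

record 'a cstar_alg = "(complex, 'a) module" +
  adj :: "'a \<Rightarrow> 'a"
  cnorm :: "'a \<Rightarrow> real"

locale cstar_algebra = module complex_ring A + ring A
  for A :: "'a cstar_alg" (structure) +
  assumes nontrivial: "\<one> \<noteq> \<zero>"
    and smult_mult_left:
      "\<lbrakk>x \<in> carrier A; y \<in> carrier A\<rbrakk> \<Longrightarrow> (c \<odot> x) \<otimes> y = c \<odot> (x \<otimes> y)"
    and smult_mult_right:
      "\<lbrakk>x \<in> carrier A; y \<in> carrier A\<rbrakk> \<Longrightarrow> x \<otimes> (c \<odot> y) = c \<odot> (x \<otimes> y)"
    and adj_closed: "x \<in> carrier A \<Longrightarrow> adj A x \<in> carrier A"
    and adj_adj: "x \<in> carrier A \<Longrightarrow> adj A (adj A x) = x"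
    and adj_add:
      "\<lbrakk>x \<in> carrier A; y \<in> carrier A\<rbrakk> \<Longrightarrow> adj A (x \<oplus> y) = adj A x \<oplus> adj A y"
    and adj_smult: "x \<in> carrier A \<Longrightarrow> adj A (c \<odot> x) = cnj c \<odot> adj A x"
    and adj_mult:
      "\<lbrakk>x \<in> carrier A; y \<in> carrier A\<rbrakk> \<Longrightarrow> adj A (x \<otimes> y) = adj A y \<otimes> adj A x"
    and cnorm_nonneg: "x \<in> carrier A \<Longrightarrow> 0 \<le> cnorm A x"
    and cnorm_eq_0: "x \<in> carrier A \<Longrightarrow> cnorm A x = 0 \<longleftrightarrow> x = \<zero>"
    and cnorm_smult: "x \<in> carrier A \<Longrightarrow> cnorm A (c \<odot> x) = cmod c * cnorm A x"
    and cnorm_triangle: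
      "\<lbrakk>x \<in> carrier A; y \<in> carrier A\<rbrakk> \<Longrightarrow> cnorm A (x \<oplus> y) \<le> cnorm A x + cnorm A y"
    and cnorm_mult:
      "\<lbrakk>x \<in> carrier A; y \<in> carrier A\<rbrakk> \<Longrightarrow> cnorm A (x \<otimes> y) \<le> cnorm A x * cnorm A y"
    and cstar_identity: "x \<in> carrier A \<Longrightarrow> cnorm A (adj A x \<otimes> x) = (cnorm A x)\<^sup>2"
    and complete:
      "\<lbrakk>range X \<subseteq> carrier A; \<forall>e>0. \<exists>N. \<forall>m\<ge>N. \<forall>n\<ge>N. cnorm A (X m \<ominus> X n) < e\<rbrakk>
        \<Longrightarrow> \<exists>x\<in>carrier A. (\<lambda>n::nat. cnorm A (X n \<ominus> x)) \<longlonglongrightarrow> 0"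

definition cstar_subalgebra :: "'a set \<Rightarrow> 'a cstar_alg \<Rightarrow> bool" where
  "cstar_subalgebra B A \<longleftrightarrow>
     B \<subseteq> carrier A \<and> \<zero>\<^bsub>A\<^esub> \<in> B \<and>
     (\<forall>x\<in>B. \<forall>y\<in>B. x \<oplus>\<^bsub>A\<^esub> y \<in> B \<and> x \<otimes>\<^bsub>A\<^esub> y \<in> B) \<and>
     (\<forall>x\<in>B. adj A x \<in> B \<and> (\<forall>c. c \<odot>\<^bsub>A\<^esub> x \<in> B)) \<and>
     (\<forall>X. \<forall>x\<in>carrier A.
        range X \<subseteq> B \<and> (\<lambda>n::nat. cnorm A (X n \<ominus>\<^bsub>A\<^esub> x)) \<longlonglongrightarrow> 0 \<longrightarrow> x \<in> B)"

definition cstar_generated :: "'a cstar_alg \<Rightarrow> 'a set \<Rightarrow> 'a set" where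
  "cstar_generated A X = \<Inter> {B. cstar_subalgebra B A \<and> X \<subseteq> B}"

text \<open>Unital *-homomorphisms; continuity is automatic.\<close>

definition star_hom :: "'a cstar_alg \<Rightarrow> 'b cstar_alg \<Rightarrow> ('a \<Rightarrow> 'b) set" where
  "star_hom A B = {h \<in> ring_hom A B.
     \<forall>x\<in>carrier A. h (adj A x) = adj B (h x) \<and> (\<forall>c. h (c \<odot>\<^bsub>A\<^esub> x) = c \<odot>\<^bsub>B\<^esub> h x)}"

definition cstar_auto :: "'a cstar_alg \<Rightarrow> ('a \<Rightarrow> 'a) set" where
  "cstar_auto A = star_hom A A \<inter> Bij (carrier A)"

definition cstar_AutoGroup :: "'a cstar_alg \<Rightarrow> ('a \<Rightarrow> 'a) monoid" where
  "cstar_AutoGroup A = BijGroup (carrier A) \<lparr>carrier := cstar_auto A\<rparr>"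

definition cstar_auto_fixing :: "'a cstar_alg \<Rightarrow> 'a set \<Rightarrow> ('a \<Rightarrow> 'a) set" where
  "cstar_auto_fixing A B = {f \<in> cstar_auto A. \<forall>x\<in>B. f x = x}"

lemma (in cstar_algebra) subgroup_cstar_auto:
  "subgroup (cstar_auto A) (BijGroup (carrier A))"
proof (rule subgroup.intro)
  show "cstar_auto A \<subseteq> carrier (BijGroup (carrier A))"
    by (auto simp: cstar_auto_def BijGroup_def)
next
  fix f g assume fg: "f \<in> cstar_auto A" "g \<in> cstar_auto A"
  then have f: "f \<in> carrier A \<rightarrow> carrier A" and g: "g \<in> carrier A \<rightarrow> carrier A"
    by (auto simp: cstar_auto_def Bij_imp_funcset)
  have "compose (carrier A) f g \<in> star_hom A A"
    using fg f g by (auto simp: cstar_auto_def star_hom_def ring_hom_def compose_def Pi_iff adj_closed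
        smult_closed complex_ring_def)
  then show "f \<otimes>\<^bsub>BijGroup (carrier A)\<^esub> g \<in> cstar_auto A"
    using fg by (auto simp: cstar_auto_def BijGroup_def compose_Bij)
next
  show "\<one>\<^bsub>BijGroup (carrier A)\<^esub> \<in> cstar_auto A"
    by (auto simp: cstar_auto_def star_hom_def ring_hom_def BijGroup_def id_Bij adj_closed
        smult_closed complex_ring_def)
next
  fix f assume f: "f \<in> cstar_auto A"
  let ?g = "inv_into (carrier A) f"
  have bij: "f \<in> Bij (carrier A)" and hom: "f \<in> star_hom A A"
    using f by (auto simp: cstar_auto_def)
  have fc: "f x \<in> carrier A" if "x \<in> carrier A" for x
    using Bij_imp_funcset[OF bij] that by blast
  have gc: "?g x \<in> carrier A" if "x \<in> carrier A" for x
    using Bij_inv_into_mem[OF bij that] .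
  have fg: "f (?g x) = x" if "x \<in> carrier A" for x
    using bij that by (auto simp: Bij_def bij_betw_def f_inv_into_f)
  have eqI: "?g x = y" if "x = f y" "y \<in> carrier A" for x y
    using bij that by (auto simp: Bij_def bij_betw_def inv_into_f_f)
  have sc: "c \<odot> x \<in> carrier A" if "x \<in> carrier A" for c x
    using smult_closed that by (simp add: complex_ring_def)
  have "restrict ?g (carrier A) \<in> star_hom A A"
    using hom unfolding star_hom_def ring_hom_def
    by (auto simp: gc fg sc adj_closed intro!: eqI)
  then show "inv\<^bsub>BijGroup (carrier A)\<^esub> f \<in> cstar_auto A"
    by (simp add: cstar_auto_def inv_BijGroup[OF bij] restrict_inv_into_Bij[OF bij])
qed

lemma (in cstar_algebra) group_cstar_AutoGroup: "group (cstar_AutoGroup A)"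
  unfolding cstar_AutoGroup_def
  by (rule subgroup.subgroup_is_group[OF subgroup_cstar_auto group_BijGroup])


section \<open>The 2-adic ring C*-algebra\<close>

definition Q2_relations :: "'a cstar_alg \<Rightarrow> 'a \<Rightarrow> 'a \<Rightarrow> bool" where
  "Q2_relations A U S \<longleftrightarrow>
     U \<in> carrier A \<and> S \<in> carrier A \<and>
     adj A U \<otimes>\<^bsub>A\<^esub> U = \<one>\<^bsub>A\<^esub> \<and> U \<otimes>\<^bsub>A\<^esub> adj A U = \<one>\<^bsub>A\<^esub> \<and>
     adj A S \<otimes>\<^bsub>A\<^esub> S = \<one>\<^bsub>A\<^esub> \<and>
     S \<otimes>\<^bsub>A\<^esub> U = (U [^]\<^bsub>A\<^esub> (2::nat)) \<otimes>\<^bsub>A\<^esub> S \<and>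
     S \<otimes>\<^bsub>A\<^esub> adj A S \<oplus>\<^bsub>A\<^esub> U \<otimes>\<^bsub>A\<^esub> S \<otimes>\<^bsub>A\<^esub> adj A S \<otimes>\<^bsub>A\<^esub> adj A U = \<one>\<^bsub>A\<^esub>"

text \<open>\<open>A\<close> is the universal C*-algebra generated by \<open>U\<close> and \<open>S\<close> subject to the relations.
  Testing universality only on algebras with carrier in the type of \<open>A\<close> is no restriction:
  a nonzero complex algebra \<open>A\<close> forces that type to have at least continuum many elements, while in
  any C*-algebra \<open>B\<close>, on whatever type, the C*-subalgebra generated by two elements has at most
  continuum many, so it has an isomorphic copy with carrier in the type of \<open>A\<close>. The zero algebra,
  excluded by the axiom \<open>\<one> \<noteq> \<zero>\<close>, would be a trivial test object.\<close>

definition is_Q2 :: "'a cstar_alg \<Rightarrow> 'a \<Rightarrow> 'a \<Rightarrow> bool" where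
  "is_Q2 A U S \<longleftrightarrow>
     cstar_algebra A \<and> Q2_relations A U S \<and> cstar_generated A {U, S} = carrier A \<and>
     (\<forall>(B :: 'a cstar_alg) u s. cstar_algebra B \<and> Q2_relations B u s \<longrightarrow>
        (\<exists>h \<in> star_hom A B. h U = u \<and> h S = s))"


section \<open>Maximal abelian subgroups\<close>

definition abelian_subgroup :: "'g set \<Rightarrow> ('g, 'm) monoid_scheme \<Rightarrow> bool" where
  "abelian_subgroup H G \<longleftrightarrow> subgroup H G \<and> comm_group (G\<lparr>carrier := H\<rparr>)"

definition maximal_abelian_subgroup :: "'g set \<Rightarrow> ('g, 'm) monoid_scheme \<Rightarrow> bool" where
  "maximal_abelian_subgroup H G \<longleftrightarrow>
     abelian_subgroup H G \<and> (\<forall>K. abelian_subgroup K G \<and> H \<subseteq> K \<longrightarrow> K = H)"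

end

theory Submission
  imports Defs
begin

text \<open>Let \<open>M\<close> be the relative commutant of \<open>U\<close> (below: \<open>comm_U\<close>). The theorem rests on two statements.

(1) The automorphisms fixing \<open>U\<close> commute with each other. Such an automorphism sends \<open>S\<close> to \<open>d S\<close> with
a unitary \<open>d\<close> in \<open>M\<close>. As \<open>M\<close> is commutative (\<open>comm_U_commute\<close>) and each of these automorphisms is the
identity on \<open>M\<close> (\<open>hom_fixing_U_comm_U\<close>), the composition of two of them sends \<open>S\<close> to \<open>d e S = e d S\<close>
in either order.

(2) An automorphism \<open>\<alpha>\<close> commuting with all of them fixes \<open>U\<close>. For a unitary \<open>w\<close> in \<open>M\<close> the inner
automorphism \<open>Ad w\<close> fixes \<open>U\<close>, so \<open>\<alpha>\<close> commutes with it. Hence \<open>w* \<alpha>(w)\<close> is central, and therefore a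
scalar (\<open>center_scalar\<close>). With \<open>w = U\<close> this gives \<open>\<alpha>(U) = c U\<close>. With the Blaschke factor
\<open>w = (U - 1/2) (1 - U/2)^(-1)\<close> it gives \<open>c = 1\<close>, since comparing coefficients shows that the function
\<open>w\<close>, rotated by \<open>c\<close>, is a multiple of \<open>w\<close> only for \<open>c = 1\<close>.

What is needed about \<open>M\<close> comes from the seminorm \<open>lim \<parallel>x S^N\<parallel>\<close>. In the canonical representation on
sequences indexed by the integers, \<open>U e_k = e_(k+1)\<close> and \<open>S e_k = e_(2k)\<close>, it is the length of the vector
\<open>x e_0\<close> for \<open>x\<close> in \<open>M\<close>. Two facts make it useful.

Trigonometric polynomials in \<open>U\<close> are dense in \<open>M\<close> for this seminorm (\<open>comm_U_approx_Trig\<close>). Averaging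
over conjugation by powers of \<open>U\<close> fixes \<open>M\<close>; it sends the monomials of degree \<open>0\<close> to trigonometric
polynomials, and the seminorms of the averages of all other monomials tend to \<open>0\<close>. In norm, already
the averages of \<open>S\<close> do not tend to \<open>0\<close>, since \<open>z\<close> and \<open>z\<^sup>2\<close> agree at \<open>z = 1\<close>; this is why a seminorm
that ignores single points of the circle is the right tool.

The seminorm is a norm on \<open>M\<close> (\<open>comm_U_eq_zero_if\<close>). The elements \<open>x\<close> with \<open>\<parallel>x y S^N\<parallel> \<longlongrightarrow> 0\<close> for all \<open>y\<close>
form an ideal, which plays the role of the kernel of the canonical representation, and this ideal is
zero (\<open>null_ideal_trivial\<close>). This is a gauge-invariant uniqueness argument. A polynomial of
degree \<open>0\<close> is a matrix over trigonometric polynomials; its norm is at most its distance to the ideal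
times a factor that, for fixed matrix size, is polynomial in the degree of the entries. Applied to the
powers \<open>y^(2^l)\<close> of a self-adjoint \<open>y\<close>, where \<open>\<parallel>y^(2^l)\<parallel> = \<parallel>y\<parallel>^(2^l)\<close>, this removes the factor. A general
polynomial splits into its homogeneous parts, at the cost of a factor proportional to the number of
degrees, which the same power trick removes. Density of the polynomials does the rest. The
universal property enters only here, to supply the gauge automorphisms \<open>S \<mapsto> z S\<close>.

Continuity of *-homomorphisms is derived from square roots: if \<open>h\<close> is self-adjoint with \<open>\<parallel>h\<parallel> < 1\<close>, then
\<open>h + i sqrt (1 - h\<^sup>2)\<close> is unitary, and so is its image.\<close>

section \<open>C*-algebras and contractivity of *-homomorphisms\<close>

context cstar_algebra
begin

abbreviation star :: "'a \<Rightarrow> 'a" ("_\<^sup>\<star>" [1000] 999)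
  where "star x \<equiv> adj A x"
abbreviation nrm :: "'a \<Rightarrow> real" ("\<parallel>_\<parallel>")
  where "nrm x \<equiv> cnorm A x"

lemma scl [simp, intro]: "x \<in> carrier A \<Longrightarrow> c \<odot> x \<in> carrier A"
  using smult_closed[of c x] by (simp add: complex_ring_def)

lemma scl_add: "x \<in> carrier A \<Longrightarrow> (c + d) \<odot> x = c \<odot> x \<oplus> d \<odot> x"
  using smult_l_distr[of c d x] by (simp add: complex_ring_def)

lemma scl_scl: "x \<in> carrier A \<Longrightarrow> c \<odot> (d \<odot> x) = (c * d) \<odot> x"
  using smult_assoc1[of c d x] by (simp add: complex_ring_def)

lemma scl_distr: "x \<in> carrier A \<Longrightarrow> y \<in> carrier A \<Longrightarrow> c \<odot> (x \<oplus> y) = c \<odot> x \<oplus> c \<odot> y"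
  using smult_r_distr[of c x y] by (simp add: complex_ring_def)

lemma scl_one [simp]: "x \<in> carrier A \<Longrightarrow> 1 \<odot> x = x"
  using smult_one[of x] by (simp add: complex_ring_def)

lemma scl_zero_left [simp]: "x \<in> carrier A \<Longrightarrow> 0 \<odot> x = \<zero>"
  using smult_l_null[of x] by (simp add: complex_ring_def)

lemma scl_zero_right [simp]: "c \<odot> \<zero> = \<zero>"
  using smult_r_null[of c] by (simp add: complex_ring_def)

lemma uminus_scl: "x \<in> carrier A \<Longrightarrow> \<ominus> x = (-1) \<odot> x"
proof -
  assume x: "x \<in> carrier A"
  have "x \<oplus> (-1) \<odot> x = 1 \<odot> x \<oplus> (-1) \<odot> x" using x by simp
  also have "\<dots> = (1 + (-1)) \<odot> x" using scl_add[OF x, of 1 "-1"] by simp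
  also have "\<dots> = \<zero>" using x by simp
  finally show ?thesis using x by (intro minus_equality) (simp_all add: a_comm)
qed

lemma minus_scl: "x \<in> carrier A \<Longrightarrow> y \<in> carrier A \<Longrightarrow> x \<ominus> y = x \<oplus> (-1) \<odot> y"
  by (simp add: a_minus_def uminus_scl)

declare adj_closed [simp, intro] adj_adj [simp] cnorm_nonneg [simp]

lemma adj_minus: "x \<in> carrier A \<Longrightarrow> y \<in> carrier A \<Longrightarrow> (x \<ominus> y)\<^sup>\<star> = x\<^sup>\<star> \<ominus> y\<^sup>\<star>"
  by (simp add: minus_scl adj_add adj_smult)

lemma adj_one [simp]: "\<one>\<^sup>\<star> = \<one>"
  by (metis adj_adj adj_closed adj_mult l_one one_closed r_one)

lemma adj_zero [simp]: "\<zero>\<^sup>\<star> = \<zero>"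
  using adj_smult[of \<zero> 0] by simp

lemma cnorm_zero [simp]: "\<parallel>\<zero>\<parallel> = 0"
  using cnorm_eq_0[of \<zero>] by simp

lemma cnorm_one [simp]: "\<parallel>\<one>\<parallel> = 1"
  using cstar_identity[of \<one>] cnorm_eq_0[of \<one>] nontrivial by (simp add: power2_eq_square)

lemma cnorm_adj [simp]: "x \<in> carrier A \<Longrightarrow> \<parallel>x\<^sup>\<star>\<parallel> = \<parallel>x\<parallel>"
proof -
  have *: "\<parallel>x\<parallel> \<le> \<parallel>x\<^sup>\<star>\<parallel>" if x: "x \<in> carrier A" for x
  proof (cases "\<parallel>x\<parallel> = 0")
    case False
    have "\<parallel>x\<parallel> * \<parallel>x\<parallel> \<le> \<parallel>x\<^sup>\<star>\<parallel> * \<parallel>x\<parallel>"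
      using cstar_identity[OF x] cnorm_mult[of "x\<^sup>\<star>" x] x by (simp add: power2_eq_square)
    then show ?thesis using False cnorm_nonneg[OF x] by simp
  qed (use x in simp)
  assume "x \<in> carrier A"
  then show ?thesis using *[of x] *[of "x\<^sup>\<star>"] by simp
qed

lemma cnorm_uminus [simp]: "x \<in> carrier A \<Longrightarrow> \<parallel>\<ominus> x\<parallel> = \<parallel>x\<parallel>"
  by (simp add: uminus_scl cnorm_smult)

lemma cnorm_minus_commute: "x \<in> carrier A \<Longrightarrow> y \<in> carrier A \<Longrightarrow> \<parallel>x \<ominus> y\<parallel> = \<parallel>y \<ominus> x\<parallel>"
proof -
  assume "x \<in> carrier A" "y \<in> carrier A"
  moreover from this have "y \<ominus> x = \<ominus> (x \<ominus> y)" by algebra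
  ultimately show ?thesis by simp
qed

lemma cnorm_triangle_minus:
  "x \<in> carrier A \<Longrightarrow> y \<in> carrier A \<Longrightarrow> \<parallel>x \<ominus> y\<parallel> \<le> \<parallel>x\<parallel> + \<parallel>y\<parallel>"
  using cnorm_triangle[of x "\<ominus> y"] by (simp add: a_minus_def)

lemma cnorm_dist_triangle:
  assumes "x \<in> carrier A" "y \<in> carrier A" "z \<in> carrier A"
  shows "\<parallel>x \<ominus> z\<parallel> \<le> \<parallel>x \<ominus> y\<parallel> + \<parallel>y \<ominus> z\<parallel>"
proof -
  have "x \<ominus> z = (x \<ominus> y) \<oplus> (y \<ominus> z)" using assms by algebra
  then show ?thesis using cnorm_triangle[of "x \<ominus> y" "y \<ominus> z"] assms by simp
qed

lemma minus_self [simp]: "x \<in> carrier A \<Longrightarrow> x \<ominus> x = \<zero>"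
  by (simp add: a_minus_def r_neg)

lemma eq_if_minus_eq_zero:
  assumes "x \<in> carrier A" "y \<in> carrier A" "x \<ominus> y = \<zero>" shows "x = y"
proof -
  have "x = (x \<ominus> y) \<oplus> y" using assms(1,2) by algebra
  then show ?thesis using assms by simp
qed

lemma eq_if_cnorm_minus_0: "x \<in> carrier A \<Longrightarrow> y \<in> carrier A \<Longrightarrow> \<parallel>x \<ominus> y\<parallel> = 0 \<Longrightarrow> x = y"
  using cnorm_eq_0[OF minus_closed[of x y]] by (blast intro: eq_if_minus_eq_zero)

lemma eq_if_cnorm_minus_small:
  assumes "x \<in> carrier A" "y \<in> carrier A" "\<And>e. e > 0 \<Longrightarrow> \<parallel>x \<ominus> y\<parallel> \<le> C * e"
  shows "x = y"
proof (rule eq_if_cnorm_minus_0)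
  show "\<parallel>x \<ominus> y\<parallel> = 0"
  proof (rule ccontr)
    assume "\<parallel>x \<ominus> y\<parallel> \<noteq> 0"
    then have p: "\<parallel>x \<ominus> y\<parallel> > 0"
      using cnorm_nonneg[OF minus_closed[OF assms(1,2)]] by linarith
    define e where "e = \<parallel>x \<ominus> y\<parallel> / (2 * (\<bar>C\<bar> + 1))"
    have e: "e > 0" using p by (simp add: e_def)
    have "C * e \<le> (\<bar>C\<bar> + 1) * e" using e by (intro mult_right_mono) auto
    also have "\<dots> = \<parallel>x \<ominus> y\<parallel> / 2" by (simp add: e_def field_simps)
    finally show False using assms(3)[OF e] p by linarith
  qed
qed (use assms in auto)

definition norm_closed :: "'a set \<Rightarrow> bool" where
  "norm_closed C \<longleftrightarrow> C \<subseteq> carrier A \<and>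
     (\<forall>x\<in>carrier A. (\<forall>e>0. \<exists>y\<in>C. \<parallel>x \<ominus> y\<parallel> \<le> e) \<longrightarrow> x \<in> C)"

text \<open>The contraction principle on a closed subset \<open>C\<close>: side conditions on the fixed point, such as being
self-adjoint or commuting with a given element, are put into \<open>C\<close>.\<close>

lemma Banach_fixed_point:
  assumes C: "norm_closed C" and x0: "x0 \<in> C" and F: "\<And>x. x \<in> C \<Longrightarrow> F x \<in> C"
    and r: "0 \<le> r" "r < 1"
    and lip: "\<And>x y. x \<in> C \<Longrightarrow> y \<in> C \<Longrightarrow> \<parallel>F x \<ominus> F y\<parallel> \<le> r * \<parallel>x \<ominus> y\<parallel>"
  shows "\<exists>x\<in>C. F x = x"
proof -
  define X where "X n = (F ^^ n) x0" for n
  have X: "X n \<in> C" for n by (induction n) (auto simp: X_def x0 F)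
  have CA: "x \<in> carrier A" if "x \<in> C" for x using C that by (auto simp: norm_closed_def)
  define B where "B = \<parallel>X 0 \<ominus> X 1\<parallel> / (1 - r)"
  have B: "B \<ge> 0" using r CA X by (simp add: B_def)
  have step: "\<parallel>X n \<ominus> X (Suc n)\<parallel> \<le> r ^ n * (B * (1 - r))" for n
  proof (induction n)
    case 0 then show ?case using r by (simp add: B_def)
  next
    case (Suc n)
    have "\<parallel>X (Suc n) \<ominus> X (Suc (Suc n))\<parallel> \<le> r * \<parallel>X n \<ominus> X (Suc n)\<parallel>"
      using lip[OF X[of n] X[of "Suc n"]] by (simp add: X_def)
    also have "\<dots> \<le> r * (r ^ n * (B * (1 - r)))" using Suc r by (intro mult_left_mono) auto
    finally show ?case by (simp add: mult.assoc)
  qed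
  have far: "\<parallel>X n \<ominus> X (n + k)\<parallel> \<le> B * (r ^ n - r ^ (n + k))" for n k
  proof (induction k)
    case 0 then show ?case using CA[OF X] by simp
  next
    case (Suc k)
    have "\<parallel>X n \<ominus> X (n + Suc k)\<parallel> \<le> \<parallel>X n \<ominus> X (n + k)\<parallel> + \<parallel>X (n + k) \<ominus> X (n + Suc k)\<parallel>"
      using CA[OF X] by (intro cnorm_dist_triangle) auto
    also have "\<dots> \<le> B * (r ^ n - r ^ (n + k)) + r ^ (n + k) * (B * (1 - r))"
      using Suc step[of "n + k"] by simp
    finally show ?case by (simp add: algebra_simps)
  qed
  have far': "\<parallel>X n \<ominus> X m\<parallel> \<le> B * r ^ n" if "n \<le> m" for n m
  proof -
    have "\<parallel>X n \<ominus> X m\<parallel> \<le> B * (r ^ n - r ^ m)" using far[of n "m - n"] that by simp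
    also have "\<dots> \<le> B * r ^ n" using B r by (intro mult_left_mono) auto
    finally show ?thesis .
  qed
  have lim0: "(\<lambda>n. B * r ^ n) \<longlonglongrightarrow> 0"
    using LIMSEQ_power_zero[of r] r by (intro tendsto_mult_right_zero) auto
  have cauchy: "\<forall>e>0. \<exists>N. \<forall>m\<ge>N. \<forall>n\<ge>N. \<parallel>X m \<ominus> X n\<parallel> < e"
  proof (intro allI impI)
    fix e :: real assume "e > 0"
    then obtain N where N: "\<And>n. n \<ge> N \<Longrightarrow> B * r ^ n < e"
      using order_tendstoD(2)[OF lim0] unfolding eventually_sequentially by blast
    show "\<exists>N. \<forall>m\<ge>N. \<forall>n\<ge>N. \<parallel>X m \<ominus> X n\<parallel> < e"
    proof (intro exI allI impI)
      fix m n assume mn: "m \<ge> N" "n \<ge> N"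
      show "\<parallel>X m \<ominus> X n\<parallel> < e"
      proof (cases "m \<le> n")
        case True then show ?thesis using far'[OF True] N[OF mn(1)] by linarith
      next
        case False
        then show ?thesis using far'[of n m] N[OF mn(2)]
            cnorm_minus_commute[OF CA[OF X[of m]] CA[OF X[of n]]] by simp
      qed
    qed
  qed
  have "\<exists>x\<in>carrier A. (\<lambda>n. \<parallel>X n \<ominus> x\<parallel>) \<longlonglongrightarrow> 0"
    using complete[OF _ cauchy] CA[OF X] by blast
  then obtain x where x: "x \<in> carrier A" and lim: "(\<lambda>n. \<parallel>X n \<ominus> x\<parallel>) \<longlonglongrightarrow> 0" by blast
  have near: "\<exists>n. \<parallel>X n \<ominus> x\<parallel> < e \<and> \<parallel>X (Suc n) \<ominus> x\<parallel> < e" if "e > 0" for e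
  proof -
    obtain N where "\<And>n. n \<ge> N \<Longrightarrow> \<parallel>X n \<ominus> x\<parallel> < e"
      using order_tendstoD(2)[OF lim \<open>e > 0\<close>] unfolding eventually_sequentially by blast
    then show ?thesis by (meson le_SucI order_refl)
  qed
  have xC: "x \<in> C"
  proof -
    have "\<exists>y\<in>C. \<parallel>x \<ominus> y\<parallel> \<le> e" if "e > 0" for e
      using near[OF that] X CA[OF X] x cnorm_minus_commute[OF x] by (metis less_eq_real_def)
    then show ?thesis using C x by (auto simp: norm_closed_def)
  qed
  have "F x = x"
  proof (rule eq_if_cnorm_minus_small[where C = 2])
    fix e :: real assume "e > 0"
    then obtain n where n: "\<parallel>X n \<ominus> x\<parallel> < e" "\<parallel>X (Suc n) \<ominus> x\<parallel> < e" using near by blast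
    have "\<parallel>F x \<ominus> x\<parallel> \<le> \<parallel>F x \<ominus> X (Suc n)\<parallel> + \<parallel>X (Suc n) \<ominus> x\<parallel>"
      using x CA[OF X] CA[OF F[OF xC]] by (intro cnorm_dist_triangle)
    also have "\<parallel>F x \<ominus> X (Suc n)\<parallel> \<le> r * \<parallel>x \<ominus> X n\<parallel>"
      using lip[OF xC X[of n]] by (simp add: X_def)
    also have "r * \<parallel>x \<ominus> X n\<parallel> \<le> 1 * \<parallel>x \<ominus> X n\<parallel>"
      using r x CA[OF X] by (intro mult_right_mono) auto
    finally show "\<parallel>F x \<ominus> x\<parallel> \<le> 2 * e"
      using n cnorm_minus_commute[OF x CA[OF X[of n]]] by simp
  qed (use CA xC F in auto)
  then show ?thesis using xC by blast
qed

lemma norm_closed_sa: "norm_closed {x \<in> carrier A. x\<^sup>\<star> = x}"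
  unfolding norm_closed_def
proof (intro conjI ballI impI CollectI)
  fix x assume x: "x \<in> carrier A" and ap: "\<forall>e>0. \<exists>y\<in>{x \<in> carrier A. x\<^sup>\<star> = x}. \<parallel>x \<ominus> y\<parallel> \<le> e"
  show "x\<^sup>\<star> = x"
  proof (rule eq_if_cnorm_minus_small[where C = 2])
    fix e :: real assume "e > 0"
    then obtain y where y: "y \<in> carrier A" "y\<^sup>\<star> = y" "\<parallel>x \<ominus> y\<parallel> \<le> e" using ap by blast
    have "\<parallel>x\<^sup>\<star> \<ominus> x\<parallel> \<le> \<parallel>x\<^sup>\<star> \<ominus> y\<parallel> + \<parallel>y \<ominus> x\<parallel>" using x y by (intro cnorm_dist_triangle) auto
    moreover have "x\<^sup>\<star> \<ominus> y = (x \<ominus> y)\<^sup>\<star>" using x y by (simp add: adj_minus)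
    ultimately show "\<parallel>x\<^sup>\<star> \<ominus> x\<parallel> \<le> 2 * e" using x y cnorm_minus_commute[OF x y(1)] by simp
  qed (use x in auto)
qed auto

lemma norm_closed_commutant:
  assumes h: "h \<in> carrier A" shows "norm_closed {x \<in> carrier A. x \<otimes> h = h \<otimes> x}"
  unfolding norm_closed_def
proof (intro conjI ballI impI CollectI)
  fix x assume x: "x \<in> carrier A"
    and ap: "\<forall>e>0. \<exists>y\<in>{x \<in> carrier A. x \<otimes> h = h \<otimes> x}. \<parallel>x \<ominus> y\<parallel> \<le> e"
  show "x \<otimes> h = h \<otimes> x"
  proof (rule eq_if_cnorm_minus_small[where C = "2 * \<parallel>h\<parallel>"])
    fix e :: real assume "e > 0"
    then obtain y where y: "y \<in> carrier A" "y \<otimes> h = h \<otimes> y" "\<parallel>x \<ominus> y\<parallel> \<le> e" using ap by blast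
    have "x \<otimes> h \<ominus> h \<otimes> x = (x \<ominus> y) \<otimes> h \<ominus> h \<otimes> (x \<ominus> y) \<oplus> (y \<otimes> h \<ominus> h \<otimes> y)" using x y(1) h by algebra
    also have "\<dots> = (x \<ominus> y) \<otimes> h \<ominus> h \<otimes> (x \<ominus> y)" using x y h by simp
    finally have "\<parallel>x \<otimes> h \<ominus> h \<otimes> x\<parallel> \<le> \<parallel>(x \<ominus> y) \<otimes> h\<parallel> + \<parallel>h \<otimes> (x \<ominus> y)\<parallel>"
      using cnorm_triangle_minus[of "(x \<ominus> y) \<otimes> h" "h \<otimes> (x \<ominus> y)"] x y h by simp
    also have "\<dots> \<le> \<parallel>x \<ominus> y\<parallel> * \<parallel>h\<parallel> + \<parallel>h\<parallel> * \<parallel>x \<ominus> y\<parallel>"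
      using cnorm_mult[of "x \<ominus> y" h] cnorm_mult[of h "x \<ominus> y"] x y h by (intro add_mono) auto
    also have "\<dots> \<le> e * \<parallel>h\<parallel> + \<parallel>h\<parallel> * e"
      using y(3) cnorm_nonneg[OF h] by (intro add_mono mult_right_mono mult_left_mono)
    finally show "\<parallel>x \<otimes> h \<ominus> h \<otimes> x\<parallel> \<le> 2 * \<parallel>h\<parallel> * e" by (simp add: mult_ac)
  qed (use x h in auto)
qed auto

lemma norm_closed_cball: "norm_closed {x \<in> carrier A. \<parallel>x\<parallel> \<le> r}"
  unfolding norm_closed_def
proof (intro conjI ballI impI CollectI)
  fix x assume x: "x \<in> carrier A" and ap: "\<forall>e>0. \<exists>y\<in>{x \<in> carrier A. \<parallel>x\<parallel> \<le> r}. \<parallel>x \<ominus> y\<parallel> \<le> e"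
  show "\<parallel>x\<parallel> \<le> r"
  proof (rule field_le_epsilon)
    fix e :: real assume "e > 0"
    then obtain y where y: "y \<in> carrier A" "\<parallel>y\<parallel> \<le> r" "\<parallel>x \<ominus> y\<parallel> \<le> e" using ap by blast
    have "x = (x \<ominus> y) \<oplus> y" using x y(1) by algebra
    then show "\<parallel>x\<parallel> \<le> r + e" using cnorm_triangle[of "x \<ominus> y" y] x y by simp
  qed
qed auto

lemma norm_closed_Int: "norm_closed C \<Longrightarrow> norm_closed D \<Longrightarrow> norm_closed (C \<inter> D)"
  unfolding norm_closed_def by (meson IntD1 IntD2 IntI le_infI1)

text \<open>\<open>k = 1 - y\<close> satisfies \<open>k\<^sup>2 = 1 - h\<^sup>2\<close> as soon as \<open>y = (h\<^sup>2 + y\<^sup>2) / 2\<close>, and the right-hand side is a contraction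
in \<open>y\<close> on a small ball.\<close>

lemma sqrt_one_minus_square:
  assumes h: "h \<in> carrier A" "h\<^sup>\<star> = h" "\<parallel>h\<parallel> < 1"
  shows "\<exists>k\<in>carrier A. k\<^sup>\<star> = k \<and> k \<otimes> h = h \<otimes> k \<and> h \<otimes> h \<oplus> k \<otimes> k = \<one>"
proof -
  define s where "s = \<parallel>h \<otimes> h\<parallel>"
  have s: "0 \<le> s" "s < 1"
    using h cstar_identity[OF h(1)] power_strict_mono[of "\<parallel>h\<parallel>" 1 2] by (auto simp: s_def)
  \<comment> \<open>The smaller root of \<open>(s + r\<^sup>2) / 2 = r\<close>: the map preserves the ball of radius \<open>r\<close> and is \<open>r\<close>-Lipschitz there.\<close>
  define r where "r = 1 - sqrt (1 - s)"
  have r: "0 \<le> r" "r < 1" "(s + r * r) / 2 = r"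
    using s by (auto simp: r_def real_le_lsqrt field_simps)
  define C where "C = {x \<in> carrier A. x\<^sup>\<star> = x} \<inter> {x \<in> carrier A. x \<otimes> h = h \<otimes> x}
    \<inter> {x \<in> carrier A. \<parallel>x\<parallel> \<le> r}"
  define F where "F y = (1/2) \<odot> (h \<otimes> h \<oplus> y \<otimes> y)" for y
  have "\<exists>y\<in>C. F y = y"
  proof (rule Banach_fixed_point[OF _ _ _ r(1,2)])
    show "norm_closed C" unfolding C_def
      using h by (intro norm_closed_Int norm_closed_sa norm_closed_commutant norm_closed_cball)
    show "\<zero> \<in> C" using r h by (auto simp: C_def)
  next
    fix y assume "y \<in> C"
    then have y: "y \<in> carrier A" "y\<^sup>\<star> = y" "y \<otimes> h = h \<otimes> y" "\<parallel>y\<parallel> \<le> r" by (auto simp: C_def)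
    have "(y \<otimes> y) \<otimes> h = h \<otimes> (y \<otimes> y)" using y h by (metis m_assoc)
    then have c: "F y \<otimes> h = h \<otimes> F y"
      using y h by (simp add: F_def smult_mult_left smult_mult_right l_distr r_distr m_assoc)
    have "\<parallel>F y\<parallel> \<le> (s + \<parallel>y\<parallel> * \<parallel>y\<parallel>) / 2"
      using cnorm_triangle[of "h \<otimes> h" "y \<otimes> y"] cnorm_mult[of y y] y h
      by (simp add: F_def cnorm_smult s_def)
    also have "\<dots> \<le> (s + r * r) / 2"
      using y r by (intro divide_right_mono add_left_mono mult_mono) auto
    also have "\<dots> = r" by (rule r)
    finally show "F y \<in> C" using c y h
      by (auto simp: C_def) (auto simp: F_def adj_add adj_smult adj_mult)
  next
    fix x y assume "x \<in> C" "y \<in> C"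
    then have y: "x \<in> carrier A" "y \<in> carrier A" "\<parallel>x\<parallel> \<le> r" "\<parallel>y\<parallel> \<le> r" by (auto simp: C_def)
    have "F x \<ominus> F y = (1/2) \<odot> ((h \<otimes> h \<oplus> x \<otimes> x) \<ominus> (h \<otimes> h \<oplus> y \<otimes> y))"
      using y h by (simp add: F_def minus_scl scl_distr scl_scl)
    also have "(h \<otimes> h \<oplus> x \<otimes> x) \<ominus> (h \<otimes> h \<oplus> y \<otimes> y) = x \<otimes> (x \<ominus> y) \<oplus> (x \<ominus> y) \<otimes> y"
      using y h by algebra
    finally have "\<parallel>F x \<ominus> F y\<parallel> \<le> (\<parallel>x \<otimes> (x \<ominus> y)\<parallel> + \<parallel>(x \<ominus> y) \<otimes> y\<parallel>) / 2"
      using cnorm_triangle[of "x \<otimes> (x \<ominus> y)" "(x \<ominus> y) \<otimes> y"] y by (simp add: cnorm_smult)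
    also have "\<dots> \<le> (\<parallel>x\<parallel> * \<parallel>x \<ominus> y\<parallel> + \<parallel>x \<ominus> y\<parallel> * \<parallel>y\<parallel>) / 2"
      using cnorm_mult[of x "x \<ominus> y"] cnorm_mult[of "x \<ominus> y" y] y by simp
    also have "\<dots> \<le> (r * \<parallel>x \<ominus> y\<parallel> + \<parallel>x \<ominus> y\<parallel> * r) / 2"
      using y r by (intro divide_right_mono add_mono mult_mono) auto
    finally show "\<parallel>F x \<ominus> F y\<parallel> \<le> r * \<parallel>x \<ominus> y\<parallel>" by simp
  qed
  then obtain y where y: "y \<in> carrier A" "y\<^sup>\<star> = y" "y \<otimes> h = h \<otimes> y" and fix_y: "F y = y"
    by (auto simp: C_def)
  have two: "y \<oplus> y = h \<otimes> h \<oplus> y \<otimes> y"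
  proof -
    have "y \<oplus> y = (1/2 + 1/2) \<odot> (h \<otimes> h \<oplus> y \<otimes> y)"
      using fix_y y h by (subst scl_add) (auto simp: F_def)
    then show ?thesis using y h by simp
  qed
  have "(\<one> \<ominus> y) \<otimes> h = h \<otimes> (\<one> \<ominus> y)" using y h by (simp add: minus_scl l_distr r_distr smult_mult_left smult_mult_right)
  moreover have "h \<otimes> h \<oplus> (\<one> \<ominus> y) \<otimes> (\<one> \<ominus> y) = \<one> \<ominus> (y \<oplus> y) \<oplus> (h \<otimes> h \<oplus> y \<otimes> y)"
    using y(1) h(1) by (algebra, simp)
  moreover have "\<dots> = \<one>" unfolding two using y(1) h(1) by algebra
  ultimately show ?thesis using y by (intro bexI[of _ "\<one> \<ominus> y"]) (auto simp: adj_minus)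
qed

lemma isometry_cnorm [simp]:
  assumes "u \<in> carrier A" "u\<^sup>\<star> \<otimes> u = \<one>" shows "\<parallel>u\<parallel> = 1"
  using cstar_identity[OF assms(1)] assms cnorm_nonneg[OF assms(1)]
  by (metis abs_of_nonneg cnorm_one power2_eq_1_iff abs_1 abs_minus_cancel)

text \<open>\<open>a\<close> is the real part of the unitary \<open>a + i b\<close>.\<close>

lemma cnorm_le_1_if_circle:
  assumes a: "a \<in> carrier A" "a\<^sup>\<star> = a" and b: "b \<in> carrier A" "b\<^sup>\<star> = b"
    and ab: "b \<otimes> a = a \<otimes> b" "a \<otimes> a \<oplus> b \<otimes> b = \<one>"
  shows "\<parallel>a\<parallel> \<le> 1"
proof -
  define u where "u = a \<oplus> \<i> \<odot> b"
  have u: "u \<in> carrier A" "u\<^sup>\<star> = a \<oplus> (-\<i>) \<odot> b" using a b by (auto simp: u_def adj_add adj_smult)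
  have "u\<^sup>\<star> \<otimes> u = (a \<otimes> a \<oplus> b \<otimes> b) \<oplus> (\<i> \<odot> (a \<otimes> b) \<oplus> (-\<i>) \<odot> (b \<otimes> a))"
    unfolding u(2) unfolding u_def using a b
    by (simp add: l_distr r_distr smult_mult_left smult_mult_right scl_scl scl_distr a_ac)
  also have "\<dots> = \<one>" using a b ab by (simp flip: scl_add)
  finally have n: "\<parallel>u\<parallel> = 1" using u by simp
  have "a = (1/2) \<odot> (u \<oplus> u\<^sup>\<star>)"
  proof -
    have "u \<oplus> u\<^sup>\<star> = (a \<oplus> a) \<oplus> (\<i> \<odot> b \<oplus> (-\<i>) \<odot> b)"
      unfolding u(2) unfolding u_def using a b by (simp add: a_ac)
    also have "\<dots> = a \<oplus> a" using b a by (simp flip: scl_add)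
    also have "a \<oplus> a = 2 \<odot> a" using scl_add[OF a(1), of 1 1] a by simp
    finally show ?thesis using a by (simp add: scl_scl)
  qed
  then have "\<parallel>a\<parallel> \<le> (\<parallel>u\<parallel> + \<parallel>u\<^sup>\<star>\<parallel>) / 2"
    using cnorm_triangle[of u "u\<^sup>\<star>"] u(1) by (simp add: cnorm_smult del: cnorm_adj)
  then show ?thesis using n u(1) by simp
qed

end

text \<open>For self-adjoint \<open>y\<close> with \<open>\<parallel>y\<parallel> < 1\<close>, the relation \<open>y\<^sup>2 + k\<^sup>2 = 1\<close> is preserved by \<open>h\<close> and bounds the norm of
\<open>h y\<close>. The C*-identity reduces the general case to this one.\<close>

lemma star_hom_cnorm_le:
  fixes A :: "'a cstar_alg" and B :: "'b cstar_alg"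
  assumes "cstar_algebra A" "cstar_algebra B" and h: "h \<in> star_hom A B" and x: "x \<in> carrier A"
  shows "cnorm B (h x) \<le> cnorm A x"
proof -
  interpret A: cstar_algebra A by fact
  interpret B: cstar_algebra B by fact
  have hc: "h y \<in> carrier B" if "y \<in> carrier A" for y
    using h that by (auto simp: star_hom_def ring_hom_def)
  have hm: "h (y \<otimes>\<^bsub>A\<^esub> z) = h y \<otimes>\<^bsub>B\<^esub> h z" "h (y \<oplus>\<^bsub>A\<^esub> z) = h y \<oplus>\<^bsub>B\<^esub> h z"
    if "y \<in> carrier A" "z \<in> carrier A" for y z
    using h that by (auto simp: star_hom_def ring_hom_def)
  have h1: "h \<one>\<^bsub>A\<^esub> = \<one>\<^bsub>B\<^esub>" using h by (auto simp: star_hom_def ring_hom_def)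
  have hs: "h (adj A y) = adj B (h y)" "h (c \<odot>\<^bsub>A\<^esub> y) = c \<odot>\<^bsub>B\<^esub> h y" if "y \<in> carrier A" for y c
    using h that by (auto simp: star_hom_def)
  have unit_ball: "cnorm B (h y) \<le> 1" if y: "y \<in> carrier A" "adj A y = y" "cnorm A y < 1" for y
  proof -
    obtain k where k: "k \<in> carrier A" "adj A k = k" "k \<otimes>\<^bsub>A\<^esub> y = y \<otimes>\<^bsub>A\<^esub> k"
      "y \<otimes>\<^bsub>A\<^esub> y \<oplus>\<^bsub>A\<^esub> k \<otimes>\<^bsub>A\<^esub> k = \<one>\<^bsub>A\<^esub>"
      using A.sqrt_one_minus_square[OF y] by blast
    show ?thesis
    proof (rule B.cnorm_le_1_if_circle)
      show "h k \<otimes>\<^bsub>B\<^esub> h y = h y \<otimes>\<^bsub>B\<^esub> h k" using k y by (simp flip: hm)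
      show "h y \<otimes>\<^bsub>B\<^esub> h y \<oplus>\<^bsub>B\<^esub> h k \<otimes>\<^bsub>B\<^esub> h k = \<one>\<^bsub>B\<^esub>" using k y by (simp flip: hm h1)
    qed (use hc hs(1) k y in \<open>auto simp flip: hs\<close>)
  qed
  have sa: "cnorm B (h y) \<le> cnorm A y" if y: "y \<in> carrier A" "adj A y = y" for y
  proof (rule dense_ge)
    fix t assume t: "cnorm A y < t"
    then have t0: "t > 0" using A.cnorm_nonneg[OF y(1)] by linarith
    have "cnorm B (h (complex_of_real (1/t) \<odot>\<^bsub>A\<^esub> y)) \<le> 1"
      using y t t0 by (intro unit_ball) (auto simp: A.adj_smult A.cnorm_smult norm_divide)
    then show "cnorm B (h y) \<le> t"
      using y t0 hc by (simp add: hs B.cnorm_smult norm_divide field_simps)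
  qed
  have "(cnorm B (h x))\<^sup>2 = cnorm B (h (adj A x \<otimes>\<^bsub>A\<^esub> x))"
    using x hc by (simp add: hm hs B.cstar_identity)
  also have "\<dots> \<le> cnorm A (adj A x \<otimes>\<^bsub>A\<^esub> x)" using x by (intro sa) (auto simp: A.adj_mult)
  also have "\<dots> = (cnorm A x)\<^sup>2" using x by (rule A.cstar_identity)
  finally show ?thesis using x by (simp add: power2_le_iff_abs_le hc)
qed

section \<open>Linear spans and closures\<close>

context cstar_algebra
begin

lemma cnorm_mult_le: "x \<in> carrier A \<Longrightarrow> y \<in> carrier A \<Longrightarrow> \<parallel>x\<parallel> \<le> a \<Longrightarrow> \<parallel>y\<parallel> \<le> b \<Longrightarrow> \<parallel>x \<otimes> y\<parallel> \<le> a * b"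
  using cnorm_mult[of x y] mult_mono[of "\<parallel>x\<parallel>" a "\<parallel>y\<parallel>" b] cnorm_nonneg[of x] cnorm_nonneg[of y] by linarith

lemma half_double [simp]: "x \<in> carrier A \<Longrightarrow> (1/2) \<odot> (x \<oplus> x) = x"
  using scl_add[of x "1/2" "1/2"] by (simp add: scl_distr)

lemma adj_nat_pow: "x \<in> carrier A \<Longrightarrow> (x [^] (n::nat))\<^sup>\<star> = x\<^sup>\<star> [^] n"
proof (induction n)
  case (Suc n)
  have "(x [^] Suc n)\<^sup>\<star> = x\<^sup>\<star> \<otimes> x\<^sup>\<star> [^] n" using Suc by (simp add: adj_mult)
  also have "\<dots> = x\<^sup>\<star> [^] Suc n" using Suc.prems by (metis adj_closed nat_pow_Suc2)
  finally show ?case .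
qed simp

lemma scl_pow: "x \<in> carrier A \<Longrightarrow> (c \<odot> x) [^] (n::nat) = c ^ n \<odot> x [^] n"
  by (induction n) (simp_all add: smult_mult_left smult_mult_right scl_scl mult.commute)

lemma isometry_mult_cnorm:
  assumes "u \<in> carrier A" "u\<^sup>\<star> \<otimes> u = \<one>" "x \<in> carrier A" shows "\<parallel>u \<otimes> x\<parallel> = \<parallel>x\<parallel>"
proof -
  have "(\<parallel>u \<otimes> x\<parallel>)\<^sup>2 = \<parallel>(u \<otimes> x)\<^sup>\<star> \<otimes> (u \<otimes> x)\<parallel>" using assms by (simp add: cstar_identity)
  also have "(u \<otimes> x)\<^sup>\<star> \<otimes> (u \<otimes> x) = x\<^sup>\<star> \<otimes> ((u\<^sup>\<star> \<otimes> u) \<otimes> x)" using assms(1,3) by (simp add: adj_mult m_assoc)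
  also have "\<parallel>\<dots>\<parallel> = \<parallel>x\<parallel>\<^sup>2" using assms by (simp add: cstar_identity)
  finally show ?thesis using assms by simp
qed

inductive_set cspan :: "'a set \<Rightarrow> 'a set" for X where
  zero: "\<zero> \<in> cspan X"
| base: "x \<in> X \<Longrightarrow> x \<in> cspan X"
| add: "x \<in> cspan X \<Longrightarrow> y \<in> cspan X \<Longrightarrow> x \<oplus> y \<in> cspan X"
| scale: "x \<in> cspan X \<Longrightarrow> c \<odot> x \<in> cspan X"

lemma cspan_closed: "x \<in> cspan X \<Longrightarrow> X \<subseteq> carrier A \<Longrightarrow> x \<in> carrier A"
  by (induction rule: cspan.induct) auto

lemma cspan_mono: "x \<in> cspan X \<Longrightarrow> X \<subseteq> Y \<Longrightarrow> x \<in> cspan Y"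
  by (induction rule: cspan.induct) (auto intro: cspan.intros)

lemma cspan_mult:
  assumes X: "X \<subseteq> carrier A" and Y: "Y \<subseteq> carrier A"
    and XY: "\<And>x y. x \<in> X \<Longrightarrow> y \<in> Y \<Longrightarrow> x \<otimes> y \<in> cspan Z"
    and x: "x \<in> cspan X" and y: "y \<in> cspan Y"
  shows "x \<otimes> y \<in> cspan Z"
  using x
proof (induction rule: cspan.induct)
  case zero then show ?case using cspan_closed[OF y Y] by (simp add: cspan.zero)
next
  case (base x)
  show ?case using y
  proof (induction rule: cspan.induct)
    case zero then show ?case using base X by (auto simp: cspan.zero)
  next
    case (base y) then show ?case using XY \<open>x \<in> X\<close> by blast
  next
    case (add y z) then show ?case using base X cspan_closed[OF _ Y]
      by (auto simp: r_distr subset_iff intro: cspan.add)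
  next
    case (scale y c) then show ?case using base X cspan_closed[OF _ Y]
      by (auto simp: smult_mult_right subset_iff intro: cspan.scale)
  qed
next
  case (add y z) then show ?case using cspan_closed[OF _ X] cspan_closed[OF y Y]
    by (auto simp: l_distr intro: cspan.add)
next
  case (scale z c) then show ?case using cspan_closed[OF _ X] cspan_closed[OF y Y]
    by (auto simp: smult_mult_left intro: cspan.scale)
qed

lemma cspan_adj:
  assumes X: "X \<subseteq> carrier A" and XY: "\<And>x. x \<in> X \<Longrightarrow> x\<^sup>\<star> \<in> Y" and x: "x \<in> cspan X"
  shows "x\<^sup>\<star> \<in> cspan Y"
  using x
  by (induction rule: cspan.induct)
    (use cspan_closed[OF _ X] XY in \<open>auto simp: adj_add adj_smult intro: cspan.intros\<close>)

definition subspace :: "'a set \<Rightarrow> bool" where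
  "subspace E \<longleftrightarrow> E \<subseteq> carrier A \<and> \<zero> \<in> E \<and> (\<forall>x\<in>E. \<forall>y\<in>E. x \<oplus> y \<in> E) \<and> (\<forall>c. \<forall>x\<in>E. c \<odot> x \<in> E)"

lemma subspace_cspan: "X \<subseteq> carrier A \<Longrightarrow> subspace (cspan X)"
  unfolding subspace_def by (auto intro: cspan.intros cspan_closed)

lemma cspan_subset: assumes "subspace E" "X \<subseteq> E" shows "cspan X \<subseteq> E"
proof
  fix x assume "x \<in> cspan X"
  then show "x \<in> E" using assms by (induction rule: cspan.induct) (auto simp: subspace_def)
qed

text \<open>Applied to the span of the monomials in the generators, this shows that they approximate every
element.\<close>

lemma cstar_subalgebra_closure:
  assumes P: "P \<subseteq> carrier A" "\<zero> \<in> P"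
    and add: "\<And>x y. x \<in> P \<Longrightarrow> y \<in> P \<Longrightarrow> x \<oplus> y \<in> P"
    and mult: "\<And>x y. x \<in> P \<Longrightarrow> y \<in> P \<Longrightarrow> x \<otimes> y \<in> P"
    and adj: "\<And>x. x \<in> P \<Longrightarrow> x\<^sup>\<star> \<in> P"
    and scale: "\<And>c x. x \<in> P \<Longrightarrow> c \<odot> x \<in> P"
  shows "cstar_subalgebra {x \<in> carrier A. \<forall>e>0. \<exists>y\<in>P. \<parallel>x \<ominus> y\<parallel> \<le> e} A" (is "cstar_subalgebra ?B A")
  unfolding cstar_subalgebra_def
proof (intro conjI ballI allI impI)
  have PA: "y \<in> carrier A" if "y \<in> P" for y using P that by blast
  show "?B \<subseteq> carrier A" by auto
  show "\<zero> \<in> ?B" using P by (auto intro!: bexI[of _ \<zero>])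
  fix x y assume xB: "x \<in> ?B" and yB: "y \<in> ?B"
  then have x: "x \<in> carrier A" and y: "y \<in> carrier A" by auto
  show "x \<oplus> y \<in> ?B"
  proof (intro CollectI conjI allI impI)
    fix e :: real assume "e > 0"
    then have "e / 2 > 0" by simp
    then obtain p q where p: "p \<in> P" "\<parallel>x \<ominus> p\<parallel> \<le> e / 2" and q: "q \<in> P" "\<parallel>y \<ominus> q\<parallel> \<le> e / 2"
      using xB yB by blast
    have "(x \<oplus> y) \<ominus> (p \<oplus> q) = (x \<ominus> p) \<oplus> (y \<ominus> q)" using x y PA[OF p(1)] PA[OF q(1)] by algebra
    then have "\<parallel>(x \<oplus> y) \<ominus> (p \<oplus> q)\<parallel> \<le> e"
      using cnorm_triangle[of "x \<ominus> p" "y \<ominus> q"] p(2) q(2) x y PA[OF p(1)] PA[OF q(1)] by simp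
    then show "\<exists>z\<in>P. \<parallel>(x \<oplus> y) \<ominus> z\<parallel> \<le> e" using add p q by blast
  qed (use x y in auto)
  show "x \<otimes> y \<in> ?B"
  proof (intro CollectI conjI allI impI)
    fix e :: real assume e: "e > 0"
    \<comment> \<open>The bound \<open>1\<close> keeps the approximant of \<open>y\<close> within norm \<open>\<parallel>y\<parallel> + 1\<close>.\<close>
    define d where "d = min 1 (e / (\<parallel>x\<parallel> + \<parallel>y\<parallel> + 1))"
    have xy: "\<parallel>x\<parallel> \<ge> 0" "\<parallel>y\<parallel> \<ge> 0" using x y by auto
    have d: "0 < d" "d \<le> 1" "d \<le> e / (\<parallel>x\<parallel> + \<parallel>y\<parallel> + 1)" using e xy by (auto simp: d_def)
    then have d': "d * (\<parallel>x\<parallel> + \<parallel>y\<parallel> + 1) \<le> e" using xy by (simp add: field_simps)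
    obtain p q where p: "p \<in> P" "\<parallel>x \<ominus> p\<parallel> \<le> d" and q: "q \<in> P" "\<parallel>y \<ominus> q\<parallel> \<le> d"
      using xB yB d(1) by blast
    note pc = PA[OF p(1)] and qc = PA[OF q(1)]
    have "q = y \<ominus> (y \<ominus> q)" using y qc by algebra
    then have "\<parallel>q\<parallel> \<le> \<parallel>y\<parallel> + d" using cnorm_triangle_minus[of y "y \<ominus> q"] y qc q(2) by simp
    then have nq: "\<parallel>q\<parallel> \<le> \<parallel>y\<parallel> + 1" using d by simp
    have "x \<otimes> y \<ominus> p \<otimes> q = x \<otimes> (y \<ominus> q) \<oplus> (x \<ominus> p) \<otimes> q" using x y pc qc by algebra
    then have "\<parallel>x \<otimes> y \<ominus> p \<otimes> q\<parallel> \<le> \<parallel>x \<otimes> (y \<ominus> q)\<parallel> + \<parallel>(x \<ominus> p) \<otimes> q\<parallel>"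
      using x y pc qc by (simp add: cnorm_triangle)
    also have "\<dots> \<le> \<parallel>x\<parallel> * d + d * (\<parallel>y\<parallel> + 1)"
      using x y pc qc p q nq by (intro add_mono cnorm_mult_le) auto
    also have "\<dots> \<le> e" using d' by (simp add: algebra_simps)
    finally show "\<exists>z\<in>P. \<parallel>x \<otimes> y \<ominus> z\<parallel> \<le> e" using mult p q by blast
  qed (use x y in auto)
next
  have PA: "y \<in> carrier A" if "y \<in> P" for y using P that by blast
  fix x assume xB: "x \<in> ?B"
  then have x: "x \<in> carrier A" by auto
  show "x\<^sup>\<star> \<in> ?B"
  proof (intro CollectI conjI allI impI)
    fix e :: real assume "e > 0"
    then obtain p where p: "p \<in> P" "\<parallel>x \<ominus> p\<parallel> \<le> e" using xB by blast
    then have "\<parallel>x\<^sup>\<star> \<ominus> p\<^sup>\<star>\<parallel> \<le> e" using x PA[OF p(1)] by (simp flip: adj_minus)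
    then show "\<exists>z\<in>P. \<parallel>x\<^sup>\<star> \<ominus> z\<parallel> \<le> e" using adj p by blast
  qed (use x in auto)
  fix c :: complex
  show "c \<odot> x \<in> ?B"
  proof (intro CollectI conjI allI impI)
    fix e :: real assume e: "e > 0"
    have c1: "cmod c + 1 > 0" using norm_ge_zero[of c] by linarith
    then have "e / (cmod c + 1) > 0" using e by simp
    then obtain p where p: "p \<in> P" "\<parallel>x \<ominus> p\<parallel> \<le> e / (cmod c + 1)" using xB by blast
    have "c \<odot> x \<ominus> c \<odot> p = c \<odot> (x \<ominus> p)" using x PA[OF p(1)] by (simp add: minus_scl scl_distr scl_scl)
    then have "\<parallel>c \<odot> x \<ominus> c \<odot> p\<parallel> = cmod c * \<parallel>x \<ominus> p\<parallel>" using x PA[OF p(1)] by (simp add: cnorm_smult)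
    also have "\<dots> \<le> (cmod c + 1) * (e / (cmod c + 1))"
      using p x PA[OF p(1)] c1 by (intro mult_mono) auto
    also have "\<dots> = e" using c1 by simp
    finally show "\<exists>z\<in>P. \<parallel>c \<odot> x \<ominus> z\<parallel> \<le> e" using scale p by blast
  qed (use x in auto)
next
  have PA: "y \<in> carrier A" if "y \<in> P" for y using P that by blast
  fix X :: "nat \<Rightarrow> 'a" and x assume x: "x \<in> carrier A"
  assume X: "range X \<subseteq> ?B \<and> (\<lambda>n. \<parallel>X n \<ominus> x\<parallel>) \<longlonglongrightarrow> 0"
  show "x \<in> ?B"
  proof (intro CollectI conjI allI impI)
    fix e :: real assume "e > 0"
    then have e: "e / 2 > 0" by simp
    obtain n where n: "\<parallel>X n \<ominus> x\<parallel> < e / 2"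
      using order_tendstoD(2)[OF conjunct2[OF X] e] unfolding eventually_sequentially by blast
    have XB: "X n \<in> ?B" using X by auto
    then obtain p where p: "p \<in> P" "\<parallel>X n \<ominus> p\<parallel> \<le> e / 2" using e by blast
    have "\<parallel>x \<ominus> p\<parallel> \<le> \<parallel>x \<ominus> X n\<parallel> + \<parallel>X n \<ominus> p\<parallel>" using x PA[OF p(1)] XB by (intro cnorm_dist_triangle) auto
    also have "\<parallel>x \<ominus> X n\<parallel> = \<parallel>X n \<ominus> x\<parallel>" using x XB by (intro cnorm_minus_commute) auto
    finally show "\<exists>z\<in>P. \<parallel>x \<ominus> z\<parallel> \<le> e" using n p by (intro bexI[of _ p]) auto
  qed (use x in auto)
qed

lemma cstar_generated_subset: "cstar_subalgebra B A \<Longrightarrow> X \<subseteq> B \<Longrightarrow> cstar_generated A X \<subseteq> B"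
  unfolding cstar_generated_def by blast

end

section \<open>The generators and their monomials\<close>

locale two_adic = cstar_algebra A for A :: "'a cstar_alg" (structure) +
  fixes U S :: 'a
  assumes relations: "Q2_relations A U S"
    and generated: "cstar_generated A {U, S} = carrier A"
    and universal: "\<And>(B :: 'a cstar_alg) u s. cstar_algebra B \<Longrightarrow> Q2_relations B u s
      \<Longrightarrow> \<exists>h \<in> star_hom A B. h U = u \<and> h S = s"
begin

lemma U [simp]: "U \<in> carrier A" and S [simp]: "S \<in> carrier A"
  using relations by (auto simp: Q2_relations_def)

lemma U_unitary: "U\<^sup>\<star> \<otimes> U = \<one>" "U \<otimes> U\<^sup>\<star> = \<one>"
  and S_isometry: "S\<^sup>\<star> \<otimes> S = \<one>"
  and SU: "S \<otimes> U = U [^] (2::nat) \<otimes> S"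
  and resolution: "S \<otimes> S\<^sup>\<star> \<oplus> U \<otimes> S \<otimes> S\<^sup>\<star> \<otimes> U\<^sup>\<star> = \<one>"
  using relations by (auto simp: Q2_relations_def)

text \<open>Integer powers of \<open>U\<close>. The inverse is spelled as the adjoint, so that \<open>Up\<close> needs no detour through the
group of units.\<close>

definition Up :: "int \<Rightarrow> 'a" where
  "Up k = (if k \<ge> 0 then U [^] nat k else U\<^sup>\<star> [^] nat (- k))"

lemma Up_int: "Up (int n) = U [^] n" and Up_neg: "Up (- int n) = U\<^sup>\<star> [^] n"
  by (simp_all add: Up_def)

lemma Up_closed [simp]: "Up k \<in> carrier A"
  by (cases k rule: int_cases2) (simp_all add: Up_int Up_neg)

lemma Up_0 [simp]: "Up 0 = \<one>" by (simp add: Up_def)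

lemma Up_1: "Up 1 = U" by (simp add: Up_def)

lemma Up_plus1: "Up (k + 1) = U \<otimes> Up k"
proof (cases "k \<ge> 0")
  case True
  then obtain n where n: "k = int n" "k + 1 = int (Suc n)" by (metis nonneg_int_cases int_ops(4) add.commute)
  show ?thesis unfolding n(2) unfolding n(1) Up_int by (rule nat_pow_Suc2) simp
next
  case False
  define n where "n = nat (- k - 1)"
  have n: "k = - int (Suc n)" "k + 1 = - int n" using False by (auto simp: n_def)
  have 1: "Up (k + 1) = U\<^sup>\<star> [^] n" unfolding n(2) by (rule Up_neg)
  have 2: "Up k = U\<^sup>\<star> \<otimes> U\<^sup>\<star> [^] n" unfolding n(1) Up_neg by (rule nat_pow_Suc2) simp
  have "U \<otimes> Up k = (U \<otimes> U\<^sup>\<star>) \<otimes> U\<^sup>\<star> [^] n" unfolding 2 by (simp add: m_assoc)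
  then show ?thesis by (simp add: 1 U_unitary)
qed

lemma Up_minus1: "Up (k - 1) = U\<^sup>\<star> \<otimes> Up k"
proof -
  have "U\<^sup>\<star> \<otimes> Up (k - 1 + 1) = (U\<^sup>\<star> \<otimes> U) \<otimes> Up (k - 1)" unfolding Up_plus1 by (simp add: m_assoc)
  then show ?thesis by (simp add: U_unitary)
qed

lemma Up_add: "Up (k + l) = Up k \<otimes> Up l"
proof (induction k rule: int_induct[of _ 0])
  case base then show ?case by simp
next
  case (step1 i)
  have "Up (i + 1 + l) = U \<otimes> Up (i + l)" using Up_plus1[of "i + l"] by (simp add: add_ac)
  then show ?case using step1 by (simp add: Up_plus1 m_assoc)
next
  case (step2 i)
  have "Up (i - 1 + l) = U\<^sup>\<star> \<otimes> Up (i + l)" using Up_minus1[of "i + l"] by (simp add: algebra_simps)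
  then show ?case using step2 by (simp add: Up_minus1 m_assoc)
qed

lemma Up_mult [simp]: "Up k \<otimes> Up l = Up (k + l)"
  "x \<in> carrier A \<Longrightarrow> Up k \<otimes> (Up l \<otimes> x) = Up (k + l) \<otimes> x"
  by (simp_all add: Up_add m_assoc)

lemma Up_m1: "Up (-1) = U\<^sup>\<star>" using Up_minus1[of 0] by simp

lemma adj_Up [simp]: "(Up k)\<^sup>\<star> = Up (- k)"
proof (induction k rule: int_induct[of _ 0])
  case base then show ?case by simp
next
  case (step1 i)
  have "(Up (i + 1))\<^sup>\<star> = (Up i)\<^sup>\<star> \<otimes> U\<^sup>\<star>" by (simp add: Up_plus1 adj_mult)
  also have "\<dots> = Up (- i) \<otimes> Up (-1)" by (simp only: step1 Up_m1)
  finally show ?case by simp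
next
  case (step2 i)
  have "(Up (i - 1))\<^sup>\<star> = (Up i)\<^sup>\<star> \<otimes> U" by (simp add: Up_minus1 adj_mult)
  also have "\<dots> = Up (- i) \<otimes> Up 1" by (simp only: step2 Up_1)
  finally show ?case by simp
qed

lemma cnorm_Up_mult [simp]: "x \<in> carrier A \<Longrightarrow> \<parallel>Up k \<otimes> x\<parallel> = \<parallel>x\<parallel>"
  by (rule isometry_mult_cnorm) auto

lemma cnorm_Up [simp]: "\<parallel>Up k\<parallel> = 1"
  using cnorm_Up_mult[of \<one> k] by simp

lemma cnorm_mult_Up [simp]: "x \<in> carrier A \<Longrightarrow> \<parallel>x \<otimes> Up k\<parallel> = \<parallel>x\<parallel>"
  using cnorm_adj[of "x \<otimes> Up k"] by (simp add: adj_mult del: cnorm_adj) simp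

lemma S_cancel [simp]: "S\<^sup>\<star> \<otimes> S = \<one>" "x \<in> carrier A \<Longrightarrow> S\<^sup>\<star> \<otimes> (S \<otimes> x) = x"
  by (simp_all add: S_isometry flip: m_assoc)

lemma S_Up: "S \<otimes> Up k = Up (2 * k) \<otimes> S"
proof (induction k rule: int_induct[of _ 0])
  case base then show ?case by simp
next
  have U2: "S \<otimes> Up 1 = Up 2 \<otimes> S" using SU by (simp add: Up_def)
  {
    case (step1 i)
    have "S \<otimes> Up (i + 1) = (S \<otimes> Up 1) \<otimes> Up i" by (simp add: m_assoc add.commute)
    also have "\<dots> = Up 2 \<otimes> (S \<otimes> Up i)" unfolding U2 by (simp add: m_assoc)
    finally show ?case using step1 by (simp add: algebra_simps)
  next
    case (step2 i)
    have "S \<otimes> Up (i - 1) = Up (-2) \<otimes> ((Up 2 \<otimes> S) \<otimes> Up (i - 1))" by (simp add: m_assoc)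
    also have "\<dots> = Up (-2) \<otimes> (S \<otimes> Up i)" unfolding U2[symmetric] by (simp add: m_assoc)
    finally show ?case using step2 by (simp add: algebra_simps)
  }
qed

lemma S_Up_left: "x \<in> carrier A \<Longrightarrow> S \<otimes> (Up k \<otimes> x) = Up (2 * k) \<otimes> (S \<otimes> x)"
  using S_Up[of k] by (simp flip: m_assoc)

lemma adjS_Up: "S\<^sup>\<star> \<otimes> Up (2 * k) = Up k \<otimes> S\<^sup>\<star>"
  using arg_cong[OF S_Up[of "- k"], of "adj A"] by (simp add: adj_mult)

lemma adjS_Up_left: "x \<in> carrier A \<Longrightarrow> S\<^sup>\<star> \<otimes> (Up (2 * k) \<otimes> x) = Up k \<otimes> (S\<^sup>\<star> \<otimes> x)"
  using adjS_Up[of k] by (simp flip: m_assoc)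

text \<open>The ranges of \<open>S\<close> and \<open>U S\<close> are orthogonal: compressing \<open>S S* + U S S* U* = 1\<close> by \<open>S\<close> gives
\<open>1 + z z* = 1\<close> for \<open>z = S* U S\<close>.\<close>

lemma adjS_U_S: "S\<^sup>\<star> \<otimes> (U \<otimes> S) = \<zero>"
proof -
  define z where "z = S\<^sup>\<star> \<otimes> (U \<otimes> S)"
  have z: "z \<in> carrier A" by (simp add: z_def)
  have "\<one> = S\<^sup>\<star> \<otimes> (S \<otimes> S\<^sup>\<star> \<oplus> U \<otimes> S \<otimes> S\<^sup>\<star> \<otimes> U\<^sup>\<star>) \<otimes> S" unfolding resolution by simp
  also have "\<dots> = \<one> \<oplus> z \<otimes> z\<^sup>\<star>" by (simp add: z_def adj_mult r_distr l_distr m_assoc)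
  finally have "\<one> \<oplus> z \<otimes> z\<^sup>\<star> = \<one>" by simp
  moreover have "p = (\<one> \<oplus> p) \<ominus> \<one>" if "p \<in> carrier A" for p using that by algebra
  from this[of "z \<otimes> z\<^sup>\<star>"] have "z \<otimes> z\<^sup>\<star> = (\<one> \<oplus> z \<otimes> z\<^sup>\<star>) \<ominus> \<one>" using z by simp
  ultimately have "z \<otimes> z\<^sup>\<star> = \<zero>" by simp
  then have "\<parallel>z\<^sup>\<star>\<parallel> = 0" using cstar_identity[of "z\<^sup>\<star>"] z by simp
  then show ?thesis using cnorm_eq_0[of z] z by (simp add: z_def)
qed

lemma adjS_Up_S: "S\<^sup>\<star> \<otimes> (Up k \<otimes> S) = (if even k then Up (k div 2) else \<zero>)"
proof (cases "even k")
  case True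
  then obtain l where "k = 2 * l" by blast
  then show ?thesis using adjS_Up_left[of S l] by simp
next
  case False
  then obtain l where l: "k = 2 * l + 1" by (metis oddE)
  have "S\<^sup>\<star> \<otimes> (Up k \<otimes> S) = S\<^sup>\<star> \<otimes> (Up (2 * l) \<otimes> (Up 1 \<otimes> S))" by (simp add: l)
  also have "\<dots> = Up l \<otimes> (S\<^sup>\<star> \<otimes> (U \<otimes> S))" by (simp add: adjS_Up_left Up_1)
  finally show ?thesis using False by (simp add: adjS_U_S)
qed

lemma adjS_Up_S_left:
  "x \<in> carrier A \<Longrightarrow> S\<^sup>\<star> \<otimes> (Up k \<otimes> (S \<otimes> x)) = (if even k then Up (k div 2) \<otimes> x else \<zero>)"
  using adjS_Up_S[of k] by (simp flip: m_assoc split: if_splits)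

lemma S_pow_cancel [simp]: "S\<^sup>\<star> [^] n \<otimes> S [^] (n::nat) = \<one>"
proof (induction n)
  case (Suc n)
  have "S\<^sup>\<star> [^] Suc n \<otimes> S [^] Suc n = S\<^sup>\<star> [^] n \<otimes> (S\<^sup>\<star> \<otimes> (S \<otimes> S [^] n))"
    unfolding nat_pow_Suc2[OF S] by (simp add: m_assoc)
  then show ?case using Suc by simp
qed simp

lemma S_pow_cancel_left [simp]: "x \<in> carrier A \<Longrightarrow> S\<^sup>\<star> [^] n \<otimes> (S [^] (n::nat) \<otimes> x) = x"
  by (simp flip: m_assoc)

lemma cnorm_S_pow_mult [simp]: "x \<in> carrier A \<Longrightarrow> \<parallel>S [^] (n::nat) \<otimes> x\<parallel> = \<parallel>x\<parallel>"
  by (rule isometry_mult_cnorm) (simp_all add: adj_nat_pow)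

lemma cnorm_S_mult [simp]: "x \<in> carrier A \<Longrightarrow> \<parallel>S \<otimes> x\<parallel> = \<parallel>x\<parallel>"
  by (rule isometry_mult_cnorm) simp_all

lemma cnorm_S_pow [simp]: "\<parallel>S [^] (n::nat)\<parallel> = 1"
  using cnorm_S_pow_mult[of \<one> n] by simp

lemma cnorm_adjS_pow [simp]: "\<parallel>S\<^sup>\<star> [^] (n::nat)\<parallel> = 1"
  using cnorm_adj[of "S [^] n"] by (simp add: adj_nat_pow del: cnorm_adj)

lemma S_pow_Up: "S [^] (n::nat) \<otimes> Up k = Up (2 ^ n * k) \<otimes> S [^] n"
proof (induction n arbitrary: k)
  case (Suc n)
  have "S [^] Suc n \<otimes> Up k = S [^] n \<otimes> (S \<otimes> Up k)" by (simp add: m_assoc)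
  also have "\<dots> = (S [^] n \<otimes> Up (2 * k)) \<otimes> S" by (simp add: S_Up m_assoc)
  also have "\<dots> = Up (2 ^ n * (2 * k)) \<otimes> S [^] Suc n" unfolding Suc by (simp add: m_assoc)
  finally show ?case by (simp add: mult_ac)
qed simp

lemma S_pow_Up_left: "x \<in> carrier A \<Longrightarrow> S [^] (n::nat) \<otimes> (Up k \<otimes> x) = Up (2 ^ n * k) \<otimes> (S [^] n \<otimes> x)"
  using S_pow_Up[of n k] by (simp flip: m_assoc)

lemma adjS_pow_Up: "S\<^sup>\<star> [^] (n::nat) \<otimes> Up (2 ^ n * k) = Up k \<otimes> S\<^sup>\<star> [^] n"
  using arg_cong[OF S_pow_Up[of n "- k"], of "adj A"] by (simp add: adj_mult adj_nat_pow)

text \<open>In the canonical representation: the range of \<open>S^n\<close> belongs to the multiples of \<open>2^n\<close>, and shifting it by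
\<open>k\<close> either maps it to itself or makes it orthogonal to itself. Compressing a trigonometric polynomial
by \<open>S^n\<close> with large \<open>n\<close> thus extracts its constant coefficient.\<close>

lemma adjS_pow_Up_S_pow:
  "S\<^sup>\<star> [^] (n::nat) \<otimes> (Up k \<otimes> S [^] n) = (if 2 ^ n dvd k then Up (k div 2 ^ n) else \<zero>)"
proof (induction n arbitrary: k)
  case (Suc n)
  have "S\<^sup>\<star> [^] Suc n \<otimes> (Up k \<otimes> S [^] Suc n) = S\<^sup>\<star> [^] n \<otimes> (S\<^sup>\<star> \<otimes> (Up k \<otimes> (S \<otimes> S [^] n)))"
    unfolding nat_pow_Suc2[OF S] by (simp add: m_assoc)
  also have "\<dots> = (if even k then S\<^sup>\<star> [^] n \<otimes> (Up (k div 2) \<otimes> S [^] n) else \<zero>)"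
    by (simp add: adjS_Up_S_left)
  also have "\<dots> = (if even k \<and> 2 ^ n dvd k div 2 then Up (k div 2 div 2 ^ n) else \<zero>)"
    using Suc by simp
  also have "even k \<and> 2 ^ n dvd k div 2 \<longleftrightarrow> 2 ^ Suc n dvd k" by auto
  also have "k div 2 div 2 ^ n = k div 2 ^ Suc n" by (simp add: zdiv_zmult2_eq)
  finally show ?case .
qed simp

definition mon :: "int \<Rightarrow> nat \<Rightarrow> nat \<Rightarrow> int \<Rightarrow> 'a" where
  "mon a m n b = Up a \<otimes> (S [^] m \<otimes> (S\<^sup>\<star> [^] n \<otimes> Up b))"

lemma mon_closed [simp]: "mon a m n b \<in> carrier A" by (simp add: mon_def)

lemma adj_mon: "(mon a m n b)\<^sup>\<star> = mon (- b) n m (- a)"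
  by (simp add: mon_def adj_mult adj_nat_pow m_assoc)

text \<open>The set \<open>D\<close> restricts the gauge degree \<open>m - n\<close>.\<close>

definition mons :: "int set \<Rightarrow> 'a set" where
  "mons D = {mon a m n b | a m n b. int m - int n \<in> D}"

lemma mons_closed [simp]: "mons D \<subseteq> carrier A" by (auto simp: mons_def)

text \<open>The inner factor of a product of two monomials is again a monomial, of the right degree, or zero; this
makes the span of the monomials an algebra graded by degree.\<close>

lemma adjS_pow_Up_S_pow_mon:
  "S\<^sup>\<star> [^] n \<otimes> (Up c \<otimes> S [^] m) = \<zero> \<or>
   (\<exists>a p q b. int p - int q = int m - int n \<and> S\<^sup>\<star> [^] n \<otimes> (Up c \<otimes> S [^] m) = mon a p q b)"
proof (cases "n \<le> m")
  case True
  have "S [^] m = S [^] n \<otimes> S [^] (m - n)" using True by (simp add: nat_pow_mult)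
  then have *: "S\<^sup>\<star> [^] n \<otimes> (Up c \<otimes> S [^] m) = (S\<^sup>\<star> [^] n \<otimes> (Up c \<otimes> S [^] n)) \<otimes> S [^] (m - n)"
    by (simp add: m_assoc)
  also have "\<dots> = (if 2 ^ n dvd c then mon (c div 2 ^ n) (m - n) 0 0 else \<zero>)" (is "_ = ?rhs")
    by (simp add: adjS_pow_Up_S_pow mon_def)
  finally have "S\<^sup>\<star> [^] n \<otimes> (Up c \<otimes> S [^] m) = ?rhs" unfolding * .
  moreover have "int (m - n) - int 0 = int m - int n" using True by simp
  ultimately show ?thesis by metis
next
  case False
  have "S\<^sup>\<star> [^] n = S\<^sup>\<star> [^] (n - m) \<otimes> S\<^sup>\<star> [^] m" using False by (simp add: nat_pow_mult)
  then have "S\<^sup>\<star> [^] n \<otimes> (Up c \<otimes> S [^] m) = S\<^sup>\<star> [^] (n - m) \<otimes> (S\<^sup>\<star> [^] m \<otimes> (Up c \<otimes> S [^] m))"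
    by (simp add: m_assoc)
  also have "\<dots> = (if 2 ^ m dvd c then mon 0 0 (n - m) (c div 2 ^ m) else \<zero>)"
    by (simp add: adjS_pow_Up_S_pow mon_def)
  finally have "S\<^sup>\<star> [^] n \<otimes> (Up c \<otimes> S [^] m) = (if 2 ^ m dvd c then mon 0 0 (n - m) (c div 2 ^ m) else \<zero>)" .
  moreover have "int 0 - int (n - m) = int m - int n" using False by simp
  ultimately show ?thesis by metis
qed

lemma mon_mult_mid:
  assumes "S\<^sup>\<star> [^] n \<otimes> (Up (b + a') \<otimes> S [^] m') = mon a'' p q b''"
  shows "mon a m n b \<otimes> mon a' m' n' b' = mon (a + 2 ^ m * a'') (m + p) (n' + q) (2 ^ n' * b'' + b')"
proof -
  have *: "Up b'' \<otimes> S\<^sup>\<star> [^] n' = S\<^sup>\<star> [^] n' \<otimes> Up (2 ^ n' * b'')" by (simp add: adjS_pow_Up)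
  have "mon a m n b \<otimes> mon a' m' n' b' =
    Up a \<otimes> (S [^] m \<otimes> ((S\<^sup>\<star> [^] n \<otimes> (Up (b + a') \<otimes> S [^] m')) \<otimes> (S\<^sup>\<star> [^] n' \<otimes> Up b')))"
    by (simp add: mon_def m_assoc)
  also have "\<dots> = Up a \<otimes> ((S [^] m \<otimes> Up a'') \<otimes> (S [^] p \<otimes> (S\<^sup>\<star> [^] q \<otimes> ((Up b'' \<otimes> S\<^sup>\<star> [^] n') \<otimes> Up b'))))"
    unfolding assms mon_def by (simp add: m_assoc)
  also have "\<dots> = Up (a + 2 ^ m * a'') \<otimes> ((S [^] m \<otimes> S [^] p) \<otimes> ((S\<^sup>\<star> [^] q \<otimes> S\<^sup>\<star> [^] n') \<otimes> Up (2 ^ n' * b'' + b')))"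
    unfolding * S_pow_Up by (simp add: m_assoc)
  also have "\<dots> = mon (a + 2 ^ m * a'') (m + p) (n' + q) (2 ^ n' * b'' + b')"
    by (simp add: mon_def nat_pow_mult add.commute)
  finally show ?thesis .
qed

lemma mon_mult:
  "mon a m n b \<otimes> mon a' m' n' b' = \<zero> \<or> mon a m n b \<otimes> mon a' m' n' b' \<in> mons {int m - int n + (int m' - int n')}"
proof -
  consider "S\<^sup>\<star> [^] n \<otimes> (Up (b + a') \<otimes> S [^] m') = \<zero>"
    | a'' p q b'' where "int p - int q = int m' - int n"
      "S\<^sup>\<star> [^] n \<otimes> (Up (b + a') \<otimes> S [^] m') = mon a'' p q b''"
    using adjS_pow_Up_S_pow_mon by blast
  then show ?thesis
  proof cases
    case 1
    have "mon a m n b \<otimes> mon a' m' n' b' =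
      Up a \<otimes> (S [^] m \<otimes> ((S\<^sup>\<star> [^] n \<otimes> (Up (b + a') \<otimes> S [^] m')) \<otimes> (S\<^sup>\<star> [^] n' \<otimes> Up b')))"
      by (simp add: mon_def m_assoc)
    then show ?thesis unfolding 1 by simp
  next
    case 2
    then show ?thesis unfolding mon_mult_mid[OF 2(2)] mons_def
      by (intro disjI2 CollectI exI conjI) (rule refl, simp)
  qed
qed

definition Pol :: "int set \<Rightarrow> 'a set" where "Pol D = cspan (mons D)"

lemma Pol_closed: "x \<in> Pol D \<Longrightarrow> x \<in> carrier A"
  unfolding Pol_def by (rule cspan_closed) (auto simp: mons_def)

lemma Pol_mult:
  assumes "x \<in> Pol D" "y \<in> Pol E" "\<And>d e. d \<in> D \<Longrightarrow> e \<in> E \<Longrightarrow> d + e \<in> F"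
  shows "x \<otimes> y \<in> Pol F"
  unfolding Pol_def
proof (rule cspan_mult[of "mons D" "mons E"])
  fix x y assume "x \<in> mons D" "y \<in> mons E"
  then obtain a m n b a' m' n' b' where *: "x = mon a m n b" "int m - int n \<in> D"
    "y = mon a' m' n' b'" "int m' - int n' \<in> E" unfolding mons_def by blast
  have "mons {int m - int n + (int m' - int n')} \<subseteq> mons F" using assms(3)[OF *(2,4)] unfolding mons_def by fastforce
  then show "x \<otimes> y \<in> cspan (mons F)" using mon_mult[of a m n b a' m' n' b'] *
    by (auto intro: cspan.zero cspan.base)
qed (use assms in \<open>auto simp: Pol_def\<close>)

lemma Pol_adj: "x \<in> Pol D \<Longrightarrow> x\<^sup>\<star> \<in> Pol (uminus ` D)"
  unfolding Pol_def
proof (erule cspan_adj[rotated 2])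
  fix x assume "x \<in> mons D"
  then obtain a m n b where *: "x = mon a m n b" "int m - int n \<in> D" unfolding mons_def by blast
  have "int n - int m = - (int m - int n)" by simp
  then show "x\<^sup>\<star> \<in> mons (uminus ` D)" using * unfolding mons_def
    by (auto simp: adj_mon intro!: exI image_eqI[of _ _ "int m - int n"])
qed auto

lemma Pol_dense: assumes x: "x \<in> carrier A" and e: "e > 0" shows "\<exists>y\<in>Pol UNIV. \<parallel>x \<ominus> y\<parallel> \<le> e"
proof -
  let ?B = "{x \<in> carrier A. \<forall>e>0. \<exists>y\<in>Pol UNIV. \<parallel>x \<ominus> y\<parallel> \<le> e}"
  have sub: "cstar_subalgebra ?B A"
  proof (rule cstar_subalgebra_closure)
    show "x \<otimes> y \<in> Pol UNIV" if "x \<in> Pol UNIV" "y \<in> Pol UNIV" for x y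
      using that by (rule Pol_mult) auto
    show "x\<^sup>\<star> \<in> Pol UNIV" if "x \<in> Pol UNIV" for x using Pol_adj[OF that] by simp
  qed (auto simp: Pol_def intro: cspan.intros Pol_closed[unfolded Pol_def])
  have "U = mon 1 0 0 0" "S = mon 0 1 0 0" by (simp_all add: mon_def Up_1)
  then have "U \<in> Pol UNIV" "S \<in> Pol UNIV" unfolding Pol_def mons_def by (blast intro: cspan.base)+
  then have "{U, S} \<subseteq> ?B" by (force intro: bexI[of _ U] bexI[of _ S])
  then have "cstar_generated A {U, S} \<subseteq> ?B" by (rule cstar_generated_subset[OF sub])
  then have "carrier A \<subseteq> ?B" by (simp only: generated)
  then show ?thesis using x e by blast
qed

section \<open>Averaging over conjugation by powers of U\<close>

text \<open>\<open>mean j y\<close> is the average of \<open>U^k y U^(-k)\<close> over \<open>k < 2^j\<close>; lengths that are powers of two match the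
relation \<open>S U = U\<^sup>2 S\<close>.\<close>

primrec mean :: "nat \<Rightarrow> 'a \<Rightarrow> 'a" where
  "mean 0 y = y"
| "mean (Suc j) y = (1/2) \<odot> (mean j y \<oplus> Up (2 ^ j) \<otimes> (mean j y \<otimes> Up (- (2 ^ j))))"

lemma mean_closed [simp]: "y \<in> carrier A \<Longrightarrow> mean j y \<in> carrier A"
  by (induction j) auto

lemma mean_zero [simp]: "mean j \<zero> = \<zero>"
  by (induction j) auto

lemma mean_add: "x \<in> carrier A \<Longrightarrow> y \<in> carrier A \<Longrightarrow> mean j (x \<oplus> y) = mean j x \<oplus> mean j y"
  by (induction j) (simp_all add: l_distr r_distr scl_distr a_ac)

lemma mean_scl: "x \<in> carrier A \<Longrightarrow> mean j (c \<odot> x) = c \<odot> mean j x"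
  by (induction j) (simp_all add: smult_mult_left smult_mult_right scl_distr scl_scl mult.commute)

lemma mean_minus: "x \<in> carrier A \<Longrightarrow> y \<in> carrier A \<Longrightarrow> mean j (x \<ominus> y) = mean j x \<ominus> mean j y"
  by (simp add: minus_scl mean_add mean_scl)

lemma mean_adj: "x \<in> carrier A \<Longrightarrow> mean j (x\<^sup>\<star>) = (mean j x)\<^sup>\<star>"
  by (induction j) (simp_all add: adj_add adj_mult adj_smult m_assoc)

lemma cnorm_mean_le: "x \<in> carrier A \<Longrightarrow> \<parallel>mean j x\<parallel> \<le> \<parallel>x\<parallel>"
proof (induction j)
  case (Suc j)
  have "\<parallel>mean j x \<oplus> Up (2 ^ j) \<otimes> (mean j x \<otimes> Up (- (2 ^ j)))\<parallel> \<le> \<parallel>mean j x\<parallel> + \<parallel>mean j x\<parallel>"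
    using cnorm_triangle[of "mean j x" "Up (2 ^ j) \<otimes> (mean j x \<otimes> Up (- (2 ^ j)))"] Suc.prems by simp
  then show ?case using Suc by (simp add: cnorm_smult)
qed simp

definition comm_U :: "'a set" where "comm_U = {x \<in> carrier A. x \<otimes> U = U \<otimes> x}"

lemma comm_U_closed: "x \<in> comm_U \<Longrightarrow> x \<in> carrier A" by (simp add: comm_U_def)

lemma comm_U_Up: assumes x: "x \<in> comm_U" shows "x \<otimes> Up k = Up k \<otimes> x"
proof (induction k rule: int_induct[of _ 0])
  case base then show ?case using comm_U_closed[OF x] by simp
next
  have xU: "x \<otimes> U = U \<otimes> x" and xc: "x \<in> carrier A" using x by (auto simp: comm_U_def)
  {
    case (step1 i)
    have "x \<otimes> Up (i + 1) = (x \<otimes> U) \<otimes> Up i" using xc by (simp add: Up_plus1 m_assoc)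
    also have "\<dots> = U \<otimes> (x \<otimes> Up i)" unfolding xU using xc by (simp add: m_assoc)
    finally show ?case unfolding step1 using xc by (simp add: Up_plus1 m_assoc)
  next
    case (step2 i)
    have "x \<otimes> Up (i - 1) = U\<^sup>\<star> \<otimes> ((U \<otimes> x) \<otimes> Up (i - 1))"
      using xc by (simp add: U_unitary flip: m_assoc)
    also have "\<dots> = U\<^sup>\<star> \<otimes> (x \<otimes> (U \<otimes> Up (i - 1)))" unfolding xU[symmetric] using xc by (simp add: m_assoc)
    also have "U \<otimes> Up (i - 1) = Up i" using Up_plus1[of "i - 1"] by simp
    also have "U\<^sup>\<star> \<otimes> (x \<otimes> Up i) = U\<^sup>\<star> \<otimes> (Up i \<otimes> x)" unfolding step2 ..
    finally show ?case using xc by (simp add: Up_minus1 m_assoc)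
  }
qed

lemma comm_U_Up_left: "x \<in> comm_U \<Longrightarrow> y \<in> carrier A \<Longrightarrow> x \<otimes> (Up k \<otimes> y) = Up k \<otimes> (x \<otimes> y)"
  using comm_U_Up[of x k] by (simp add: comm_U_closed flip: m_assoc)

lemma comm_U_I: "x \<in> carrier A \<Longrightarrow> (\<And>k. x \<otimes> Up k = Up k \<otimes> x) \<Longrightarrow> x \<in> comm_U"
  using Up_1 by (metis (mono_tags, lifting) comm_U_def mem_Collect_eq)

lemma comm_U_Up_mem [simp]: "Up k \<in> comm_U"
  by (rule comm_U_I) (simp_all add: add.commute)

lemma comm_U_one [simp]: "\<one> \<in> comm_U" using comm_U_Up_mem[of 0] by simp

lemma comm_U_add: "x \<in> comm_U \<Longrightarrow> y \<in> comm_U \<Longrightarrow> x \<oplus> y \<in> comm_U"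
  by (auto simp: comm_U_def l_distr r_distr)

lemma comm_U_scl: "x \<in> comm_U \<Longrightarrow> c \<odot> x \<in> comm_U"
  by (auto simp: comm_U_def smult_mult_left smult_mult_right)

lemma comm_U_zero [simp]: "\<zero> \<in> comm_U"
  by (simp add: comm_U_def)

declare comm_U_closed [simp]

lemma comm_U_minus: "x \<in> comm_U \<Longrightarrow> y \<in> comm_U \<Longrightarrow> x \<ominus> y \<in> comm_U"
  by (simp add: minus_scl comm_U_add comm_U_scl)

lemma comm_U_mult: "x \<in> comm_U \<Longrightarrow> y \<in> comm_U \<Longrightarrow> x \<otimes> y \<in> comm_U"
  by (intro comm_U_I) (auto simp: m_assoc comm_U_Up comm_U_Up_left)

lemma comm_U_adj: assumes x: "x \<in> comm_U" shows "x\<^sup>\<star> \<in> comm_U"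
proof (rule comm_U_I)
  show "x\<^sup>\<star> \<otimes> Up k = Up k \<otimes> x\<^sup>\<star>" for k
    using arg_cong[OF comm_U_Up[OF x, of "- k"], of "adj A"] x by (simp add: adj_mult)
qed (use x in auto)

lemma mean_comm_U: "x \<in> comm_U \<Longrightarrow> mean j x = x"
  by (induction j) (simp_all add: comm_U_Up)

lemma mean_Up_mult: "x \<in> carrier A \<Longrightarrow> mean j (Up a \<otimes> x) = Up a \<otimes> mean j x"
  by (induction j) (simp_all add: smult_mult_right r_distr m_assoc add.commute)

lemma mean_mult_Up: "x \<in> carrier A \<Longrightarrow> mean j (x \<otimes> Up a) = mean j x \<otimes> Up a"
  by (induction j) (simp_all add: smult_mult_left l_distr m_assoc add.commute)

text \<open>Conjugating \<open>S x S*\<close> by \<open>U^(2k)\<close> is conjugating \<open>x\<close> by \<open>U^k\<close>, and odd powers contribute one more \<open>U\<close>.\<close>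

lemma mean_conj_S:
  "x \<in> carrier A \<Longrightarrow> mean (Suc j) (S \<otimes> (x \<otimes> S\<^sup>\<star>)) =
    (1/2) \<odot> (S \<otimes> (mean j x \<otimes> S\<^sup>\<star>) \<oplus> Up 1 \<otimes> (S \<otimes> (mean j x \<otimes> (S\<^sup>\<star> \<otimes> Up (-1)))))"
proof (induction j)
  case 0 then show ?case by (simp add: m_assoc)
next
  case (Suc j)
  define y where "y = mean j x"
  have y: "y \<in> carrier A" using Suc.prems by (simp add: y_def)
  have e: "S\<^sup>\<star> \<otimes> Up (- (2 * 2 ^ j)) = Up (- (2 ^ j)) \<otimes> S\<^sup>\<star>"
    using adjS_Up[of "- (2 ^ j)"] by simp
  have 1: "Up (2 * 2 ^ j) \<otimes> (S \<otimes> (y \<otimes> (S\<^sup>\<star> \<otimes> Up (- (2 * 2 ^ j)))))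
    = S \<otimes> (Up (2 ^ j) \<otimes> (y \<otimes> (Up (- (2 ^ j)) \<otimes> S\<^sup>\<star>)))"
    unfolding e using y by (simp add: S_Up_left)
  have e': "S\<^sup>\<star> \<otimes> Up (-1 - 2 * 2 ^ j) = Up (- (2 ^ j)) \<otimes> (S\<^sup>\<star> \<otimes> Up (-1))"
  proof -
    have "Up (-1 - 2 * 2 ^ j) = Up (2 * - (2 ^ j)) \<otimes> Up (-1)" by (simp add: algebra_simps)
    then show ?thesis using adjS_Up_left[of "Up (-1)" "- (2 ^ j)"] by simp
  qed
  have 2: "Up (2 * 2 ^ j + 1) \<otimes> (S \<otimes> (y \<otimes> (S\<^sup>\<star> \<otimes> Up (-1 - 2 * 2 ^ j))))
    = Up 1 \<otimes> (S \<otimes> (Up (2 ^ j) \<otimes> (y \<otimes> (Up (- (2 ^ j)) \<otimes> (S\<^sup>\<star> \<otimes> Up (-1))))))"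
    unfolding e' using y by (simp add: S_Up_left add.commute)
  show ?case
    unfolding mean.simps(2)[of "Suc j" "S \<otimes> (x \<otimes> S\<^sup>\<star>)"] Suc.IH[OF Suc.prems]
    unfolding mean.simps(2)[of j x] y_def[symmetric]
    using y 1 2
    by (simp add: smult_mult_left smult_mult_right l_distr r_distr m_assoc scl_distr scl_scl a_ac)
qed

lemma mean_S_pow_adjS_pow:
  "m \<le> j \<Longrightarrow> mean j (S [^] (m::nat) \<otimes> S\<^sup>\<star> [^] m) = (1 / 2 ^ m) \<odot> \<one>"
proof (induction m arbitrary: j)
  case 0 then show ?case using mean_comm_U[of \<one>] by simp
next
  case (Suc m)
  then obtain i where i: "j = Suc i" "m \<le> i" by (cases j) auto
  define x where "x = S [^] m \<otimes> S\<^sup>\<star> [^] m"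
  have x: "x \<in> carrier A" by (simp add: x_def)
  have "S [^] Suc m \<otimes> S\<^sup>\<star> [^] Suc m = S \<otimes> (x \<otimes> S\<^sup>\<star>)"
    unfolding nat_pow_Suc2[OF S] by (simp add: x_def m_assoc)
  then have "mean j (S [^] Suc m \<otimes> S\<^sup>\<star> [^] Suc m) =
    (1/2) \<odot> (S \<otimes> (mean i x \<otimes> S\<^sup>\<star>) \<oplus> Up 1 \<otimes> (S \<otimes> (mean i x \<otimes> (S\<^sup>\<star> \<otimes> Up (-1)))))"
    unfolding i(1) using mean_conj_S[OF x] by simp
  also have "\<dots> = (1 / 2 ^ Suc m) \<odot> (S \<otimes> S\<^sup>\<star> \<oplus> U \<otimes> S \<otimes> S\<^sup>\<star> \<otimes> U\<^sup>\<star>)"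
    unfolding x_def Suc.IH[OF i(2)]
    by (simp add: smult_mult_left smult_mult_right scl_scl scl_distr m_assoc Up_1 Up_m1)
  finally show ?case unfolding resolution .
qed

text \<open>The average of \<open>U^(q k)\<close> over \<open>k < 2^j\<close>. As \<open>U^k S^d U^(-k) = U^(k (1 - 2^d)) S^d\<close>, it occurs in
\<open>mean j (S^d)\<close> with \<open>q = 1 - 2^d\<close>, which is odd for \<open>d > 0\<close>.\<close>

primrec Up_mean :: "nat \<Rightarrow> int \<Rightarrow> 'a" where
  "Up_mean 0 q = \<one>"
| "Up_mean (Suc j) q = (1/2) \<odot> (Up_mean j (2 * q) \<oplus> Up q \<otimes> Up_mean j (2 * q))"

lemma Up_mean_comm_U [simp]: "Up_mean j q \<in> comm_U"
  by (induction j arbitrary: q) (simp_all add: comm_U_scl comm_U_add comm_U_mult)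

lemma Up_mean_closed [simp]: "Up_mean j q \<in> carrier A" by (rule comm_U_closed) simp

lemma Up_mean_Suc': "Up_mean (Suc j) q = (1/2) \<odot> (Up_mean j q \<oplus> Up (2 ^ j * q) \<otimes> Up_mean j q)"
proof (induction j arbitrary: q)
  case (Suc j)
  have *: "2 ^ j * (2 * q) = 2 ^ Suc j * q" by simp
  show ?case
    unfolding Up_mean.simps(2)[of "Suc j" q] Suc.IH[of "2 * q"] *
    unfolding Up_mean.simps(2)[of j q]
    by (simp add: r_distr scl_distr scl_scl smult_mult_right a_ac add.commute)
qed simp

lemma Up_mean_double_S: "Up_mean j (2 * q) \<otimes> S = S \<otimes> Up_mean j q"
proof (induction j arbitrary: q)
  case (Suc j)
  then show ?case using Suc[of "2 * q"]
    by (simp add: smult_mult_left smult_mult_right l_distr r_distr m_assoc S_Up_left)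
qed simp

lemma Up_mean_adj: "(Up_mean j q)\<^sup>\<star> = Up_mean j (- q)"
proof (induction j arbitrary: q)
  case (Suc j)
  then show ?case using comm_U_Up[OF Up_mean_comm_U[of j "- (2 * q)"], of "- q"]
    by (simp add: adj_smult adj_add adj_mult)
qed simp

text \<open>For odd \<open>q\<close> the two summands have orthogonal ranges.\<close>

lemma cnorm_S_plus_Up_S:
  assumes x: "x \<in> carrier A" and q: "odd q"
  shows "(\<parallel>S \<otimes> x \<oplus> Up q \<otimes> (S \<otimes> x)\<parallel>)\<^sup>2 = 2 * \<parallel>x\<parallel>\<^sup>2"
proof -
  define z where "z = S \<otimes> x \<oplus> Up q \<otimes> (S \<otimes> x)"
  have z: "z \<in> carrier A" "z\<^sup>\<star> = x\<^sup>\<star> \<otimes> S\<^sup>\<star> \<oplus> x\<^sup>\<star> \<otimes> (S\<^sup>\<star> \<otimes> Up (- q))"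
    using x by (simp_all add: z_def adj_add adj_mult m_assoc)
  have "z\<^sup>\<star> \<otimes> z = x\<^sup>\<star> \<otimes> x \<oplus> x\<^sup>\<star> \<otimes> x"
    unfolding z(2) unfolding z_def using x q by (simp add: l_distr r_distr m_assoc adjS_Up_S_left)
  also have "\<dots> = 2 \<odot> (x\<^sup>\<star> \<otimes> x)" using scl_add[of "x\<^sup>\<star> \<otimes> x" 1 1] x by simp
  finally have "\<parallel>z\<^sup>\<star> \<otimes> z\<parallel> = 2 * \<parallel>x\<parallel>\<^sup>2" using x by (simp add: cnorm_smult cstar_identity)
  then show ?thesis using z(1) by (simp add: cstar_identity z_def)
qed

text \<open>The length of an average of \<open>2^j\<close> distinct basis vectors. Splitting off the factor \<open>(1 + U^q) / 2\<close> and
moving \<open>S\<close> to the left through the rest reduces \<open>j\<close> by one and halves the square of the norm.\<close>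

lemma cnorm_Up_mean_S_pow:
  "odd q \<Longrightarrow> (\<parallel>Up_mean j q \<otimes> S [^] (n + j)\<parallel>)\<^sup>2 = (1/2) ^ j"
proof (induction j)
  case (Suc j)
  define x where "x = Up_mean j q \<otimes> S [^] (n + j)"
  have x: "x \<in> carrier A" by (simp add: x_def)
  have "S [^] (n + Suc j) = S \<otimes> S [^] (n + j)" unfolding add_Suc_right by (rule nat_pow_Suc2) simp
  then have "Up_mean j (2 * q) \<otimes> S [^] (n + Suc j) = S \<otimes> x"
    using Up_mean_double_S[of j q] by (simp add: x_def flip: m_assoc)
  then have "Up_mean (Suc j) q \<otimes> S [^] (n + Suc j) = (1/2) \<odot> (S \<otimes> x \<oplus> Up q \<otimes> (S \<otimes> x))"
    by (simp add: smult_mult_left l_distr m_assoc del: nat_pow_Suc add_Suc_right)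
  then have "(\<parallel>Up_mean (Suc j) q \<otimes> S [^] (n + Suc j)\<parallel>)\<^sup>2 = (1/2)\<^sup>2 * (\<parallel>S \<otimes> x \<oplus> Up q \<otimes> (S \<otimes> x)\<parallel>)\<^sup>2"
    using x by (simp add: cnorm_smult power_mult_distrib power_divide)
  also have "\<dots> = (1/2) * \<parallel>x\<parallel>\<^sup>2" unfolding cnorm_S_plus_Up_S[OF x Suc.prems] by (simp add: power2_eq_square)
  finally show ?case using Suc by (simp add: x_def)
qed simp

lemma mean_S_pow: "mean j (S [^] (d::nat)) = Up_mean j (1 - 2 ^ d) \<otimes> S [^] d"
proof (induction j)
  case (Suc j)
  have e0: "S [^] d \<otimes> Up (- (2 ^ j)) = Up (- (2 ^ d * 2 ^ j)) \<otimes> S [^] d" using S_pow_Up[of d "- (2 ^ j)"] by simp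
  have e1: "2 ^ j * (1 - 2 ^ d) = (2 ^ j - 2 ^ d * 2 ^ j :: int)" by (simp add: algebra_simps)
  have e2: "Up (2 ^ j) \<otimes> (mean j (S [^] d) \<otimes> Up (- (2 ^ j))) = Up (2 ^ j * (1 - 2 ^ d)) \<otimes> (Up_mean j (1 - 2 ^ d) \<otimes> S [^] d)"
    unfolding Suc e1 by (simp add: m_assoc e0 comm_U_Up_left[OF Up_mean_comm_U])
  show ?case
    unfolding mean.simps(2) e2 unfolding Suc Up_mean_Suc' by (simp add: smult_mult_left l_distr m_assoc)
qed simp

text \<open>The averages of \<open>y\<close> vanish asymptotically in the seminorm. The factor \<open>Up b\<close>, a change of the base
point from \<open>e_0\<close> to \<open>e_b\<close>, makes the property stable under multiplication by powers of \<open>U\<close> and under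
\<open>y \<mapsto> S y S*\<close>.\<close>

definition asym_null :: "'a \<Rightarrow> bool" where
  "asym_null y \<longleftrightarrow> y \<in> carrier A \<and> (\<forall>b. \<forall>e>0. \<forall>\<^sub>F j in sequentially. \<forall>\<^sub>F N in sequentially.
     \<parallel>mean j y \<otimes> (Up b \<otimes> S [^] N)\<parallel> \<le> e)"

lemma asym_nullI:
  assumes "y \<in> carrier A"
    "\<And>b e. e > 0 \<Longrightarrow> \<forall>\<^sub>F j in sequentially. \<forall>\<^sub>F N in sequentially. \<parallel>mean j y \<otimes> (Up b \<otimes> S [^] (N::nat))\<parallel> \<le> e"
  shows "asym_null y"
  using assms by (simp add: asym_null_def)

lemma asym_nullD:
  assumes "asym_null y"
  shows "y \<in> carrier A"
    "e > 0 \<Longrightarrow> \<forall>\<^sub>F j in sequentially. \<forall>\<^sub>F N in sequentially. \<parallel>mean j y \<otimes> (Up b \<otimes> S [^] (N::nat))\<parallel> \<le> e"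
  using assms by (simp_all add: asym_null_def)

lemma asym_null_zero: "asym_null \<zero>"
  by (rule asym_nullI) auto

lemma asym_null_add: assumes x: "asym_null x" and y: "asym_null y" shows "asym_null (x \<oplus> y)"
proof (rule asym_nullI)
  note xc = asym_nullD(1)[OF x] and yc = asym_nullD(1)[OF y]
  fix b and e :: real assume "e > 0"
  then have e: "e / 2 > 0" by simp
  show "\<forall>\<^sub>F j in sequentially. \<forall>\<^sub>F N in sequentially. \<parallel>mean j (x \<oplus> y) \<otimes> (Up b \<otimes> S [^] N)\<parallel> \<le> e"
    using asym_nullD(2)[OF x e, of b] asym_nullD(2)[OF y e, of b]
  proof eventually_elim
    case (elim j)
    then show ?case
    proof eventually_elim
      case (elim N)
      have "mean j (x \<oplus> y) \<otimes> (Up b \<otimes> S [^] N) = mean j x \<otimes> (Up b \<otimes> S [^] N) \<oplus> mean j y \<otimes> (Up b \<otimes> S [^] N)"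
        using xc yc by (simp add: mean_add l_distr)
      then show ?case using elim xc yc
          cnorm_triangle[of "mean j x \<otimes> (Up b \<otimes> S [^] N)" "mean j y \<otimes> (Up b \<otimes> S [^] N)"] by simp
    qed
  qed
qed (use asym_nullD(1) x y in auto)

lemma asym_null_scl: assumes x: "asym_null x" shows "asym_null (c \<odot> x)"
proof (rule asym_nullI)
  note xc = asym_nullD(1)[OF x]
  fix b and e :: real assume e: "e > 0"
  have c1: "cmod c + 1 > 0" using norm_ge_zero[of c] by linarith
  then have e': "e / (cmod c + 1) > 0" using e by simp
  show "\<forall>\<^sub>F j in sequentially. \<forall>\<^sub>F N in sequentially. \<parallel>mean j (c \<odot> x) \<otimes> (Up b \<otimes> S [^] N)\<parallel> \<le> e"
    using asym_nullD(2)[OF x e', of b]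
  proof eventually_elim
    case (elim j)
    then show ?case
    proof eventually_elim
      case (elim N)
      have "\<parallel>mean j (c \<odot> x) \<otimes> (Up b \<otimes> S [^] N)\<parallel> = cmod c * \<parallel>mean j x \<otimes> (Up b \<otimes> S [^] N)\<parallel>"
        using xc by (simp add: mean_scl smult_mult_left cnorm_smult)
      also have "\<dots> \<le> (cmod c + 1) * (e / (cmod c + 1))"
        using elim xc c1 by (intro mult_mono) auto
      finally show ?case using c1 by simp
    qed
  qed
qed (use asym_nullD(1) x in auto)

lemma asym_null_Up:
  assumes x: "asym_null x" shows "asym_null (Up a \<otimes> (x \<otimes> Up b))"
proof (rule asym_nullI)
  note xc = asym_nullD(1)[OF x]
  fix c and e :: real assume e: "e > 0"
  show "\<forall>\<^sub>F j in sequentially. \<forall>\<^sub>F N in sequentially. \<parallel>mean j (Up a \<otimes> (x \<otimes> Up b)) \<otimes> (Up c \<otimes> S [^] N)\<parallel> \<le> e"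
    using asym_nullD(2)[OF x e, of "b + c"]
    using xc by (simp add: mean_Up_mult mean_mult_Up m_assoc)
qed (use asym_nullD(1) x in auto)

text \<open>Here \<open>S^d\<close> and its adjoint have nonzero degree, so that \<open>Up_mean j q\<close> occurs with odd \<open>q\<close> and
\<open>\<parallel>Up_mean j q S^N\<parallel>\<close> equals \<open>2^(-j/2)\<close> for \<open>N \<ge> j\<close>.\<close>

lemma asym_null_S_pow:
  assumes d: "d > 0" shows "asym_null (S [^] (d::nat))" "asym_null (S\<^sup>\<star> [^] (d::nat))"
proof -
  have half: "(\<lambda>j. (1/2 :: real) ^ j) \<longlonglongrightarrow> 0" by (rule LIMSEQ_power_zero) simp
  have *: "\<forall>\<^sub>F j in sequentially. \<forall>\<^sub>F N in sequentially. \<parallel>Up_mean j q \<otimes> S [^] (N::nat)\<parallel> \<le> e"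
    if e: "e > 0" and q: "odd q" for e q
  proof -
    have "\<forall>\<^sub>F j in sequentially. (1/2 :: real) ^ j < e\<^sup>2"
      using order_tendstoD(2)[OF half, of "e\<^sup>2"] e by simp
    then show ?thesis
    proof eventually_elim
      case (elim j)
      show ?case
        using eventually_ge_at_top[of j]
      proof eventually_elim
        case (elim N)
        have "(\<parallel>Up_mean j q \<otimes> S [^] N\<parallel>)\<^sup>2 = (1/2) ^ j" using cnorm_Up_mean_S_pow[OF q, of j "N - j"] elim by simp
        then have "(\<parallel>Up_mean j q \<otimes> S [^] N\<parallel>)\<^sup>2 \<le> e\<^sup>2" using \<open>(1/2) ^ j < e\<^sup>2\<close> by simp
        then show ?case using e by (simp add: power2_le_iff_abs_le)
      qed
    qed
  qed
  have odd: "odd (1 - 2 ^ d :: int)" "odd (2 ^ d - 1 :: int)" using d by auto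
  show "asym_null (S [^] d)"
  proof (rule asym_nullI)
    fix b and e :: real assume e: "e > 0"
    show "\<forall>\<^sub>F j in sequentially. \<forall>\<^sub>F N in sequentially. \<parallel>mean j (S [^] d) \<otimes> (Up b \<otimes> S [^] N)\<parallel> \<le> e"
      using *[OF e odd(1)]
    proof eventually_elim
      case (elim j)
      then have "\<forall>\<^sub>F N in sequentially. \<parallel>Up_mean j (1 - 2 ^ d) \<otimes> S [^] (N + d)\<parallel> \<le> e"
        by (subst eventually_sequentially_seg)
      then show ?case
      proof eventually_elim
        case (elim N)
        have "mean j (S [^] d) \<otimes> (Up b \<otimes> S [^] N) = Up (2 ^ d * b) \<otimes> (Up_mean j (1 - 2 ^ d) \<otimes> S [^] (N + d))"
          by (simp add: mean_S_pow m_assoc S_pow_Up_left comm_U_Up_left[OF Up_mean_comm_U] nat_pow_mult add.commute)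
        then show ?case using elim by simp
      qed
    qed
  qed simp
  show "asym_null (S\<^sup>\<star> [^] d)"
  proof (rule asym_nullI)
    fix b and e :: real assume e: "e > 0"
    show "\<forall>\<^sub>F j in sequentially. \<forall>\<^sub>F N in sequentially. \<parallel>mean j (S\<^sup>\<star> [^] d) \<otimes> (Up b \<otimes> S [^] N)\<parallel> \<le> e"
      using *[OF e odd(2)]
    proof eventually_elim
      case (elim j)
      then show ?case
      proof eventually_elim
        case (elim N)
        have "mean j (S\<^sup>\<star> [^] d) = S\<^sup>\<star> [^] d \<otimes> Up_mean j (2 ^ d - 1)"
          using mean_adj[of "S [^] d" j] by (simp add: mean_S_pow adj_mult adj_nat_pow Up_mean_adj)
        then have "mean j (S\<^sup>\<star> [^] d) \<otimes> (Up b \<otimes> S [^] N) = S\<^sup>\<star> [^] d \<otimes> (Up b \<otimes> (Up_mean j (2 ^ d - 1) \<otimes> S [^] N))"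
          by (simp add: m_assoc comm_U_Up_left[OF Up_mean_comm_U])
        then have "\<parallel>mean j (S\<^sup>\<star> [^] d) \<otimes> (Up b \<otimes> S [^] N)\<parallel> \<le> 1 * e"
          using elim by (simp only:) (intro cnorm_mult_le, simp_all)
        then show ?case by simp
      qed
    qed
  qed simp
qed

text \<open>Of the two terms in \<open>mean_conj_S\<close> only the one whose range matches the parity of \<open>b\<close> survives on
\<open>Up b S^N\<close>; on it \<open>b\<close> is replaced by \<open>b div 2\<close>.\<close>

lemma asym_null_conj_S:
  assumes x: "asym_null x" shows "asym_null (S \<otimes> (x \<otimes> S\<^sup>\<star>))"
proof (rule asym_nullI)
  note xc = asym_nullD(1)[OF x]
  fix b and e :: real assume e: "e > 0"
  have "\<forall>\<^sub>F j in sequentially. \<forall>\<^sub>F N in sequentially. \<parallel>mean (Suc j) (S \<otimes> (x \<otimes> S\<^sup>\<star>)) \<otimes> (Up b \<otimes> S [^] N)\<parallel> \<le> e"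
    using asym_nullD(2)[OF x e, of "b div 2"]
  proof eventually_elim
    case (elim j)
    have "\<forall>\<^sub>F N in sequentially. \<parallel>mean (Suc j) (S \<otimes> (x \<otimes> S\<^sup>\<star>)) \<otimes> (Up b \<otimes> S [^] Suc N)\<parallel> \<le> e"
      using elim
    proof eventually_elim
      case (elim N)
      define w where "w = mean j x \<otimes> (Up (b div 2) \<otimes> S [^] N)"
      have w: "w \<in> carrier A" "\<parallel>w\<parallel> \<le> e" using elim xc by (simp_all add: w_def)
      have sp: "S [^] Suc N = S \<otimes> S [^] N" by (rule nat_pow_Suc2) simp
      have "mean (Suc j) (S \<otimes> (x \<otimes> S\<^sup>\<star>)) \<otimes> (Up b \<otimes> S [^] Suc N)
        = (1/2) \<odot> (S \<otimes> (mean j x \<otimes> (S\<^sup>\<star> \<otimes> (Up b \<otimes> (S \<otimes> S [^] N)))) \<oplus>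
            Up 1 \<otimes> (S \<otimes> (mean j x \<otimes> (S\<^sup>\<star> \<otimes> (Up (b - 1) \<otimes> (S \<otimes> S [^] N))))))"
        unfolding mean_conj_S[OF xc] sp using xc by (simp add: smult_mult_left l_distr m_assoc)
      also have "\<dots> = (1/2) \<odot> (if even b then S \<otimes> w else Up 1 \<otimes> (S \<otimes> w))"
      proof (cases "even b")
        case True then show ?thesis using xc by (simp add: adjS_Up_S_left w_def)
      next
        case False
        then have "(b - 1) div 2 = b div 2" "even (b - 1)" by presburger+
        then show ?thesis using xc False by (simp add: adjS_Up_S_left w_def)
      qed
      finally have "\<parallel>mean (Suc j) (S \<otimes> (x \<otimes> S\<^sup>\<star>)) \<otimes> (Up b \<otimes> S [^] Suc N)\<parallel> = \<parallel>w\<parallel> / 2"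
        using w(1) by (simp add: cnorm_smult del: nat_pow_Suc mean.simps)
      then show ?case using w cnorm_nonneg[OF w(1)] by linarith
    qed
    then show ?case by (subst (asm) eventually_sequentially_Suc)
  qed
  then show "\<forall>\<^sub>F j in sequentially. \<forall>\<^sub>F N in sequentially. \<parallel>mean j (S \<otimes> (x \<otimes> S\<^sup>\<star>)) \<otimes> (Up b \<otimes> S [^] N)\<parallel> \<le> e"
    by (subst (asm) eventually_sequentially_Suc)
qed (use asym_nullD(1) x in auto)

lemma asym_null_conj_S_pow:
  assumes x: "asym_null x" shows "asym_null (S [^] (n::nat) \<otimes> (x \<otimes> S\<^sup>\<star> [^] n))"
proof (induction n)
  case 0 then show ?case using asym_nullD(1)[OF x] x by simp
next
  case (Suc n)
  have "S [^] Suc n \<otimes> (x \<otimes> S\<^sup>\<star> [^] Suc n) = S \<otimes> ((S [^] n \<otimes> (x \<otimes> S\<^sup>\<star> [^] n)) \<otimes> S\<^sup>\<star>)"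
    unfolding nat_pow_Suc2[OF S] using asym_nullD(1)[OF x] by (simp add: m_assoc)
  then show ?case using asym_null_conj_S[OF Suc] by simp
qed

lemma asym_null_S_pow_adjS_pow:
  assumes "m \<noteq> n" shows "asym_null (S [^] (m::nat) \<otimes> S\<^sup>\<star> [^] (n::nat))"
proof (cases "n < m")
  case True
  have "S [^] m = S [^] n \<otimes> S [^] (m - n)" using True by (simp add: nat_pow_mult)
  then show ?thesis
    using asym_null_conj_S_pow[OF asym_null_S_pow(1)[of "m - n"], of n] True by (simp add: m_assoc)
next
  case False
  have "S\<^sup>\<star> [^] n = S\<^sup>\<star> [^] (n - m) \<otimes> S\<^sup>\<star> [^] m" using False by (simp add: nat_pow_mult)
  then show ?thesis
    using asym_null_conj_S_pow[OF asym_null_S_pow(2)[of "n - m"], of m] False assms by (simp add: m_assoc)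
qed

definition Trig :: "'a set" where "Trig = cspan (range Up)"

lemma Trig_comm_U: "g \<in> Trig \<Longrightarrow> g \<in> comm_U"
  unfolding Trig_def
proof (induction rule: cspan.induct)
  case zero then show ?case by simp
qed (auto intro: comm_U_add comm_U_scl)

text \<open>A monomial of degree \<open>0\<close> averages to a multiple of a power of \<open>U\<close>, because the averages of
\<open>S^m (S*)^m\<close> are \<open>2^(-m)\<close>; the others average to \<open>0\<close>. The adjoint is carried along because the
commutativity of the commutant needs both approximations at once.\<close>

lemma Pol_asym_Trig:
  assumes "y \<in> Pol UNIV"
  shows "\<exists>g\<in>Trig. asym_null (y \<ominus> g) \<and> asym_null (y\<^sup>\<star> \<ominus> g\<^sup>\<star>)"
  using assms unfolding Pol_def
proof (induction rule: cspan.induct)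
  case zero
  then show ?case by (intro bexI[of _ \<zero>]) (auto simp: Trig_def asym_null_zero intro: cspan.zero)
next
  case (base y)
  then obtain a m n b where y: "y = mon a m n b" unfolding mons_def by blast
  show ?case
  proof (cases "m = n")
    case True
    define g where "g = (1 / 2 ^ m) \<odot> Up (a + b)"
    define z where "z = S [^] m \<otimes> S\<^sup>\<star> [^] m \<ominus> (1 / 2 ^ m) \<odot> \<one>"
    have zc: "z \<in> carrier A" by (simp add: z_def)
    have "mean j z = \<zero>" if "j \<ge> m" for j
      using mean_S_pow_adjS_pow[OF that] mean_comm_U[of "\<one>"] by (simp add: z_def mean_minus mean_scl)
    then have "\<forall>\<^sub>F j in sequentially. mean j z = \<zero>" unfolding eventually_sequentially by blast
    then have z0: "asym_null z"
      by (intro asym_nullI zc) (auto elim!: eventually_mono)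
    have "y \<ominus> g = Up a \<otimes> (z \<otimes> Up b)"
      unfolding y g_def z_def True
      by (simp add: mon_def minus_scl l_distr r_distr m_assoc smult_mult_left smult_mult_right scl_scl)
    moreover have zs: "z\<^sup>\<star> = z" by (simp add: z_def adj_minus adj_mult adj_nat_pow adj_smult)
    moreover have "y\<^sup>\<star> \<ominus> g\<^sup>\<star> = (y \<ominus> g)\<^sup>\<star>" by (simp add: adj_minus y g_def)
    ultimately have "asym_null (y \<ominus> g)" "asym_null (y\<^sup>\<star> \<ominus> g\<^sup>\<star>)"
      using asym_null_Up[OF z0] zc by (simp_all add: adj_mult m_assoc)
    then show ?thesis by (intro bexI[of _ g]) (auto simp: g_def Trig_def intro: cspan.intros)
  next
    case False
    have "asym_null (Up a \<otimes> ((S [^] m \<otimes> S\<^sup>\<star> [^] n) \<otimes> Up b))"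
      "asym_null (Up (- b) \<otimes> ((S [^] n \<otimes> S\<^sup>\<star> [^] m) \<otimes> Up (- a)))"
      by (intro asym_null_Up asym_null_S_pow_adjS_pow False False[symmetric])+
    then show ?thesis
      by (intro bexI[of _ \<zero>]) (auto simp: y mon_def Trig_def minus_scl adj_mult adj_nat_pow m_assoc intro: cspan.zero)
  qed
next
  case (add x y)
  then obtain g h where g: "g \<in> Trig" "asym_null (x \<ominus> g)" "asym_null (x\<^sup>\<star> \<ominus> g\<^sup>\<star>)"
    and h: "h \<in> Trig" "asym_null (y \<ominus> h)" "asym_null (y\<^sup>\<star> \<ominus> h\<^sup>\<star>)" by blast
  have c: "g \<in> carrier A" "h \<in> carrier A" "x \<in> carrier A" "y \<in> carrier A"
    using Trig_comm_U[OF g(1)] Trig_comm_U[OF h(1)] add.hyps cspan_closed[OF _ mons_closed] by auto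
  have "(x \<oplus> y) \<ominus> (g \<oplus> h) = (x \<ominus> g) \<oplus> (y \<ominus> h)"
    "(x\<^sup>\<star> \<oplus> y\<^sup>\<star>) \<ominus> (g\<^sup>\<star> \<oplus> h\<^sup>\<star>) = (x\<^sup>\<star> \<ominus> g\<^sup>\<star>) \<oplus> (y\<^sup>\<star> \<ominus> h\<^sup>\<star>)"
    using c by (simp_all add: minus_scl scl_distr a_ac)
  then show ?case using g h asym_null_add c
    by (intro bexI[of _ "g \<oplus> h"]) (auto simp: adj_add Trig_def intro: cspan.add)
next
  case (scale x c)
  then obtain g where g: "g \<in> Trig" "asym_null (x \<ominus> g)" "asym_null (x\<^sup>\<star> \<ominus> g\<^sup>\<star>)" by blast
  have gx: "g \<in> carrier A" "x \<in> carrier A"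
    using Trig_comm_U[OF g(1)] scale.hyps cspan_closed[OF _ mons_closed] by auto
  have "c \<odot> x \<ominus> c \<odot> g = c \<odot> (x \<ominus> g)" "cnj c \<odot> x\<^sup>\<star> \<ominus> cnj c \<odot> g\<^sup>\<star> = cnj c \<odot> (x\<^sup>\<star> \<ominus> g\<^sup>\<star>)"
    using gx by (simp_all add: minus_scl scl_distr scl_scl)
  then show ?case using g asym_null_scl gx
    by (intro bexI[of _ "c \<odot> g"]) (auto simp: adj_smult Trig_def intro: cspan.scale)
qed

text \<open>Averaging fixes \<open>x\<close> and \<open>g\<close> and is contractive, so an approximation \<open>y\<close> of \<open>x\<close> in norm may be
replaced by its asymptotic average \<open>g\<close>.\<close>

lemma comm_U_approx_Trig:
  assumes x: "x \<in> comm_U" and e: "e > 0"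
  shows "\<exists>g\<in>Trig. (\<forall>\<^sub>F N in sequentially. \<parallel>(x \<ominus> g) \<otimes> S [^] (N::nat)\<parallel> \<le> e) \<and>
    (\<forall>\<^sub>F N in sequentially. \<parallel>(x\<^sup>\<star> \<ominus> g\<^sup>\<star>) \<otimes> S [^] (N::nat)\<parallel> \<le> e)"
proof -
  note xc = comm_U_closed[OF x]
  have e2: "e / 2 > 0" using e by simp
  obtain y where y: "y \<in> Pol UNIV" "\<parallel>x \<ominus> y\<parallel> \<le> e / 2" using Pol_dense[OF xc e2] by blast
  note yc = Pol_closed[OF y(1)]
  obtain g where g: "g \<in> Trig" "asym_null (y \<ominus> g)" "asym_null (y\<^sup>\<star> \<ominus> g\<^sup>\<star>)"
    using Pol_asym_Trig[OF y(1)] by blast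
  note gM = Trig_comm_U[OF g(1)] and gc = comm_U_closed[OF Trig_comm_U[OF g(1)]]
  have main: "\<forall>\<^sub>F N in sequentially. \<parallel>(x \<ominus> g) \<otimes> S [^] (N::nat)\<parallel> \<le> e"
    if x: "x \<in> comm_U" and g: "g \<in> comm_U" and y: "y \<in> carrier A" "\<parallel>x \<ominus> y\<parallel> \<le> e / 2"
      and n: "asym_null (y \<ominus> g)" for x y g
  proof -
    note xc = comm_U_closed[OF x] and gc = comm_U_closed[OF g]
    obtain j where j: "\<forall>\<^sub>F N in sequentially. \<parallel>mean j (y \<ominus> g) \<otimes> (Up 0 \<otimes> S [^] (N::nat))\<parallel> \<le> e / 2"
      using asym_nullD(2)[OF n e2, of 0] unfolding eventually_sequentially by blast
    from j show ?thesis
    proof eventually_elim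
      case (elim N)
      have "x \<ominus> g = mean j (x \<ominus> g)" by (simp add: mean_comm_U comm_U_minus x g)
      also have "mean j (x \<ominus> g) = mean j ((x \<ominus> y) \<oplus> (y \<ominus> g))"
        using xc y gc by (intro arg_cong[of _ _ "mean j"]) algebra
      also have "\<dots> = mean j (x \<ominus> y) \<oplus> mean j (y \<ominus> g)" using xc y gc by (simp add: mean_add)
      finally have "x \<ominus> g = mean j (x \<ominus> y) \<oplus> mean j (y \<ominus> g)" .
      then have "(x \<ominus> g) \<otimes> S [^] N = mean j (x \<ominus> y) \<otimes> S [^] N \<oplus> mean j (y \<ominus> g) \<otimes> S [^] N"
        using xc y gc by (simp add: l_distr)
      also have "\<parallel>\<dots>\<parallel> \<le> \<parallel>mean j (x \<ominus> y) \<otimes> S [^] N\<parallel> + \<parallel>mean j (y \<ominus> g) \<otimes> S [^] N\<parallel>"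
        using xc y gc by (intro cnorm_triangle) auto
      also have "\<dots> \<le> (e / 2) * 1 + e / 2"
        using cnorm_mean_le[of "x \<ominus> y" j] y xc gc elim by (intro add_mono cnorm_mult_le) auto
      finally show ?case by simp
    qed
  qed
  have "\<parallel>x\<^sup>\<star> \<ominus> y\<^sup>\<star>\<parallel> \<le> e / 2" using y(2) xc yc by (simp flip: adj_minus)
  then show ?thesis
    using main[OF x gM yc y(2) g(2)] main[OF comm_U_adj[OF x] comm_U_adj[OF gM] adj_closed[OF yc] _ g(3)] g(1)
    by blast
qed

end

section \<open>Gauge automorphisms and the null ideal\<close>

lemma star_hom_comp:
  assumes "f \<in> star_hom A A" "g \<in> star_hom A A" shows "(\<lambda>x. f (g x)) \<in> star_hom A A"
  using assms unfolding star_hom_def ring_hom_def by (auto simp: Pi_iff)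

lemma null_comparison:
  fixes f g :: "nat \<Rightarrow> real"
  assumes "\<forall>\<^sub>F n in F. norm (f n) \<le> g n" "(g \<longlongrightarrow> 0) F"
  shows "(f \<longlongrightarrow> 0) F"
  using assms(1) by (intro tendsto_0_le[OF assms(2), of f 1]) (auto elim: eventually_mono)

text \<open>A factor \<open>4^l = (2^l)\<^sup>2\<close> is polynomial in the exponent \<open>2^l\<close> and cannot make up for a base greater than
\<open>1\<close>.\<close>

lemma le_if_square_powers_le:
  fixes x d :: real
  assumes d: "0 \<le> d" and le: "\<And>l. x ^ (2 ^ l) \<le> C * 4 ^ l * d ^ (2 ^ l)"
  shows "x \<le> d"
proof (rule ccontr)
  assume "\<not> x \<le> d"
  then have xd: "x > d" by simp
  have d0: "d > 0"
  proof (rule ccontr)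
    assume "\<not> d > 0"
    then have "d = 0" using d by simp
    then show False using le[of 0] xd by simp
  qed
  define \<rho> where "\<rho> = x / d"
  have \<rho>: "\<rho> > 1" using xd d0 by (simp add: \<rho>_def)
  have le': "\<rho> ^ (2 ^ l) \<le> C * 4 ^ l" for l
    using le[of l] d0 by (simp add: \<rho>_def power_divide field_simps)
  \<comment> \<open>The base \<open>8\<close> beats the factor \<open>4\<close> and leaves \<open>2^i\<close> unbounded.\<close>
  obtain n where n: "8 < \<rho> ^ n" using real_arch_pow[OF \<rho>] by blast
  define R where "R = \<rho> ^ (2 ^ n)"
  have "\<rho> ^ n \<le> R" unfolding R_def using \<rho> by (intro power_increasing) (auto intro: less_imp_le)
  then have R: "R > 8" using n by simp
  have "2 ^ i \<le> C * 4 ^ n" for i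
  proof -
    have "8 ^ i \<le> R ^ i" using R by (intro power_mono) auto
    also have "\<dots> \<le> R ^ (2 ^ i)" using R by (intro power_increasing) (auto intro: less_imp_le)
    also have "\<dots> = \<rho> ^ (2 ^ (n + i))" by (simp add: R_def power_add flip: power_mult)
    also have "\<dots> \<le> (C * 4 ^ n) * 4 ^ i" using le'[of "n + i"] by (simp add: power_add mult_ac)
    finally have "(2 * 4) ^ i \<le> (C * 4 ^ n) * 4 ^ i" by simp
    then show ?thesis unfolding power_mult_distrib by simp
  qed
  moreover obtain i where "C * 4 ^ n < 2 ^ i" using real_arch_pow[of 2] by auto
  ultimately show False by (meson not_le)
qed

context cstar_algebra
begin

lemma star_homD:
  assumes "h \<in> star_hom A A"
  shows "x \<in> carrier A \<Longrightarrow> h x \<in> carrier A"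
    "x \<in> carrier A \<Longrightarrow> y \<in> carrier A \<Longrightarrow> h (x \<otimes> y) = h x \<otimes> h y"
    "x \<in> carrier A \<Longrightarrow> y \<in> carrier A \<Longrightarrow> h (x \<oplus> y) = h x \<oplus> h y"
    "h \<one> = \<one>"
    "x \<in> carrier A \<Longrightarrow> h (x\<^sup>\<star>) = (h x)\<^sup>\<star>"
    "x \<in> carrier A \<Longrightarrow> h (c \<odot> x) = c \<odot> h x"
  using assms by (auto simp: star_hom_def ring_hom_def)

lemma star_hom_minus:
  assumes h: "h \<in> star_hom A A" and "x \<in> carrier A" "y \<in> carrier A"
  shows "h (x \<ominus> y) = h x \<ominus> h y"
  using assms by (simp add: minus_scl star_homD[OF h])

lemma star_hom_zero: "h \<in> star_hom A A \<Longrightarrow> h \<zero> = \<zero>"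
  using star_homD(6)[of h \<zero> 0] star_homD(1)[of h \<zero>] by simp

lemma star_hom_pow: "h \<in> star_hom A A \<Longrightarrow> x \<in> carrier A \<Longrightarrow> h (x [^] (n::nat)) = h x [^] n"
  by (induction n) (simp_all add: star_homD)

lemma star_hom_contractive: "h \<in> star_hom A A \<Longrightarrow> x \<in> carrier A \<Longrightarrow> \<parallel>h x\<parallel> \<le> \<parallel>x\<parallel>"
  using star_hom_cnorm_le[OF cstar_algebra_axioms cstar_algebra_axioms] by blast

lemma id_star_hom: "(\<lambda>x. x) \<in> star_hom A A"
  by (auto simp: star_hom_def ring_hom_def)

text \<open>The power \<open>b^(2^l)\<close>.\<close>

primrec iter_sq :: "nat \<Rightarrow> 'a \<Rightarrow> 'a" where
  "iter_sq 0 b = b"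
| "iter_sq (Suc l) b = iter_sq l b \<otimes> iter_sq l b"

lemma iter_sq_closed [simp]: "b \<in> carrier A \<Longrightarrow> iter_sq l b \<in> carrier A"
  by (induction l) auto

lemma iter_sq_sa: "b \<in> carrier A \<Longrightarrow> b\<^sup>\<star> = b \<Longrightarrow> (iter_sq l b)\<^sup>\<star> = iter_sq l b"
  by (induction l) (auto simp: adj_mult)

lemma cnorm_iter_sq: "b \<in> carrier A \<Longrightarrow> b\<^sup>\<star> = b \<Longrightarrow> \<parallel>iter_sq l b\<parallel> = \<parallel>b\<parallel> ^ (2 ^ l)"
proof (induction l)
  case (Suc l)
  have "\<parallel>iter_sq (Suc l) b\<parallel> = \<parallel>iter_sq l b\<parallel>\<^sup>2"
    using cstar_identity[of "iter_sq l b"] iter_sq_sa Suc.prems by simp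
  then show ?case using Suc by (simp add: power2_eq_square mult_2 power_add)
qed simp

lemma cstar_subalgebra_equalizer:
  assumes f: "f \<in> star_hom A A" and g: "g \<in> star_hom A A"
  shows "cstar_subalgebra {x \<in> carrier A. f x = g x} A"
  unfolding cstar_subalgebra_def
proof (intro conjI ballI allI impI)
  fix X :: "nat \<Rightarrow> 'a" and x
  assume x: "x \<in> carrier A" and X: "range X \<subseteq> {x \<in> carrier A. f x = g x} \<and> (\<lambda>n. \<parallel>X n \<ominus> x\<parallel>) \<longlonglongrightarrow> 0"
  have "f x = g x"
  proof (rule eq_if_cnorm_minus_small[where C = 2])
    fix e :: real assume e: "e > 0"
    obtain n where n: "\<parallel>X n \<ominus> x\<parallel> < e"
      using order_tendstoD(2)[OF conjunct2[OF X] e] unfolding eventually_sequentially by blast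
    have Xn: "X n \<in> carrier A" "f (X n) = g (X n)" using X by auto
    have "\<parallel>f x \<ominus> g x\<parallel> \<le> \<parallel>f x \<ominus> f (X n)\<parallel> + \<parallel>f (X n) \<ominus> g x\<parallel>"
      using x Xn f g by (intro cnorm_dist_triangle) (auto intro: star_homD(1))
    also have "\<dots> = \<parallel>f (x \<ominus> X n)\<parallel> + \<parallel>g (X n \<ominus> x)\<parallel>"
      using x Xn by (simp add: star_hom_minus[OF f] star_hom_minus[OF g])
    also have "\<dots> \<le> \<parallel>x \<ominus> X n\<parallel> + \<parallel>X n \<ominus> x\<parallel>"
      using x Xn by (intro add_mono star_hom_contractive f g) auto
    also have "\<dots> \<le> 2 * e" using n cnorm_minus_commute[OF x Xn(1)] by simp
    finally show "\<parallel>f x \<ominus> g x\<parallel> \<le> 2 * e" .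
  qed (use x f g in \<open>auto intro: star_homD(1)\<close>)
  then show "x \<in> {x \<in> carrier A. f x = g x}" using x by simp
qed (auto simp: star_homD[OF f] star_homD[OF g] star_hom_zero[OF f] star_hom_zero[OF g])

lemma unitary_cancel:
  assumes "w \<in> carrier A" "w\<^sup>\<star> \<otimes> w = \<one>" "w \<otimes> w\<^sup>\<star> = \<one>" "x \<in> carrier A"
  shows "w\<^sup>\<star> \<otimes> (w \<otimes> x) = x" "w \<otimes> (w\<^sup>\<star> \<otimes> x) = x"
  using assms by (simp_all flip: m_assoc)

definition Ad :: "'a \<Rightarrow> 'a \<Rightarrow> 'a" where "Ad w = restrict (\<lambda>x. w \<otimes> (x \<otimes> w\<^sup>\<star>)) (carrier A)"

lemma Ad_auto:
  assumes w: "w \<in> carrier A" "w\<^sup>\<star> \<otimes> w = \<one>" "w \<otimes> w\<^sup>\<star> = \<one>" shows "Ad w \<in> cstar_auto A"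
proof -
  note c = unitary_cancel[OF w]
  have "Ad w \<in> star_hom A A"
    unfolding star_hom_def ring_hom_def using w
    by (auto simp: Ad_def l_distr r_distr m_assoc c adj_mult smult_mult_left smult_mult_right)
  moreover have "bij_betw (Ad w) (carrier A) (carrier A)"
    by (rule bij_betw_byWitness[where f' = "\<lambda>x. w\<^sup>\<star> \<otimes> (x \<otimes> w)"])
      (use w c in \<open>auto simp: Ad_def m_assoc\<close>)
  ultimately show ?thesis unfolding cstar_auto_def Bij_def by (auto simp: Ad_def)
qed

lemma scl_one_inject: assumes "a \<odot> \<one> = b \<odot> \<one>" shows "a = b"
proof -
  have "(a - b) \<odot> \<one> = a \<odot> \<one> \<ominus> b \<odot> \<one>" using scl_add[of \<one> a "- b"] by (simp add: minus_scl scl_scl)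
  then have "(a - b) \<odot> \<one> = \<zero>" unfolding assms by simp
  then have "cmod (a - b) * \<parallel>\<one>\<parallel> = 0" by (metis cnorm_smult cnorm_zero one_closed)
  then show ?thesis by simp
qed

lemma AutoGroup_mult:
  "f \<in> cstar_auto A \<Longrightarrow> g \<in> cstar_auto A \<Longrightarrow> f \<otimes>\<^bsub>cstar_AutoGroup A\<^esub> g = compose (carrier A) f g"
  by (auto simp: cstar_AutoGroup_def BijGroup_def cstar_auto_def)

lemma carrier_AutoGroup [simp]: "carrier (cstar_AutoGroup A) = cstar_auto A"
  by (simp add: cstar_AutoGroup_def)

end

context two_adic
begin

lemma star_hom_eqI:
  assumes f: "f \<in> star_hom A A" and g: "g \<in> star_hom A A" and "f U = g U" "f S = g S" and x: "x \<in> carrier A"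
  shows "f x = g x"
proof -
  have "{U, S} \<subseteq> {x \<in> carrier A. f x = g x}" using assms by simp
  then have "cstar_generated A {U, S} \<subseteq> {x \<in> carrier A. f x = g x}"
    by (rule cstar_generated_subset[OF cstar_subalgebra_equalizer[OF f g]])
  then show ?thesis using x unfolding generated by blast
qed

lemma star_hom_Up:
  assumes h: "h \<in> star_hom A A" and "h U = U" shows "h (Up k) = Up k"
  using assms(2) by (cases k rule: int_cases2) (simp_all add: Up_int Up_neg star_hom_pow[OF h] star_homD[OF h])

lemma cnj_cis: "cnj (cis t) = cis (- t)"
  by (rule complex_eqI) simp_all

text \<open>The relations are homogeneous in \<open>S\<close>, so universality provides a homomorphism that rotates \<open>S\<close>.\<close>

lemma gauge_exists: "\<exists>h\<in>star_hom A A. h U = U \<and> h S = cis t \<odot> S"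
proof (rule universal)
  have z: "cis t * cis (- t) = 1" "cis (- t) * cis t = 1" by (simp_all add: cis_mult)
  show "Q2_relations A U (cis t \<odot> S)"
    unfolding Q2_relations_def using U_unitary S_isometry SU resolution
    by (simp add: adj_smult cnj_cis smult_mult_left smult_mult_right scl_scl z)
qed (rule cstar_algebra_axioms)

definition gauge :: "real \<Rightarrow> 'a \<Rightarrow> 'a" where
  "gauge t = (SOME h. h \<in> star_hom A A \<and> h U = U \<and> h S = cis t \<odot> S)"

lemma gauge: "gauge t \<in> star_hom A A" "gauge t U = U" "gauge t S = cis t \<odot> S"
  using someI_ex[of "\<lambda>h. h \<in> star_hom A A \<and> h U = U \<and> h S = cis t \<odot> S"] gauge_exists[of t]
  unfolding gauge_def by blast+

lemma gauge_inverse: assumes x: "x \<in> carrier A" shows "gauge t (gauge (- t) x) = x"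
proof -
  have "gauge t (gauge (- t) S) = S"
    by (simp add: gauge star_homD[OF gauge(1)] scl_scl cis_mult)
  then show ?thesis
    using star_hom_eqI[OF star_hom_comp[OF gauge(1) gauge(1)] id_star_hom _ _ x, of t "- t"] gauge(2) by simp
qed

lemma gauge_S_pow: "gauge t (S [^] (n::nat)) = cis (real n * t) \<odot> S [^] n"
  by (simp add: star_hom_pow[OF gauge(1)] gauge scl_pow DeMoivre)

lemma gauge_mon: "gauge t (mon a m n b) = cis (of_int (int m - int n) * t) \<odot> mon a m n b"
proof -
  have 1: "gauge t (S\<^sup>\<star> [^] n) = cis (- (real n * t)) \<odot> S\<^sup>\<star> [^] n"
    using star_homD(5)[OF gauge(1)[of t], of "S [^] n"] by (simp add: gauge_S_pow adj_nat_pow adj_smult cnj_cis)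
  have 2: "gauge t (Up k) = Up k" for k by (intro star_hom_Up gauge)
  have "gauge t (mon a m n b) = (cis (real m * t) * cis (- (real n * t))) \<odot> mon a m n b"
    unfolding mon_def
    by (simp add: star_homD[OF gauge(1)] gauge_S_pow 1 2 smult_mult_left smult_mult_right scl_scl mult.commute)
  then show ?thesis by (simp add: cis_mult algebra_simps)
qed

text \<open>The stand-in for the kernel of the canonical representation. Quantifying over \<open>y\<close> turns the
annihilator of one vector into a two-sided ideal.\<close>

definition null_ideal :: "'a set" where
  "null_ideal = {x \<in> carrier A. \<forall>y\<in>carrier A. (\<lambda>N. \<parallel>x \<otimes> (y \<otimes> S [^] (N::nat))\<parallel>) \<longlonglongrightarrow> 0}"

lemma null_ideal_closed: "x \<in> null_ideal \<Longrightarrow> x \<in> carrier A"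
  by (simp add: null_ideal_def)

lemma null_idealD: "x \<in> null_ideal \<Longrightarrow> y \<in> carrier A \<Longrightarrow> (\<lambda>N. \<parallel>x \<otimes> (y \<otimes> S [^] (N::nat))\<parallel>) \<longlonglongrightarrow> 0"
  by (simp add: null_ideal_def)

lemma null_idealI:
  "x \<in> carrier A \<Longrightarrow> (\<And>y. y \<in> carrier A \<Longrightarrow> (\<lambda>N. \<parallel>x \<otimes> (y \<otimes> S [^] (N::nat))\<parallel>) \<longlonglongrightarrow> 0) \<Longrightarrow> x \<in> null_ideal"
  by (simp add: null_ideal_def)

declare null_ideal_closed [simp]

lemma null_ideal_add: assumes x: "x \<in> null_ideal" and y: "y \<in> null_ideal" shows "x \<oplus> y \<in> null_ideal"
proof (rule null_idealI)
  note xc = null_ideal_closed[OF x] and yc = null_ideal_closed[OF y]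
  fix z assume z: "z \<in> carrier A"
  show "(\<lambda>N. \<parallel>(x \<oplus> y) \<otimes> (z \<otimes> S [^] N)\<parallel>) \<longlonglongrightarrow> 0"
  proof (rule null_comparison)
    show "(\<lambda>N. \<parallel>x \<otimes> (z \<otimes> S [^] N)\<parallel> + \<parallel>y \<otimes> (z \<otimes> S [^] N)\<parallel>) \<longlonglongrightarrow> 0"
      using tendsto_add_zero[OF null_idealD[OF x z] null_idealD[OF y z]] .
    show "\<forall>\<^sub>F N in sequentially. norm \<parallel>(x \<oplus> y) \<otimes> (z \<otimes> S [^] N)\<parallel> \<le> \<parallel>x \<otimes> (z \<otimes> S [^] N)\<parallel> + \<parallel>y \<otimes> (z \<otimes> S [^] N)\<parallel>"
      using xc yc z by (intro always_eventually allI) (simp add: l_distr cnorm_triangle)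
  qed
qed (use x y in auto)

lemma null_ideal_mult_left: assumes x: "x \<in> carrier A" and y: "y \<in> null_ideal" shows "x \<otimes> y \<in> null_ideal"
proof (rule null_idealI)
  note yc = null_ideal_closed[OF y]
  fix z assume z: "z \<in> carrier A"
  show "(\<lambda>N. \<parallel>(x \<otimes> y) \<otimes> (z \<otimes> S [^] N)\<parallel>) \<longlonglongrightarrow> 0"
  proof (rule null_comparison)
    show "(\<lambda>N. \<parallel>x\<parallel> * \<parallel>y \<otimes> (z \<otimes> S [^] N)\<parallel>) \<longlonglongrightarrow> 0"
      using tendsto_mult_right_zero[OF null_idealD[OF y z]] .
    show "\<forall>\<^sub>F N in sequentially. norm \<parallel>(x \<otimes> y) \<otimes> (z \<otimes> S [^] N)\<parallel> \<le> \<parallel>x\<parallel> * \<parallel>y \<otimes> (z \<otimes> S [^] N)\<parallel>"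
      using x yc z by (intro always_eventually allI) (simp add: m_assoc cnorm_mult)
  qed
qed (use x y in auto)

lemma null_ideal_mult_right: assumes x: "x \<in> carrier A" and y: "y \<in> null_ideal" shows "y \<otimes> x \<in> null_ideal"
proof (rule null_idealI)
  fix z assume "z \<in> carrier A"
  then show "(\<lambda>N. \<parallel>(y \<otimes> x) \<otimes> (z \<otimes> S [^] N)\<parallel>) \<longlonglongrightarrow> 0"
    using null_idealD[OF y, of "x \<otimes> z"] x null_ideal_closed[OF y] by (simp add: m_assoc)
qed (use x y in auto)

lemma null_ideal_scl: "x \<in> null_ideal \<Longrightarrow> c \<odot> x \<in> null_ideal"
  using null_ideal_mult_left[of "c \<odot> \<one>" x] by (simp add: smult_mult_left)

lemma null_ideal_gauge: assumes x: "x \<in> null_ideal" shows "gauge t x \<in> null_ideal"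
proof (rule null_idealI)
  note xc = null_ideal_closed[OF x]
  show "gauge t x \<in> carrier A" using xc by (rule star_homD(1)[OF gauge(1)])
  fix y assume y: "y \<in> carrier A"
  define y' where "y' = gauge (- t) y"
  have y': "y' \<in> carrier A" unfolding y'_def using y by (rule star_homD(1)[OF gauge(1)])
  show "(\<lambda>N. \<parallel>gauge t x \<otimes> (y \<otimes> S [^] N)\<parallel>) \<longlonglongrightarrow> 0"
  proof (rule null_comparison)
    show "(\<lambda>N. \<parallel>x \<otimes> (y' \<otimes> S [^] N)\<parallel>) \<longlonglongrightarrow> 0" using null_idealD[OF x y'] .
    show "\<forall>\<^sub>F N in sequentially. norm \<parallel>gauge t x \<otimes> (y \<otimes> S [^] N)\<parallel> \<le> \<parallel>x \<otimes> (y' \<otimes> S [^] N)\<parallel>"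
    proof (intro always_eventually allI)
      fix N
      have "gauge t (x \<otimes> (y' \<otimes> S [^] N)) = gauge t x \<otimes> (y \<otimes> (cis (real N * t) \<odot> S [^] N))"
        using xc y' gauge_inverse[OF y] by (simp add: star_homD[OF gauge(1)] gauge_S_pow y'_def)
      also have "\<dots> = cis (real N * t) \<odot> (gauge t x \<otimes> (y \<otimes> S [^] N))"
        using y star_homD(1)[OF gauge(1) xc] by (simp add: smult_mult_right)
      finally have "\<parallel>gauge t x \<otimes> (y \<otimes> S [^] N)\<parallel> = \<parallel>gauge t (x \<otimes> (y' \<otimes> S [^] N))\<parallel>"
        using y star_homD(1)[OF gauge(1) xc] by (simp add: cnorm_smult)
      also have "\<dots> \<le> \<parallel>x \<otimes> (y' \<otimes> S [^] N)\<parallel>" using xc y' by (intro star_hom_contractive gauge) auto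
      finally show "norm \<parallel>gauge t x \<otimes> (y \<otimes> S [^] N)\<parallel> \<le> \<parallel>x \<otimes> (y' \<otimes> S [^] N)\<parallel>"
        using y star_homD(1)[OF gauge(1) xc] by simp
    qed
  qed
qed

text \<open>For a monomial \<open>y\<close> and large \<open>N\<close>, the element \<open>y S^N\<close> is zero or a power of \<open>U\<close> times a power of \<open>S\<close>,
and the power of \<open>U\<close> can be moved past \<open>x\<close>.\<close>

lemma comm_U_null_ideal:
  assumes x: "x \<in> comm_U" and lim: "(\<lambda>N. \<parallel>x \<otimes> S [^] (N::nat)\<parallel>) \<longlonglongrightarrow> 0"
  shows "x \<in> null_ideal"
proof (rule null_idealI)
  show xc: "x \<in> carrier A" using x by simp
  have mon: "(\<lambda>N. \<parallel>x \<otimes> (mon a m n b \<otimes> S [^] N)\<parallel>) \<longlonglongrightarrow> 0" for a m n b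
  proof (rule LIMSEQ_offset[of _ n], rule null_comparison)
    show "(\<lambda>N. \<parallel>x \<otimes> S [^] (N + m)\<parallel>) \<longlonglongrightarrow> 0" using LIMSEQ_ignore_initial_segment[OF lim] .
    show "\<forall>\<^sub>F N in sequentially. norm \<parallel>x \<otimes> (mon a m n b \<otimes> S [^] (N + n))\<parallel> \<le> \<parallel>x \<otimes> S [^] (N + m)\<parallel>"
    proof (intro always_eventually allI)
      fix N
      have sp: "S [^] (N + n) = S [^] n \<otimes> S [^] N" "S [^] (N + m) = S [^] m \<otimes> S [^] N"
        by (simp_all add: nat_pow_mult add.commute)
      have "mon a m n b \<otimes> S [^] (N + n) = Up a \<otimes> (S [^] m \<otimes> ((S\<^sup>\<star> [^] n \<otimes> (Up b \<otimes> S [^] n)) \<otimes> S [^] N))"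
        unfolding sp mon_def by (simp add: m_assoc)
      also have "\<dots> = (if 2 ^ n dvd b then Up (a + 2 ^ m * (b div 2 ^ n)) \<otimes> S [^] (N + m) else \<zero>)"
        unfolding adjS_pow_Up_S_pow sp by (simp add: S_pow_Up_left)
      finally show "norm \<parallel>x \<otimes> (mon a m n b \<otimes> S [^] (N + n))\<parallel> \<le> \<parallel>x \<otimes> S [^] (N + m)\<parallel>"
        using xc comm_U_Up_left[OF x] by simp
    qed
  qed
  have pol: "(\<lambda>N. \<parallel>x \<otimes> (y \<otimes> S [^] N)\<parallel>) \<longlonglongrightarrow> 0" if "y \<in> Pol UNIV" for y
    using that unfolding Pol_def
  proof (induction rule: cspan.induct)
    case (base y) then show ?case using mon by (auto simp: mons_def)
  next
    case (add y z)
    have c: "y \<in> carrier A" "z \<in> carrier A" using add.hyps cspan_closed[OF _ mons_closed] by auto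
    show ?case
    proof (rule null_comparison)
      show "(\<lambda>N. \<parallel>x \<otimes> (y \<otimes> S [^] N)\<parallel> + \<parallel>x \<otimes> (z \<otimes> S [^] N)\<parallel>) \<longlonglongrightarrow> 0"
        using tendsto_add_zero[OF add.IH] .
      show "\<forall>\<^sub>F N in sequentially. norm \<parallel>x \<otimes> ((y \<oplus> z) \<otimes> S [^] N)\<parallel> \<le> \<parallel>x \<otimes> (y \<otimes> S [^] N)\<parallel> + \<parallel>x \<otimes> (z \<otimes> S [^] N)\<parallel>"
        using c xc by (intro always_eventually allI) (simp add: l_distr r_distr cnorm_triangle)
    qed
  next
    case (scale y c)
    have "y \<in> carrier A" using scale.hyps cspan_closed[OF _ mons_closed] by auto
    then show ?case using tendsto_mult_right_zero[OF scale.IH, of "cmod c"] xc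
      by (simp add: smult_mult_left smult_mult_right cnorm_smult)
  qed (use xc in simp)
  fix y assume y: "y \<in> carrier A"
  show "(\<lambda>N. \<parallel>x \<otimes> (y \<otimes> S [^] N)\<parallel>) \<longlonglongrightarrow> 0"
  proof (rule LIMSEQ_I)
    fix e :: real assume e: "e > 0"
    define d where "d = e / (2 * (\<parallel>x\<parallel> + 1))"
    have x1: "\<parallel>x\<parallel> + 1 > 0" using cnorm_nonneg[OF xc] by linarith
    have "a * (e / (2 * a)) = e / 2" if "a > 0" for a :: real using that by (simp add: field_simps)
    then have d: "d > 0" "(\<parallel>x\<parallel> + 1) * d = e / 2"
      unfolding d_def using e x1 by (simp, blast)
    obtain p where p: "p \<in> Pol UNIV" "\<parallel>y \<ominus> p\<parallel> \<le> d" using Pol_dense[OF y d(1)] by blast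
    note pc = Pol_closed[OF p(1)]
    have "\<forall>\<^sub>F N in sequentially. \<parallel>x \<otimes> (p \<otimes> S [^] N)\<parallel> < e / 2"
      using order_tendstoD(2)[OF pol[OF p(1)], of "e / 2"] e half_gt_zero by blast
    then obtain N0 :: nat where N0: "\<And>N. N \<ge> N0 \<Longrightarrow> \<parallel>x \<otimes> (p \<otimes> S [^] N)\<parallel> < e / 2"
      unfolding eventually_sequentially by blast
    have "norm (\<parallel>x \<otimes> (y \<otimes> S [^] N)\<parallel> - 0) < e" if "N \<ge> N0" for N
    proof -
      have "x \<otimes> (y \<otimes> S [^] N) = x \<otimes> ((y \<ominus> p) \<otimes> S [^] N) \<oplus> x \<otimes> (p \<otimes> S [^] N)"
        using xc y pc nat_pow_closed[OF S, of N] by algebra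
      then have "\<parallel>x \<otimes> (y \<otimes> S [^] N)\<parallel> \<le> \<parallel>x \<otimes> ((y \<ominus> p) \<otimes> S [^] N)\<parallel> + \<parallel>x \<otimes> (p \<otimes> S [^] N)\<parallel>"
        using xc y pc by (simp add: cnorm_triangle)
      also have "\<parallel>x \<otimes> ((y \<ominus> p) \<otimes> S [^] N)\<parallel> \<le> (\<parallel>x\<parallel> + 1) * (d * 1)"
        using xc y pc p by (intro cnorm_mult_le) auto
      finally show ?thesis using N0[OF that] d xc y by simp
    qed
    then show "\<exists>N0 :: nat. \<forall>N\<ge>N0. norm (\<parallel>x \<otimes> (y \<otimes> S [^] N)\<parallel> - 0) < e" by blast
  qed
qed

text \<open>If \<open>c\<close> is in the ideal, then \<open>b\<^sup>2 - (b - c)\<^sup>2\<close> is again in the ideal.\<close>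

lemma iter_sq_mod_null_ideal:
  assumes b: "b \<in> carrier A" and c: "c \<in> null_ideal"
  shows "\<exists>c'\<in>null_ideal. \<parallel>iter_sq l b \<ominus> c'\<parallel> \<le> \<parallel>b \<ominus> c\<parallel> ^ (2 ^ l)"
proof (induction l)
  case 0 then show ?case using c by auto
next
  case (Suc l)
  then obtain c' where c': "c' \<in> null_ideal" "\<parallel>iter_sq l b \<ominus> c'\<parallel> \<le> \<parallel>b \<ominus> c\<parallel> ^ (2 ^ l)" by blast
  define s where "s = iter_sq l b"
  have s: "s \<in> carrier A" using b by (simp add: s_def)
  note cc = null_ideal_closed[OF c'(1)]
  \<comment> \<open>Chosen so that \<open>s\<^sup>2 - c'' = (s - c')\<^sup>2\<close>.\<close>
  define c'' where "c'' = s \<otimes> c' \<oplus> c' \<otimes> (s \<ominus> c')"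
  have c'': "c'' \<in> null_ideal" unfolding c''_def
    using s cc c'(1) by (intro null_ideal_add null_ideal_mult_left null_ideal_mult_right) auto
  have "s \<otimes> s \<ominus> c'' = (s \<ominus> c') \<otimes> (s \<ominus> c')" unfolding c''_def using s cc by algebra
  then have "\<parallel>s \<otimes> s \<ominus> c''\<parallel> \<le> \<parallel>b \<ominus> c\<parallel> ^ (2 ^ l) * \<parallel>b \<ominus> c\<parallel> ^ (2 ^ l)"
    using c'(2) s cc by (simp only: s_def[symmetric]) (intro cnorm_mult_le, auto)
  also have "\<dots> = \<parallel>b \<ominus> c\<parallel> ^ (2 ^ Suc l)" by (simp add: mult_2 power_add)
  finally show ?case using c'' by (auto simp: s_def)
qed

text \<open>The power trick: a loss that is polynomial in the exponent disappears in the limit, because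
the norm of a self-adjoint element is multiplicative on iterated squares.\<close>

lemma cnorm_le_dist_null_ideal_if_powers:
  assumes b: "b \<in> carrier A" "b\<^sup>\<star> = b" and c: "c \<in> null_ideal" and C: "C \<ge> 0"
    and pow: "\<And>l c'. c' \<in> null_ideal \<Longrightarrow> \<parallel>iter_sq l b\<parallel> \<le> C * 4 ^ l * \<parallel>iter_sq l b \<ominus> c'\<parallel>"
  shows "\<parallel>b\<parallel> \<le> \<parallel>b \<ominus> c\<parallel>"
proof (rule le_if_square_powers_le)
  show "0 \<le> \<parallel>b \<ominus> c\<parallel>" using b c by simp
  fix l
  obtain c' where c': "c' \<in> null_ideal" "\<parallel>iter_sq l b \<ominus> c'\<parallel> \<le> \<parallel>b \<ominus> c\<parallel> ^ (2 ^ l)"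
    using iter_sq_mod_null_ideal[OF b(1) c] by blast
  have "\<parallel>b\<parallel> ^ (2 ^ l) \<le> C * 4 ^ l * \<parallel>iter_sq l b \<ominus> c'\<parallel>" using pow[OF c'(1)] cnorm_iter_sq[OF b] by simp
  also have "\<dots> \<le> C * 4 ^ l * \<parallel>b \<ominus> c\<parallel> ^ (2 ^ l)" using c'(2) C by (intro mult_left_mono) auto
  finally show "\<parallel>b\<parallel> ^ (2 ^ l) \<le> C * 4 ^ l * \<parallel>b \<ominus> c\<parallel> ^ (2 ^ l)" .
qed

section \<open>The null ideal is zero\<close>

text \<open>The decomposition \<open>1 = S S* + U S S* U*\<close> identifies the algebra with the two by two matrices over itself;
\<open>entry s t b\<close> for \<open>s, t\<close> in \<open>{0, 1}\<close> are the matrix entries of \<open>b\<close>.\<close>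

definition entry :: "int \<Rightarrow> int \<Rightarrow> 'a \<Rightarrow> 'a" where
  "entry s t b = S\<^sup>\<star> \<otimes> (Up (- s) \<otimes> (b \<otimes> (Up t \<otimes> S)))"

lemma entry_closed [simp]: "b \<in> carrier A \<Longrightarrow> entry s t b \<in> carrier A"
  by (simp add: entry_def)

lemma entry_add: "b \<in> carrier A \<Longrightarrow> c \<in> carrier A \<Longrightarrow> entry s t (b \<oplus> c) = entry s t b \<oplus> entry s t c"
  by (simp add: entry_def l_distr r_distr)

lemma entry_scl: "b \<in> carrier A \<Longrightarrow> entry s t (k \<odot> b) = k \<odot> entry s t b"
  by (simp add: entry_def smult_mult_left smult_mult_right)

lemma entry_minus: "b \<in> carrier A \<Longrightarrow> c \<in> carrier A \<Longrightarrow> entry s t (b \<ominus> c) = entry s t b \<ominus> entry s t c"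
  by (simp add: minus_scl entry_add entry_scl)

lemma entry_zero [simp]: "entry s t \<zero> = \<zero>"
  by (simp add: entry_def)

lemma cnorm_entry_le: "b \<in> carrier A \<Longrightarrow> \<parallel>entry s t b\<parallel> \<le> \<parallel>b\<parallel>"
proof -
  assume b: "b \<in> carrier A"
  have S1: "\<parallel>S\<^sup>\<star>\<parallel> \<le> 1" using cnorm_S_mult[of \<one>] by simp
  have "\<parallel>b \<otimes> (Up t \<otimes> S)\<parallel> \<le> \<parallel>b\<parallel> * 1"
    using b cnorm_S_mult[of \<one>] by (intro cnorm_mult_le) auto
  then have "\<parallel>S\<^sup>\<star> \<otimes> (Up (- s) \<otimes> (b \<otimes> (Up t \<otimes> S)))\<parallel> \<le> 1 * \<parallel>b\<parallel>"
    using b S1 by (intro cnorm_mult_le) auto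
  then show ?thesis by (simp add: entry_def)
qed

lemma entry_null_ideal: "c \<in> null_ideal \<Longrightarrow> entry s t c \<in> null_ideal"
  unfolding entry_def by (simp add: null_ideal_mult_left null_ideal_mult_right)

lemma resolution': "\<one> = S \<otimes> S\<^sup>\<star> \<oplus> Up 1 \<otimes> (S \<otimes> (S\<^sup>\<star> \<otimes> Up (-1)))"
  using resolution by (simp add: Up_1 Up_m1 m_assoc)

lemma entry_mult:
  assumes b: "b \<in> carrier A" "c \<in> carrier A"
  shows "entry s t (b \<otimes> c) = entry s 0 b \<otimes> entry 0 t c \<oplus> entry s 1 b \<otimes> entry 1 t c"
proof -
  have "entry s t (b \<otimes> c) = S\<^sup>\<star> \<otimes> (Up (- s) \<otimes> (b \<otimes> (\<one> \<otimes> (c \<otimes> (Up t \<otimes> S)))))"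
    using b by (simp add: entry_def m_assoc)
  then show ?thesis unfolding resolution'
    using b by (simp add: entry_def l_distr r_distr m_assoc)
qed

lemma sum_entries:
  assumes b: "b \<in> carrier A"
  shows "b = (S \<otimes> (entry 0 0 b \<otimes> S\<^sup>\<star>) \<oplus> S \<otimes> (entry 0 1 b \<otimes> (S\<^sup>\<star> \<otimes> Up (-1)))) \<oplus>
    (Up 1 \<otimes> (S \<otimes> (entry 1 0 b \<otimes> S\<^sup>\<star>)) \<oplus> Up 1 \<otimes> (S \<otimes> (entry 1 1 b \<otimes> (S\<^sup>\<star> \<otimes> Up (-1)))))"
proof -
  have "b = (S \<otimes> S\<^sup>\<star> \<oplus> Up 1 \<otimes> (S \<otimes> (S\<^sup>\<star> \<otimes> Up (-1)))) \<otimes> (b \<otimes> (S \<otimes> S\<^sup>\<star> \<oplus> Up 1 \<otimes> (S \<otimes> (S\<^sup>\<star> \<otimes> Up (-1)))))"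
    unfolding resolution'[symmetric] using b by simp
  also have "\<dots> = (S \<otimes> (entry 0 0 b \<otimes> S\<^sup>\<star>) \<oplus> S \<otimes> (entry 0 1 b \<otimes> (S\<^sup>\<star> \<otimes> Up (-1)))) \<oplus>
    (Up 1 \<otimes> (S \<otimes> (entry 1 0 b \<otimes> S\<^sup>\<star>)) \<oplus> Up 1 \<otimes> (S \<otimes> (entry 1 1 b \<otimes> (S\<^sup>\<star> \<otimes> Up (-1)))))"
    using b by (simp add: entry_def l_distr r_distr m_assoc a_ac)
  finally show ?thesis .
qed

text \<open>The matrices with entries in \<open>E\<close>. The iterate \<open>lift ^^ m\<close> consists of matrices of size \<open>2^m\<close>, and all
polynomials of degree \<open>0\<close> are such matrices over trigonometric polynomials.\<close>

definition lift :: "'a set \<Rightarrow> 'a set" where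
  "lift E = {b \<in> carrier A. \<forall>s\<in>{0,1}. \<forall>t\<in>{0,1}. entry s t b \<in> E}"

lemma liftI:
  "b \<in> carrier A \<Longrightarrow> (\<And>s t. s \<in> {0,1} \<Longrightarrow> t \<in> {0,1} \<Longrightarrow> entry s t b \<in> E) \<Longrightarrow> b \<in> lift E"
  by (simp add: lift_def)

lemma lift_mono: "E \<subseteq> F \<Longrightarrow> lift E \<subseteq> lift F"
  unfolding lift_def by blast

lemma lift_pow_mono: "E \<subseteq> F \<Longrightarrow> (lift ^^ m) E \<subseteq> (lift ^^ m) F"
  by (induction m) (auto dest: lift_mono)

lemma subspace_lift: assumes "subspace E" shows "subspace (lift E)"
  using assms unfolding subspace_def
  by (auto simp: lift_def entry_add entry_scl)

lemma subspace_lift_pow: "subspace E \<Longrightarrow> subspace ((lift ^^ m) E)"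
  by (induction m) (auto intro: subspace_lift)

lemma lift_mult:
  assumes E: "subspace E3" and EE: "\<And>x y. x \<in> E1 \<Longrightarrow> y \<in> E2 \<Longrightarrow> x \<otimes> y \<in> E3"
    and b: "b \<in> lift E1" "c \<in> lift E2"
  shows "b \<otimes> c \<in> lift E3"
proof -
  have bc: "b \<in> carrier A" "c \<in> carrier A" using b by (auto simp: lift_def)
  show ?thesis using bc b E EE unfolding lift_def subspace_def by (simp add: entry_mult)
qed

lemma lift_pow_mult:
  assumes E: "subspace E3" and EE: "\<And>x y. x \<in> E1 \<Longrightarrow> y \<in> E2 \<Longrightarrow> x \<otimes> y \<in> E3"
  shows "b \<in> (lift ^^ m) E1 \<Longrightarrow> c \<in> (lift ^^ m) E2 \<Longrightarrow> b \<otimes> c \<in> (lift ^^ m) E3"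
proof (induction m arbitrary: b c)
  case (Suc m)
  have "b \<in> lift ((lift ^^ m) E1)" "c \<in> lift ((lift ^^ m) E2)" using Suc.prems by simp_all
  then show ?case using lift_mult[OF subspace_lift_pow[OF E] Suc.IH] by simp
qed (use EE in simp)

definition Trig_le :: "int \<Rightarrow> 'a set" where "Trig_le D = cspan (Up ` {- D..D})"

lemma subspace_Trig_le: "subspace (Trig_le D)"
  unfolding Trig_le_def by (rule subspace_cspan) auto

lemma Trig_le_mono: "D \<le> D' \<Longrightarrow> Trig_le D \<subseteq> Trig_le D'"
  unfolding Trig_le_def by (intro cspan_subset subspace_cspan) (auto intro!: cspan.base)

lemma Trig_le_mult: "x \<in> Trig_le D \<Longrightarrow> y \<in> Trig_le D' \<Longrightarrow> x \<otimes> y \<in> Trig_le (D + D')"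
  unfolding Trig_le_def by (erule cspan_mult[rotated 3]) (auto intro!: cspan.base)

lemma Up_Trig_le: "\<bar>k\<bar> \<le> D \<Longrightarrow> Up k \<in> Trig_le D"
  unfolding Trig_le_def by (rule cspan.base, rule imageI) (simp add: abs_le_iff)

lemma zero_Trig_le: "\<zero> \<in> Trig_le D"
  unfolding Trig_le_def by (rule cspan.zero)

lemma entry_Up: "entry s t (Up k) = (if even (k + t - s) then Up ((k + t - s) div 2) else \<zero>)"
proof -
  have "entry s t (Up k) = S\<^sup>\<star> \<otimes> (Up (k + t - s) \<otimes> S)" by (simp add: entry_def algebra_simps)
  then show ?thesis by (simp only: adjS_Up_S)
qed

lemma Trig_le_subset_lift: assumes "\<And>k s t. \<bar>k\<bar> \<le> D \<Longrightarrow> s \<in> {0,1} \<Longrightarrow> t \<in> {0,1} \<Longrightarrow> even (k + t - s) \<Longrightarrow> \<bar>(k + t - s) div 2\<bar> \<le> D'"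
  shows "Trig_le D \<subseteq> lift (Trig_le D')"
  unfolding Trig_le_def[of D]
proof (rule cspan_subset[OF subspace_lift[OF subspace_Trig_le]], rule image_subsetI)
  fix k assume "k \<in> {- D..D}"
  then have k: "\<bar>k\<bar> \<le> D" by auto
  have "entry s t (Up k) \<in> Trig_le D'" if "s \<in> {0,1}" "t \<in> {0,1}" for s t
    unfolding entry_Up using Up_Trig_le assms[OF k that] zero_Trig_le by simp
  then show "Up k \<in> lift (Trig_le D')" by (intro liftI) simp_all
qed

lemma Trig_le_lift_same: "D \<ge> 1 \<Longrightarrow> Trig_le D \<subseteq> lift (Trig_le D)"
proof (rule Trig_le_subset_lift)
  fix k s t :: int
  assume D: "D \<ge> 1" and *: "\<bar>k\<bar> \<le> D" "s \<in> {0,1}" "t \<in> {0,1}" "even (k + t - s)"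
  from *(4) obtain j where j: "k + t - s = 2 * j" by blast
  have "\<bar>j\<bar> \<le> D" using *(1-3) D j by (elim insertE emptyE) linarith+
  then show "\<bar>(k + t - s) div 2\<bar> \<le> D" unfolding j by simp
qed

text \<open>Passing to entries halves the exponents of \<open>U\<close>. The shift \<open>t - s\<close> may raise an exponent to
\<open>2^(n+1) + 1\<close> in absolute value, but this number is odd and the entry is zero.\<close>

lemma Trig_le_lift_half: "Trig_le (2 ^ Suc n) \<subseteq> lift (Trig_le (2 ^ n))"
proof (rule Trig_le_subset_lift)
  fix k s t :: int
  assume *: "\<bar>k\<bar> \<le> 2 ^ Suc n" "s \<in> {0,1}" "t \<in> {0,1}" "even (k + t - s)"
  from *(4) obtain j where j: "k + t - s = 2 * j" by blast
  have "\<bar>k\<bar> \<le> 2 * 2 ^ n" using *(1) by simp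
  then have "\<bar>j\<bar> \<le> 2 ^ n" using *(2,3) j by (elim insertE emptyE) linarith+
  then show "\<bar>(k + t - s) div 2\<bar> \<le> 2 ^ n" unfolding j by simp
qed

lemma Trig_le_lift_pow: "Trig_le (2 ^ n) \<subseteq> (lift ^^ n) (Trig_le 1)"
proof (induction n)
  case (Suc n)
  have "Trig_le (2 ^ Suc n) \<subseteq> lift (Trig_le (2 ^ n))" by (rule Trig_le_lift_half)
  also have "\<dots> \<subseteq> lift ((lift ^^ n) (Trig_le 1))" by (rule lift_mono[OF Suc])
  finally show ?case by simp
qed simp

lemma lift_pow_le: "D \<ge> 1 \<Longrightarrow> (lift ^^ m) (Trig_le D) \<subseteq> (lift ^^ (m + k)) (Trig_le D)"
proof (induction k)
  case (Suc k)
  have "(lift ^^ (m + k)) (Trig_le D) \<subseteq> (lift ^^ (m + k)) (lift (Trig_le D))"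
    using Suc.prems by (intro lift_pow_mono Trig_le_lift_same)
  then show ?case using Suc by (simp add: funpow_swap1)
qed simp

lemma lift_pow_Trig_le_mono:
  assumes "m \<le> m'" "p \<le> (p' :: nat)" shows "(lift ^^ m) (Trig_le (2 ^ p)) \<subseteq> (lift ^^ m') (Trig_le (2 ^ p'))"
proof -
  have "(lift ^^ m) (Trig_le (2 ^ p)) \<subseteq> (lift ^^ m) (Trig_le (2 ^ p'))"
    using assms by (intro lift_pow_mono Trig_le_mono) simp
  also have "\<dots> \<subseteq> (lift ^^ m') (Trig_le (2 ^ p'))" using lift_pow_le[of "2 ^ p'" m "m' - m"] assms by simp
  finally show ?thesis .
qed

lemma entry_mon_Suc:
  "entry s t (mon a (Suc m) (Suc m) b) =
    (if even (a - s) \<and> even (b + t) then mon ((a - s) div 2) m m ((b + t) div 2) else \<zero>)"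
proof -
  have 1: "S [^] Suc m = S \<otimes> S [^] m" by (rule nat_pow_Suc2) simp
  have "entry s t (mon a (Suc m) (Suc m) b) =
    S\<^sup>\<star> \<otimes> (Up (a - s) \<otimes> (S \<otimes> (S [^] m \<otimes> (S\<^sup>\<star> [^] m \<otimes> (S\<^sup>\<star> \<otimes> (Up (b + t) \<otimes> S))))))"
    unfolding entry_def mon_def 1 by (simp add: m_assoc)
  then show ?thesis by (simp add: adjS_Up_S_left adjS_Up_S mon_def)
qed

lemma mon_lift_pow:
  assumes D: "D \<ge> 1" shows "\<bar>a\<bar> \<le> D \<Longrightarrow> \<bar>b\<bar> \<le> D \<Longrightarrow> mon a m m b \<in> (lift ^^ m) (Trig_le (2 * D))"
proof (induction m arbitrary: a b)
  case 0 then show ?case by (simp add: mon_def Up_Trig_le)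
next
  case (Suc m)
  have z: "\<zero> \<in> (lift ^^ m) (Trig_le (2 * D))" using subspace_lift_pow[OF subspace_Trig_le] by (simp add: subspace_def)
  have "entry s t (mon a (Suc m) (Suc m) b) \<in> (lift ^^ m) (Trig_le (2 * D))" if st: "s \<in> {0,1}" "t \<in> {0,1}" for s t
  proof -
    have "\<bar>(a - s) div 2\<bar> \<le> D" "\<bar>(b + t) div 2\<bar> \<le> D" using st Suc.prems D by auto
    then show ?thesis unfolding entry_mon_Suc using Suc.IH z by simp
  qed
  then show ?case by (auto intro: liftI)
qed

lemma Pol_0_lift: "b \<in> Pol {0} \<Longrightarrow> \<exists>m p. b \<in> (lift ^^ m) (Trig_le (2 ^ p))"
  unfolding Pol_def
proof (induction rule: cspan.induct)
  case zero
  then show ?case using subspace_Trig_le by (intro exI[of _ 0]) (simp add: zero_Trig_le)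
next
  case (base y)
  then obtain a m b where y: "y = mon a m m b" by (auto simp: mons_def)
  define n where "n = nat (\<bar>a\<bar> + \<bar>b\<bar>)"
  have "\<bar>a\<bar> + \<bar>b\<bar> \<le> 2 ^ n" using of_nat_mono[OF less_imp_le[OF less_exp[of n]], where 'a = int] by (simp add: n_def)
  then have "mon a m m b \<in> (lift ^^ m) (Trig_le (2 * 2 ^ n))" by (intro mon_lift_pow) auto
  then show ?case unfolding y by (intro exI[of _ m] exI[of _ "Suc n"]) simp
next
  case (add x y)
  then obtain m p m' p' where *: "x \<in> (lift ^^ m) (Trig_le (2 ^ p))" "y \<in> (lift ^^ m') (Trig_le (2 ^ p'))" by blast
  then have "x \<in> (lift ^^ (max m m')) (Trig_le (2 ^ (max p p')))" "y \<in> (lift ^^ (max m m')) (Trig_le (2 ^ (max p p')))"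
    using lift_pow_Trig_le_mono[of m "max m m'" p "max p p'"] lift_pow_Trig_le_mono[of m' "max m m'" p' "max p p'"] by auto
  then show ?case using subspace_lift_pow[OF subspace_Trig_le] unfolding subspace_def by blast
next
  case (scale x c)
  then show ?case using subspace_lift_pow[OF subspace_Trig_le] unfolding subspace_def by blast
qed

text \<open>The norm of a matrix is at most the sum of the norms of its four entries, and passing to an entry
does not increase the distance to the ideal.\<close>

lemma lift_cnorm_bound:
  assumes E: "\<And>b c. b \<in> E \<Longrightarrow> c \<in> null_ideal \<Longrightarrow> \<parallel>b\<parallel> \<le> C * \<parallel>b \<ominus> c\<parallel>" and C: "C \<ge> 0"
    and b: "b \<in> lift E" and c: "c \<in> null_ideal"
  shows "\<parallel>b\<parallel> \<le> 4 * C * \<parallel>b \<ominus> c\<parallel>"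
proof -
  have bc: "b \<in> carrier A" using b by (simp add: lift_def)
  have ent: "\<parallel>entry s t b\<parallel> \<le> C * \<parallel>b \<ominus> c\<parallel>" if "s \<in> {0,1}" "t \<in> {0,1}" for s t
  proof -
    have "\<parallel>entry s t b\<parallel> \<le> C * \<parallel>entry s t b \<ominus> entry s t c\<parallel>"
      using that b by (intro E entry_null_ideal c) (auto simp: lift_def)
    also have "\<dots> = C * \<parallel>entry s t (b \<ominus> c)\<parallel>" using bc c by (simp add: entry_minus)
    also have "\<dots> \<le> C * \<parallel>b \<ominus> c\<parallel>" using C bc c by (intro mult_left_mono cnorm_entry_le) auto
    finally show ?thesis .
  qed
  define K where "K = C * \<parallel>b \<ominus> c\<parallel>"
  have S1: "\<parallel>S\<^sup>\<star>\<parallel> \<le> 1" using cnorm_S_mult[of \<one>] by simp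
  have nS: "\<parallel>x \<otimes> S\<^sup>\<star>\<parallel> \<le> \<parallel>x\<parallel>" "\<parallel>x \<otimes> (S\<^sup>\<star> \<otimes> Up (-1))\<parallel> \<le> \<parallel>x\<parallel>" if "x \<in> carrier A" for x
    using cnorm_mult_le[of x "S\<^sup>\<star>" "\<parallel>x\<parallel>" 1] cnorm_mult_le[of x "S\<^sup>\<star> \<otimes> Up (-1)" "\<parallel>x\<parallel>" 1] that S1 by simp_all
  have K: "\<parallel>entry s t b \<otimes> S\<^sup>\<star>\<parallel> \<le> K" "\<parallel>entry s t b \<otimes> (S\<^sup>\<star> \<otimes> Up (-1))\<parallel> \<le> K"
    if "s \<in> {0,1}" "t \<in> {0,1}" for s t
    using order.trans[OF nS(1) ent[OF that]] order.trans[OF nS(2) ent[OF that]] bc by (simp_all add: K_def)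
  have "\<parallel>b\<parallel> \<le> (\<parallel>S \<otimes> (entry 0 0 b \<otimes> S\<^sup>\<star>)\<parallel> + \<parallel>S \<otimes> (entry 0 1 b \<otimes> (S\<^sup>\<star> \<otimes> Up (-1)))\<parallel>) +
    (\<parallel>Up 1 \<otimes> (S \<otimes> (entry 1 0 b \<otimes> S\<^sup>\<star>))\<parallel> + \<parallel>Up 1 \<otimes> (S \<otimes> (entry 1 1 b \<otimes> (S\<^sup>\<star> \<otimes> Up (-1))))\<parallel>)"
    using bc by (subst sum_entries[OF bc]) (intro order.trans[OF cnorm_triangle] add_mono, auto intro: cnorm_triangle)
  also have "\<dots> \<le> (K + K) + (K + K)"
    using bc K by (intro add_mono) simp_all
  finally show ?thesis by (simp add: K_def)
qed

lemma Trig_le_1_repr: "g \<in> Trig_le 1 \<Longrightarrow> \<exists>a b c. g = (a \<odot> Up (-1) \<oplus> b \<odot> \<one>) \<oplus> c \<odot> Up 1"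
  unfolding Trig_le_def
proof (induction rule: cspan.induct)
  case zero
  then show ?case by (intro exI[of _ 0]) simp
next
  case (base x)
  then obtain k where k: "x = Up k" "k \<in> {-1..1}" by auto
  then consider "k = -1" | "k = 0" | "k = 1" by fastforce
  then show ?case
  proof cases
    case 1 show ?thesis by (rule exI[of _ 1], rule exI[of _ 0], rule exI[of _ 0]) (simp add: k(1) 1)
  next
    case 2 show ?thesis by (rule exI[of _ 0], rule exI[of _ 1], rule exI[of _ 0]) (simp add: k(1) 2)
  next
    case 3 show ?thesis by (rule exI[of _ 0], rule exI[of _ 0], rule exI[of _ 1]) (simp add: k(1) 3)
  qed
next
  case (add x y)
  then obtain a b c a' b' c' where "x = (a \<odot> Up (-1) \<oplus> b \<odot> \<one>) \<oplus> c \<odot> Up 1"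
    "y = (a' \<odot> Up (-1) \<oplus> b' \<odot> \<one>) \<oplus> c' \<odot> Up 1" by blast
  then have "x \<oplus> y = ((a + a') \<odot> Up (-1) \<oplus> (b + b') \<odot> \<one>) \<oplus> (c + c') \<odot> Up 1"
    by (simp add: scl_add a_ac)
  then show ?case by blast
next
  case (scale x k)
  then obtain a b c where "x = (a \<odot> Up (-1) \<oplus> b \<odot> \<one>) \<oplus> c \<odot> Up 1" by blast
  then have "k \<odot> x = ((k * a) \<odot> Up (-1) \<oplus> (k * b) \<odot> \<one>) \<oplus> (k * c) \<odot> Up 1"
    by (simp add: scl_distr scl_scl)
  then show ?case by blast
qed

lemma adjS_pow_Up_small:
  assumes "\<bar>k\<bar> \<le> 2" shows "S\<^sup>\<star> [^] (n + 2 :: nat) \<otimes> (Up k \<otimes> S [^] (n + 2)) = (if k = 0 then \<one> else \<zero>)"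
proof -
  have "\<not> 2 ^ (n + 2) dvd k" if "k \<noteq> 0"
  proof
    assume "2 ^ (n + 2) dvd k"
    then have "2 ^ (n + 2) \<le> \<bar>k\<bar>" using dvd_imp_le_int[OF that] by fastforce
    moreover have "(2::int) ^ (n + 2) \<ge> 4" by simp
    ultimately show False using assms by linarith
  qed
  then show ?thesis unfolding adjS_pow_Up_S_pow by auto
qed

text \<open>Compression by \<open>S^N\<close> with large \<open>N\<close> reads off each of the three coefficients and annihilates the
ideal asymptotically.\<close>

lemma Trig_le_1_bound:
  assumes g: "g \<in> Trig_le 1" and i: "i \<in> null_ideal" shows "\<parallel>g\<parallel> \<le> 3 * \<parallel>g \<ominus> i\<parallel>"
proof -
  obtain a b c where gr: "g = (a \<odot> Up (-1) \<oplus> b \<odot> \<one>) \<oplus> c \<odot> Up 1" using Trig_le_1_repr[OF g] by blast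
  have gc: "g \<in> carrier A" by (simp add: gr)
  note ic = null_ideal_closed[OF i]
  have coeff: "cmod k \<le> \<parallel>g \<ominus> i\<parallel>"
    if "\<And>n :: nat. S\<^sup>\<star> [^] (n + 2) \<otimes> (Up l \<otimes> (g \<otimes> S [^] (n + 2))) = k \<odot> \<one>" for k l
  proof (rule field_le_epsilon)
    fix e :: real assume "e > 0"
    then obtain N0 :: nat where "\<And>N. N \<ge> N0 \<Longrightarrow> \<parallel>i \<otimes> (\<one> \<otimes> S [^] N)\<parallel> < e"
      using order_tendstoD(2)[OF null_idealD[OF i, of \<one>]] unfolding eventually_sequentially by blast
    from this[of "N0 + 2"] have N: "\<parallel>i \<otimes> S [^] (N0 + 2)\<parallel> < e" by simp
    define s where "s = S [^] (N0 + 2)"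
    have s: "s \<in> carrier A" "\<parallel>s\<parallel> = 1" by (simp_all add: s_def del: nat_pow_Suc add_2_eq_Suc')
    define v where "v = S\<^sup>\<star> [^] (N0 + 2) \<otimes> Up l"
    have v: "v \<in> carrier A" "\<parallel>v\<parallel> = 1" by (simp_all add: v_def del: nat_pow_Suc add_2_eq_Suc')
    have "k \<odot> \<one> = v \<otimes> (g \<otimes> s)" using that[of N0] gc by (simp add: v_def s_def m_assoc del: nat_pow_Suc add_2_eq_Suc')
    also have "\<dots> = v \<otimes> ((g \<ominus> i) \<otimes> s) \<oplus> v \<otimes> (i \<otimes> s)" using v(1) s(1) gc ic by algebra
    finally have "cmod k = \<parallel>v \<otimes> ((g \<ominus> i) \<otimes> s) \<oplus> v \<otimes> (i \<otimes> s)\<parallel>" using cnorm_smult[of \<one> k] by simp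
    also have "\<dots> \<le> \<parallel>v \<otimes> ((g \<ominus> i) \<otimes> s)\<parallel> + \<parallel>v \<otimes> (i \<otimes> s)\<parallel>"
      using v(1) s(1) gc ic by (intro cnorm_triangle) auto
    also have "\<dots> \<le> 1 * (\<parallel>g \<ominus> i\<parallel> * 1) + 1 * e"
      using v s gc ic N[folded s_def] by (intro add_mono cnorm_mult_le) auto
    finally show "cmod k \<le> \<parallel>g \<ominus> i\<parallel> + e" by simp
  qed
  have "cmod a \<le> \<parallel>g \<ominus> i\<parallel>"
    by (rule coeff[of 1]) (simp add: gr l_distr r_distr smult_mult_left smult_mult_right m_assoc adjS_pow_Up_small del: nat_pow_Suc add_2_eq_Suc')
  moreover have "cmod b \<le> \<parallel>g \<ominus> i\<parallel>"
    by (rule coeff[of 0]) (simp add: gr l_distr r_distr smult_mult_left smult_mult_right m_assoc adjS_pow_Up_small del: nat_pow_Suc add_2_eq_Suc')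
  moreover have "cmod c \<le> \<parallel>g \<ominus> i\<parallel>"
    by (rule coeff[of "-1"]) (simp add: gr l_distr r_distr smult_mult_left smult_mult_right m_assoc adjS_pow_Up_small del: nat_pow_Suc add_2_eq_Suc')
  moreover have "\<parallel>g\<parallel> \<le> (\<parallel>a \<odot> Up (-1)\<parallel> + \<parallel>b \<odot> \<one>\<parallel>) + \<parallel>c \<odot> Up 1\<parallel>"
    unfolding gr by (intro order.trans[OF cnorm_triangle] add_mono) (auto intro: cnorm_triangle)
  then have "\<parallel>g\<parallel> \<le> cmod a + cmod b + cmod c" by (simp add: cnorm_smult)
  ultimately show ?thesis by linarith
qed

lemma lift_pow_bound:
  "b \<in> (lift ^^ n) (Trig_le 1) \<Longrightarrow> c \<in> null_ideal \<Longrightarrow> \<parallel>b\<parallel> \<le> 4 ^ n * 3 * \<parallel>b \<ominus> c\<parallel>"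
proof (induction n arbitrary: b c)
  case 0 then show ?case using Trig_le_1_bound by simp
next
  case (Suc n)
  then show ?case using lift_cnorm_bound[of "(lift ^^ n) (Trig_le 1)" "4 ^ n * 3" b c] by (simp add: mult.assoc)
qed

lemma iter_sq_lift_pow: "b \<in> (lift ^^ m) (Trig_le D) \<Longrightarrow> iter_sq l b \<in> (lift ^^ m) (Trig_le (2 ^ l * D))"
proof (induction l)
  case (Suc l)
  have "iter_sq l b \<otimes> iter_sq l b \<in> (lift ^^ m) (Trig_le (2 ^ l * D + 2 ^ l * D))"
    by (rule lift_pow_mult[OF subspace_Trig_le Trig_le_mult Suc.IH Suc.IH]) (use Suc.prems in auto)
  moreover have "2 ^ l * D + 2 ^ l * D = 2 ^ Suc l * D" by simp
  ultimately show ?case by (simp only: iter_sq.simps)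
qed simp

text \<open>Squaring does not change the matrix size \<open>2^m\<close> and doubles the degree of the entries. Hence \<open>b^(2^l)\<close>
is a matrix of size \<open>2^(m+p+l)\<close> over \<open>Trig_le 1\<close>, which costs a factor polynomial in \<open>2^l\<close>.\<close>

lemma core_cnorm_le_dist:
  assumes b: "b \<in> Pol {0}" "b\<^sup>\<star> = b" and c: "c \<in> null_ideal"
  shows "\<parallel>b\<parallel> \<le> \<parallel>b \<ominus> c\<parallel>"
proof -
  obtain m p where mp: "b \<in> (lift ^^ m) (Trig_le (2 ^ p))" using Pol_0_lift[OF b(1)] by blast
  show ?thesis
  proof (rule cnorm_le_dist_null_ideal_if_powers[OF Pol_closed[OF b(1)] b(2) c, of "4 ^ (m + p) * 3"])
    fix l c' assume c': "c' \<in> null_ideal"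
    have "iter_sq l b \<in> (lift ^^ m) (Trig_le (2 ^ l * 2 ^ p))" using iter_sq_lift_pow[OF mp] .
    also have "\<dots> \<subseteq> (lift ^^ m) ((lift ^^ (l + p)) (Trig_le 1))"
      using Trig_le_lift_pow[of "l + p"] by (intro lift_pow_mono) (simp add: power_add)
    also have "\<dots> = (lift ^^ (m + (l + p))) (Trig_le 1)" by (simp add: funpow_add)
    finally have "\<parallel>iter_sq l b\<parallel> \<le> 4 ^ (m + (l + p)) * 3 * \<parallel>iter_sq l b \<ominus> c'\<parallel>" using lift_pow_bound c' by blast
    then show "\<parallel>iter_sq l b\<parallel> \<le> 4 ^ (m + p) * 3 * 4 ^ l * \<parallel>iter_sq l b \<ominus> c'\<parallel>" by (simp add: power_add mult_ac)
  qed simp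
qed

text \<open>\<open>y* y\<close> has degree \<open>0\<close>, and \<open>y* c\<close> lies in the ideal.\<close>

lemma homogeneous_cnorm_le_dist:
  assumes y: "y \<in> Pol {d}" and c: "c \<in> null_ideal" shows "\<parallel>y\<parallel> \<le> \<parallel>y \<ominus> c\<parallel>"
proof (cases "\<parallel>y\<parallel> = 0")
  case True then show ?thesis using Pol_closed[OF y] c by simp
next
  case False
  note yc = Pol_closed[OF y] and cc = null_ideal_closed[OF c]
  have "y\<^sup>\<star> \<in> Pol {- d}" using Pol_adj[OF y] by simp
  then have b: "y\<^sup>\<star> \<otimes> y \<in> Pol {0}" using Pol_mult[OF _ y, of "y\<^sup>\<star>" "{- d}" "{0}"] by simp
  have "\<parallel>y\<parallel>\<^sup>2 = \<parallel>y\<^sup>\<star> \<otimes> y\<parallel>" using yc by (simp add: cstar_identity)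
  also have "\<dots> \<le> \<parallel>y\<^sup>\<star> \<otimes> y \<ominus> y\<^sup>\<star> \<otimes> c\<parallel>"
    using yc c by (intro core_cnorm_le_dist b null_ideal_mult_left) (auto simp: adj_mult)
  also have "y\<^sup>\<star> \<otimes> y \<ominus> y\<^sup>\<star> \<otimes> c = y\<^sup>\<star> \<otimes> (y \<ominus> c)"
    using yc cc by (simp add: minus_scl r_distr smult_mult_right)
  also have "\<parallel>\<dots>\<parallel> \<le> \<parallel>y\<parallel> * \<parallel>y \<ominus> c\<parallel>" using yc cc by (intro cnorm_mult_le) auto
  finally have "\<parallel>y\<parallel> * \<parallel>y\<parallel> \<le> \<parallel>y\<parallel> * \<parallel>y \<ominus> c\<parallel>" by (simp add: power2_eq_square)
  then show ?thesis using False yc cnorm_nonneg[OF yc] by simp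
qed

text \<open>The projection onto the degrees on which the rotated gauge automorphism acts as \<open>\<sigma>\<close>; two such
projections split a set of degrees into two halves.\<close>

lemma Pol_spectral_part:
  assumes y: "y \<in> Pol D" and \<sigma>: "\<sigma> = 1 \<or> \<sigma> = -1"
    and D: "\<And>d. d \<in> D \<Longrightarrow> cis (- r) * cis (of_int d * t) = 1 \<or> cis (- r) * cis (of_int d * t) = -1"
  shows "(1/2) \<odot> (y \<oplus> (\<sigma> * cis (- r)) \<odot> gauge t y) \<in> Pol {d \<in> D. cis (- r) * cis (of_int d * t) = \<sigma>}"
  using y unfolding Pol_def
proof (induction rule: cspan.induct)
  case zero then show ?case by (simp add: star_hom_zero[OF gauge(1)] cspan.zero)
next
  case (base y)
  then obtain a m n b where y: "y = mon a m n b" "int m - int n \<in> D" by (auto simp: mons_def)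
  define d where "d = int m - int n"
  have "gauge t y = cis (of_int d * t) \<odot> y" unfolding y(1) gauge_mon d_def ..
  then have g: "y \<oplus> (\<sigma> * cis (- r)) \<odot> gauge t y = y \<oplus> (\<sigma> * (cis (- r) * cis (of_int d * t))) \<odot> y"
    using y(1) by (simp add: scl_scl mult.assoc)
  show ?case
  proof (cases "cis (- r) * cis (of_int d * t) = \<sigma>")
    case True
    then have "(1/2) \<odot> (y \<oplus> (\<sigma> * cis (- r)) \<odot> gauge t y) = y" unfolding g using \<sigma> y(1) by auto
    moreover have "y \<in> mons {d \<in> D. cis (- r) * cis (of_int d * t) = \<sigma>}"
      using y True unfolding mons_def d_def by blast
    ultimately show ?thesis by (simp add: cspan.base)
  next
    case False
    then have "\<sigma> * (cis (- r) * cis (of_int d * t)) = -1" using D[of d] \<sigma> y(2) by (auto simp: d_def)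
    then have "y \<oplus> (\<sigma> * cis (- r)) \<odot> gauge t y = \<zero>" unfolding g using minus_scl[of y y] y(1) by simp
    then show ?thesis by (simp add: cspan.zero)
  qed
next
  case (add x y)
  have c: "x \<in> carrier A" "y \<in> carrier A" "gauge t x \<in> carrier A" "gauge t y \<in> carrier A"
    using add.hyps cspan_closed[OF _ mons_closed] star_homD(1)[OF gauge(1)] by auto
  have "(1/2) \<odot> (x \<oplus> y \<oplus> (\<sigma> * cis (- r)) \<odot> gauge t (x \<oplus> y)) =
     (1/2) \<odot> (x \<oplus> (\<sigma> * cis (- r)) \<odot> gauge t x) \<oplus> (1/2) \<odot> (y \<oplus> (\<sigma> * cis (- r)) \<odot> gauge t y)"
    using c by (simp add: star_homD(3)[OF gauge(1)] scl_distr a_ac)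
  then show ?case using add.IH by (simp add: cspan.add)
next
  case (scale x k)
  have c: "x \<in> carrier A" "gauge t x \<in> carrier A"
    using scale.hyps cspan_closed[OF _ mons_closed] star_homD(1)[OF gauge(1)] by auto
  have "(1/2) \<odot> (k \<odot> x \<oplus> (\<sigma> * cis (- r)) \<odot> gauge t (k \<odot> x)) = k \<odot> ((1/2) \<odot> (x \<oplus> (\<sigma> * cis (- r)) \<odot> gauge t x))"
    using c by (simp add: star_homD(6)[OF gauge(1)] scl_distr scl_scl mult_ac)
  then show ?case using scale.IH by (simp only: cspan.scale)
qed

text \<open>The \<open>2^s\<close> possible degrees are separated by repeated halving. Each step uses one gauge automorphism,
which preserves the ideal, and costs a factor of \<open>2\<close>.\<close>

lemma Pol_cnorm_le_dist_progression:
  "(\<And>d. d \<in> D \<Longrightarrow> \<exists>k. d = r + 2 ^ p * k \<and> 0 \<le> k \<and> k < 2 ^ s) \<Longrightarrow> y \<in> Pol D \<Longrightarrow> c \<in> null_ideal \<Longrightarrow>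
    \<parallel>y\<parallel> \<le> 2 ^ s * \<parallel>y \<ominus> c\<parallel>"
proof (induction s arbitrary: r p D y c)
  case 0
  then have "D \<subseteq> {r}" by fastforce
  then have "y \<in> Pol {r}" using 0(2) unfolding Pol_def by (rule_tac cspan_mono) (auto simp: mons_def)
  then show ?case using homogeneous_cnorm_le_dist 0(3) by simp
next
  case (Suc s)
  note yc = Pol_closed[OF Suc.prems(2)] and cc = null_ideal_closed[OF Suc.prems(3)]
  \<comment> \<open>Rotation by \<open>t\<close> multiplies degree \<open>r + 2^p k\<close> by \<open>(-1)^k\<close>, up to a phase depending only on \<open>r\<close>.\<close>
  define t where "t = pi / 2 ^ p"
  define \<omega> where "\<omega> d = cis (- (of_int r * t)) * cis (of_int d * t)" for d :: int
  have \<omega>: "\<omega> (r + 2 ^ p * k) = (if even k then 1 else -1)" for k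
  proof -
    have "\<omega> (r + 2 ^ p * k) = cis (of_int k * pi)"
      unfolding \<omega>_def by (simp add: cis_mult t_def field_simps)
    also have "\<dots> = (if even k then 1 else -1)"
      by (rule complex_eqI) (auto simp: cos_int_times_real mult.commute sin_times_pi_eq_0 elim!: evenE oddE)
    finally show ?thesis .
  qed
  define proj where "proj \<sigma> x = (1/2) \<odot> (x \<oplus> (\<sigma> * cis (- (of_int r * t))) \<odot> gauge t x)" for \<sigma> x
  have gc: "gauge t x \<in> carrier A" if "x \<in> carrier A" for x using that by (rule star_homD(1)[OF gauge(1)])
  have proj_le: "\<parallel>proj \<sigma> x\<parallel> \<le> \<parallel>x\<parallel>" if "x \<in> carrier A" "cmod \<sigma> = 1" for \<sigma> x
  proof -
    have "\<parallel>x \<oplus> (\<sigma> * cis (- (of_int r * t))) \<odot> gauge t x\<parallel> \<le> \<parallel>x\<parallel> + \<parallel>(\<sigma> * cis (- (of_int r * t))) \<odot> gauge t x\<parallel>"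
      using that gc by (intro cnorm_triangle) auto
    also have "\<dots> = \<parallel>x\<parallel> + \<parallel>gauge t x\<parallel>" using that gc by (simp add: cnorm_smult norm_mult)
    also have "\<dots> \<le> \<parallel>x\<parallel> + \<parallel>x\<parallel>" using star_hom_contractive[OF gauge(1) that(1)] by simp
    finally show ?thesis using that gc by (simp add: proj_def cnorm_smult)
  qed
  have proj_minus: "proj \<sigma> y \<ominus> proj \<sigma> c = proj \<sigma> (y \<ominus> c)" for \<sigma>
    using yc cc gc unfolding proj_def
    by (simp add: star_homD(3,6)[OF gauge(1)] minus_scl scl_distr scl_scl a_ac mult_ac)
  have proj_sum: "y = proj 1 y \<oplus> proj (-1) y"
  proof -
    define w where "w = (1/2 * cis (- (of_int r * t))) \<odot> gauge t y"
    have w: "w \<in> carrier A" using gc[OF yc] by (simp add: w_def)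
    have e: "(1/2 * - cis (- (of_int r * t))) \<odot> gauge t y = (-1) \<odot> w"
      using gc[OF yc] by (simp add: w_def scl_scl)
    have "proj 1 y \<oplus> proj (-1) y = ((1/2) \<odot> y \<oplus> w) \<oplus> ((1/2) \<odot> y \<oplus> (-1) \<odot> w)"
      using yc gc[OF yc] e by (simp add: proj_def scl_distr scl_scl w_def)
    also have "\<dots> = ((1/2) \<odot> y \<oplus> (1/2) \<odot> y) \<oplus> (w \<ominus> w)"
      using yc w by (simp add: minus_scl a_ac del: minus_self)
    also have "\<dots> = y" using yc w by (simp flip: scl_add)
    finally show ?thesis ..
  qed
  have part: "\<parallel>proj \<sigma> y\<parallel> \<le> 2 ^ s * \<parallel>y \<ominus> c\<parallel>"
    if \<sigma>: "\<sigma> = 1 \<and> r' = r \<or> \<sigma> = -1 \<and> r' = r + 2 ^ p" for \<sigma> r'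
  proof -
    have \<sigma>1: "\<sigma> = 1 \<or> \<sigma> = -1" "cmod \<sigma> = 1" using \<sigma> by auto
    have P: "proj \<sigma> y \<in> Pol {d \<in> D. \<omega> d = \<sigma>}"
      unfolding proj_def \<omega>_def
    proof (rule Pol_spectral_part[OF Suc.prems(2) \<sigma>1(1)])
      fix d assume "d \<in> D"
      then obtain k where "d = r + 2 ^ p * k" using Suc.prems(1) by blast
      then show "cis (- (of_int r * t)) * cis (of_int d * t) = 1 \<or> cis (- (of_int r * t)) * cis (of_int d * t) = -1"
        using \<omega>[of k] unfolding \<omega>_def by (auto split: if_splits)
    qed
    have "\<parallel>proj \<sigma> y\<parallel> \<le> 2 ^ s * \<parallel>proj \<sigma> y \<ominus> proj \<sigma> c\<parallel>"
    proof (rule Suc.IH[of _ r' "Suc p", OF _ P])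
      show "proj \<sigma> c \<in> null_ideal" unfolding proj_def
        using Suc.prems(3) by (intro null_ideal_scl null_ideal_add null_ideal_gauge)
      fix d assume d: "d \<in> {d \<in> D. \<omega> d = \<sigma>}"
      then obtain k where k: "d = r + 2 ^ p * k" "0 \<le> k" "k < 2 ^ Suc s" using Suc.prems(1) by blast
      have ev: "(if even k then 1 else -1) = \<sigma>" using d \<omega>[of k] k by simp
      show "\<exists>k. d = r' + 2 ^ Suc p * k \<and> 0 \<le> k \<and> k < 2 ^ s"
      proof (intro exI[of _ "k div 2"] conjI)
        show "d = r' + 2 ^ Suc p * (k div 2)"
          using ev \<sigma> k(1) by (cases "even k") (auto elim!: evenE oddE simp: algebra_simps split: if_splits)
        show "0 \<le> k div 2" "k div 2 < 2 ^ s" using k by auto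
      qed
    qed
    also have "\<dots> \<le> 2 ^ s * \<parallel>y \<ominus> c\<parallel>"
      unfolding proj_minus using proj_le[of "y \<ominus> c" \<sigma>] \<sigma>1 yc cc by simp
    finally show ?thesis .
  qed
  have pc: "proj \<sigma> y \<in> carrier A" for \<sigma> using yc gc by (simp add: proj_def)
  have "\<parallel>y\<parallel> \<le> \<parallel>proj 1 y\<parallel> + \<parallel>proj (-1) y\<parallel>"
    using cnorm_triangle[OF pc[of 1] pc[of "-1"]] unfolding proj_sum[symmetric] .
  also have "\<dots> \<le> 2 ^ s * \<parallel>y \<ominus> c\<parallel> + 2 ^ s * \<parallel>y \<ominus> c\<parallel>"
    using part[of 1 r] part[of "-1" "r + 2 ^ p"] by (intro add_mono) auto
  finally show ?case by simp
qed

lemma mons_mono: "D \<subseteq> E \<Longrightarrow> mons D \<subseteq> mons E"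
  unfolding mons_def by blast

lemma Pol_UNIV_bounded: "y \<in> Pol UNIV \<Longrightarrow> \<exists>p. y \<in> Pol {- (2 ^ p)..2 ^ (p::nat)}"
  unfolding Pol_def
proof (induction rule: cspan.induct)
  case (base y)
  then obtain a m n b where y: "y = mon a m n b" by (auto simp: mons_def)
  have "int m + int n \<le> 2 ^ (m + n)"
    using of_nat_mono[OF less_imp_le[OF less_exp[of "m + n"]], where 'a = int] by simp
  then have "y \<in> mons {- (2 ^ (m + n))..2 ^ (m + n)}" unfolding y mons_def by force
  then show ?case by (blast intro: cspan.base)
next
  case (add x y)
  then obtain p q where *: "x \<in> cspan (mons {- (2 ^ p)..2 ^ p})" "y \<in> cspan (mons {- (2 ^ q)..2 ^ q})" by blast
  have m: "mons {- (2 ^ k)..2 ^ k} \<subseteq> mons {- (2 ^ max p q)..2 ^ max p q}" if "k \<le> max p q" for k :: nat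
    using power_increasing[OF that, of "2::int"] by (intro mons_mono) auto
  show ?case by (rule exI[of _ "max p q"], intro cspan.add) (use cspan_mono[OF *(1) m] cspan_mono[OF *(2) m] in auto)
qed (blast intro: cspan.intros)+

lemma iter_sq_Pol: "y \<in> Pol {- k..k} \<Longrightarrow> iter_sq l y \<in> Pol {- (2 ^ l * k)..2 ^ l * k}"
proof (induction l)
  case (Suc l)
  show ?case unfolding iter_sq.simps
    by (rule Pol_mult[OF Suc.IH Suc.IH]) (use Suc.prems in auto)
qed simp

text \<open>The number of degrees occurring in \<open>y^(2^l)\<close> is proportional to \<open>2^l\<close>, so the power trick applies a second
time.\<close>

lemma Pol_cnorm_le_dist:
  assumes y: "y \<in> Pol UNIV" "y\<^sup>\<star> = y" and c: "c \<in> null_ideal"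
  shows "\<parallel>y\<parallel> \<le> \<parallel>y \<ominus> c\<parallel>"
proof -
  obtain p :: nat where p: "y \<in> Pol {- (2 ^ p)..2 ^ p}" using Pol_UNIV_bounded[OF y(1)] by blast
  show ?thesis
  proof (rule cnorm_le_dist_null_ideal_if_powers[OF Pol_closed[OF y(1)] y(2) c, of "2 ^ (p + 2)"])
    fix l c' assume c': "c' \<in> null_ideal"
    have "\<parallel>iter_sq l y\<parallel> \<le> 2 ^ (p + l + 2) * \<parallel>iter_sq l y \<ominus> c'\<parallel>"
    proof (rule Pol_cnorm_le_dist_progression[OF _ iter_sq_Pol[OF p] c', where r = "- (2 ^ l * 2 ^ p)" and p = 0])
      fix d :: int assume d: "d \<in> {- (2 ^ l * 2 ^ p)..2 ^ l * 2 ^ p}"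
      define X :: int where "X = 2 ^ l * 2 ^ p"
      have X: "X > 0" "2 ^ (p + l + 2) = 4 * X" by (simp_all add: X_def power_add)
      have "d = - X + 2 ^ 0 * (d + X)" "0 \<le> d + X" "d + X < 2 ^ (p + l + 2)"
        using d X(1) unfolding X(2) X_def[symmetric] by auto
      then show "\<exists>k. d = - (2 ^ l * 2 ^ p) + 2 ^ 0 * k \<and> 0 \<le> k \<and> k < 2 ^ (p + l + 2)"
        unfolding X_def by blast
    qed
    also have "\<dots> = 2 ^ (p + 2) * 2 ^ l * \<parallel>iter_sq l y \<ominus> c'\<parallel>" by (simp add: power_add)
    also have "\<dots> \<le> 2 ^ (p + 2) * 4 ^ l * \<parallel>iter_sq l y \<ominus> c'\<parallel>"
      using Pol_closed[OF y(1)] c' by (intro mult_right_mono mult_left_mono power_mono) auto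
    finally show "\<parallel>iter_sq l y\<parallel> \<le> 2 ^ (p + 2) * 4 ^ l * \<parallel>iter_sq l y \<ominus> c'\<parallel>" .
  qed simp
qed

lemma null_ideal_trivial: assumes x: "x \<in> null_ideal" shows "x = \<zero>"
proof -
  note xc = null_ideal_closed[OF x]
  define a where "a = x\<^sup>\<star> \<otimes> x"
  have a: "a \<in> null_ideal" "a \<in> carrier A" "a\<^sup>\<star> = a"
    using x xc by (simp_all add: a_def null_ideal_mult_left adj_mult)
  have "a = \<zero>"
  proof (rule eq_if_cnorm_minus_small[where C = 2])
    fix e :: real assume "e > 0"
    then obtain p where p: "p \<in> Pol UNIV" "\<parallel>a \<ominus> p\<parallel> \<le> e" using Pol_dense[OF a(2)] by blast
    note pc = Pol_closed[OF p(1)]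
    define y where "y = (1/2) \<odot> (p \<oplus> p\<^sup>\<star>)"
    have "p\<^sup>\<star> \<in> Pol UNIV" using Pol_adj[OF p(1)] by simp
    then have y: "y \<in> Pol UNIV" "y\<^sup>\<star> = y" using p(1) pc
      by (auto simp: y_def adj_smult adj_add a_ac Pol_def intro: cspan.intros)
    note yc = Pol_closed[OF y(1)]
    have "a = (1/2) \<odot> (a \<oplus> a)" using a by simp
    then have "a \<ominus> y = (1/2) \<odot> (a \<oplus> a) \<ominus> y" by simp
    also have "\<dots> = (1/2) \<odot> ((a \<ominus> p) \<oplus> (a \<ominus> p)\<^sup>\<star>)"
      using a pc by (simp add: y_def minus_scl adj_add adj_smult scl_distr scl_scl a_ac)
    also have "\<parallel>\<dots>\<parallel> \<le> (\<parallel>a \<ominus> p\<parallel> + \<parallel>(a \<ominus> p)\<^sup>\<star>\<parallel>) / 2"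
      using cnorm_triangle[of "a \<ominus> p" "(a \<ominus> p)\<^sup>\<star>"] a pc by (simp add: cnorm_smult del: cnorm_adj)
    also have "\<dots> \<le> e" using p a pc by simp
    finally have ay: "\<parallel>a \<ominus> y\<parallel> \<le> e" .
    have "\<parallel>y\<parallel> \<le> \<parallel>y \<ominus> a\<parallel>" using Pol_cnorm_le_dist[OF y a(1)] .
    also have "\<dots> = \<parallel>a \<ominus> y\<parallel>" using a yc by (simp add: cnorm_minus_commute)
    finally have "\<parallel>y\<parallel> \<le> e" using ay by simp
    moreover have "\<parallel>a \<ominus> \<zero>\<parallel> \<le> \<parallel>a \<ominus> y\<parallel> + \<parallel>y \<ominus> \<zero>\<parallel>" using a yc by (intro cnorm_dist_triangle) auto
    ultimately show "\<parallel>a \<ominus> \<zero>\<parallel> \<le> 2 * e" using ay yc by (simp add: minus_scl)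
  qed (use a in auto)
  then have "\<parallel>x\<parallel> = 0" using cstar_identity[OF xc] by (simp add: a_def)
  then show ?thesis using cnorm_eq_0[OF xc] by simp
qed

lemma comm_U_eq_zero_if:
  assumes "x \<in> comm_U" "(\<lambda>N. \<parallel>x \<otimes> S [^] (N::nat)\<parallel>) \<longlonglongrightarrow> 0" shows "x = \<zero>"
  using null_ideal_trivial[OF comm_U_null_ideal[OF assms]] .

section \<open>The relative commutant of U\<close>

lemma comm_U_Trig: assumes x: "x \<in> comm_U" and g: "g \<in> Trig" shows "x \<otimes> g = g \<otimes> x"
proof -
  have "Trig \<subseteq> {y \<in> carrier A. x \<otimes> y = y \<otimes> x}"
    unfolding Trig_def using comm_U_closed[OF x] comm_U_Up[OF x]
    by (intro cspan_subset) (auto simp: subspace_def l_distr r_distr smult_mult_left smult_mult_right)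
  then show ?thesis using g by blast
qed

lemma comm_U_eq_zero_if_small:
  assumes c: "c \<in> comm_U"
    and small: "\<And>e. e > 0 \<Longrightarrow> \<forall>\<^sub>F N in sequentially. \<parallel>c \<otimes> S [^] (N::nat)\<parallel> \<le> K * e" and K: "K > 0"
  shows "c = \<zero>"
proof (rule comm_U_eq_zero_if[OF c], rule LIMSEQ_I)
  fix e :: real assume e: "e > 0"
  then have "e / (2 * K) > 0" using K by simp
  from small[OF this] obtain N0 :: nat where "\<And>N. N \<ge> N0 \<Longrightarrow> \<parallel>c \<otimes> S [^] N\<parallel> \<le> K * (e / (2 * K))"
    unfolding eventually_sequentially by blast
  moreover have "K * (e / (2 * K)) < e" using K e by simp
  ultimately have "norm (\<parallel>c \<otimes> S [^] N\<parallel> - 0) < e" if "N \<ge> N0" for N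
    using that c by (auto intro: le_less_trans)
  then show "\<exists>N0 :: nat. \<forall>N\<ge>N0. norm (\<parallel>c \<otimes> S [^] N\<parallel> - 0) < e" by blast
qed

lemma cnorm_compress_left:
  "a \<in> carrier A \<Longrightarrow> w \<in> carrier A \<Longrightarrow> \<parallel>S\<^sup>\<star> [^] N \<otimes> (a \<otimes> (w \<otimes> S [^] (N::nat)))\<parallel> \<le> \<parallel>a\<parallel> * \<parallel>w \<otimes> S [^] N\<parallel>"
  using cnorm_mult_le[of "S\<^sup>\<star> [^] N" "a \<otimes> (w \<otimes> S [^] N)" 1 "\<parallel>a\<parallel> * \<parallel>w \<otimes> S [^] N\<parallel>"] by (simp add: cnorm_mult)

text \<open>Compression by \<open>S^N\<close> behaves asymptotically like a trace on the commutant. Replacing \<open>b\<close> by \<open>b - g\<close> with a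
trigonometric polynomial \<open>g\<close> does not change the commutator with \<open>a\<close>, and both \<open>b - g\<close> and its adjoint
are small in the seminorm.\<close>

lemma comm_U_asym_trace:
  assumes a: "a \<in> comm_U" and b: "b \<in> comm_U" and e: "e > 0"
  shows "\<forall>\<^sub>F N in sequentially. \<parallel>S\<^sup>\<star> [^] N \<otimes> ((a \<otimes> b \<ominus> b \<otimes> a) \<otimes> S [^] (N::nat))\<parallel> \<le> e"
proof -
  note ac = comm_U_closed[OF a] and bc = comm_U_closed[OF b]
  define d where "d = e / (2 * (\<parallel>a\<parallel> + 1))"
  have a1: "\<parallel>a\<parallel> \<ge> 0" using ac by simp
  have d: "d > 0" "2 * \<parallel>a\<parallel> * d \<le> e" using e a1 by (auto simp: d_def field_simps)
  obtain g where g: "g \<in> Trig" "\<forall>\<^sub>F N in sequentially. \<parallel>(b \<ominus> g) \<otimes> S [^] (N::nat)\<parallel> \<le> d"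
    "\<forall>\<^sub>F N in sequentially. \<parallel>(b\<^sup>\<star> \<ominus> g\<^sup>\<star>) \<otimes> S [^] (N::nat)\<parallel> \<le> d"
    using comm_U_approx_Trig[OF b d(1)] by blast
  note gc = comm_U_closed[OF Trig_comm_U[OF g(1)]]
  define w where "w = b \<ominus> g"
  have w: "w \<in> carrier A" "w\<^sup>\<star> = b\<^sup>\<star> \<ominus> g\<^sup>\<star>" using bc gc by (simp_all add: w_def adj_minus)
  have "a \<otimes> b \<ominus> b \<otimes> a = (a \<otimes> w \<ominus> w \<otimes> a) \<oplus> (a \<otimes> g \<ominus> g \<otimes> a)" unfolding w_def using ac bc gc by algebra
  then have comm: "a \<otimes> b \<ominus> b \<otimes> a = a \<otimes> w \<ominus> w \<otimes> a" unfolding comm_U_Trig[OF a g(1)] using ac gc w by simp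
  show ?thesis using g(2,3)
  proof eventually_elim
    case (elim N)
    define s where "s = S [^] N"
    have s: "s \<in> carrier A" "s\<^sup>\<star> = S\<^sup>\<star> [^] N" by (simp_all add: s_def adj_nat_pow)
    have "\<parallel>s\<^sup>\<star> \<otimes> ((a \<otimes> b \<ominus> b \<otimes> a) \<otimes> s)\<parallel> = \<parallel>s\<^sup>\<star> \<otimes> (a \<otimes> (w \<otimes> s)) \<ominus> s\<^sup>\<star> \<otimes> (w \<otimes> (a \<otimes> s))\<parallel>"
      unfolding comm using ac w s(1) by (simp add: minus_scl l_distr r_distr m_assoc smult_mult_left smult_mult_right)
    also have "\<dots> \<le> \<parallel>s\<^sup>\<star> \<otimes> (a \<otimes> (w \<otimes> s))\<parallel> + \<parallel>s\<^sup>\<star> \<otimes> (w \<otimes> (a \<otimes> s))\<parallel>"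
      using ac w s(1) by (intro cnorm_triangle_minus) auto
    also have "\<parallel>s\<^sup>\<star> \<otimes> (w \<otimes> (a \<otimes> s))\<parallel> = \<parallel>(s\<^sup>\<star> \<otimes> (w \<otimes> (a \<otimes> s)))\<^sup>\<star>\<parallel>"
      using ac w s(1) by (intro cnorm_adj[symmetric]) auto
    also have "(s\<^sup>\<star> \<otimes> (w \<otimes> (a \<otimes> s)))\<^sup>\<star> = s\<^sup>\<star> \<otimes> (a\<^sup>\<star> \<otimes> (w\<^sup>\<star> \<otimes> s))"
      using ac w(1) s(1) by (simp add: adj_mult m_assoc)
    also have "\<parallel>s\<^sup>\<star> \<otimes> (a \<otimes> (w \<otimes> s))\<parallel> + \<parallel>s\<^sup>\<star> \<otimes> (a\<^sup>\<star> \<otimes> (w\<^sup>\<star> \<otimes> s))\<parallel> \<le> \<parallel>a\<parallel> * \<parallel>w \<otimes> s\<parallel> + \<parallel>a\<^sup>\<star>\<parallel> * \<parallel>w\<^sup>\<star> \<otimes> s\<parallel>"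
      unfolding s(2) unfolding s_def using ac w(1) by (intro add_mono cnorm_compress_left) auto
    also have "\<parallel>a\<^sup>\<star>\<parallel> = \<parallel>a\<parallel>" using ac by simp
    also have "\<parallel>a\<parallel> * \<parallel>w \<otimes> s\<parallel> + \<parallel>a\<parallel> * \<parallel>w\<^sup>\<star> \<otimes> s\<parallel> \<le> \<parallel>a\<parallel> * d + \<parallel>a\<parallel> * d"
      using elim ac unfolding w(2) s_def by (intro add_mono mult_left_mono) (simp_all add: w_def)
    finally show ?case using d(2) unfolding s(2) by (simp add: s_def mult_ac)
  qed
qed

text \<open>With \<open>w = z - g\<close> small in the seminorm together with its adjoint, the commutator is \<open>x w - w x\<close>. The
seminorm of \<open>x w\<close> is clearly small, and the trace property turns that of \<open>w x\<close> into that of its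
adjoint \<open>x* w*\<close>.\<close>

lemma comm_U_commute: assumes x: "x \<in> comm_U" and z: "z \<in> comm_U" shows "x \<otimes> z = z \<otimes> x"
proof -
  note xc = comm_U_closed[OF x] and zc = comm_U_closed[OF z]
  have xn: "\<parallel>x\<parallel> \<ge> 0" using xc by simp
  have "x \<otimes> z \<ominus> z \<otimes> x = \<zero>"
  proof (rule comm_U_eq_zero_if_small[where K = "2 * \<parallel>x\<parallel> + 1"])
    show "x \<otimes> z \<ominus> z \<otimes> x \<in> comm_U" using x z by (intro comm_U_minus comm_U_mult)
    show "2 * \<parallel>x\<parallel> + 1 > 0" using xn by simp
    fix e :: real assume e: "e > 0"
    obtain g where g: "g \<in> Trig" "\<forall>\<^sub>F N in sequentially. \<parallel>(z \<ominus> g) \<otimes> S [^] (N::nat)\<parallel> \<le> e"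
      "\<forall>\<^sub>F N in sequentially. \<parallel>(z\<^sup>\<star> \<ominus> g\<^sup>\<star>) \<otimes> S [^] (N::nat)\<parallel> \<le> e"
      using comm_U_approx_Trig[OF z e] by blast
    note gM = Trig_comm_U[OF g(1)] and gc = comm_U_closed[OF Trig_comm_U[OF g(1)]]
    define w where "w = z \<ominus> g"
    have wM: "w \<in> comm_U" using z gM by (simp add: w_def comm_U_minus)
    note wc = comm_U_closed[OF wM]
    have ws: "w\<^sup>\<star> = z\<^sup>\<star> \<ominus> g\<^sup>\<star>" using zc gc by (simp add: w_def adj_minus)
    have "x \<otimes> z \<ominus> z \<otimes> x = (x \<otimes> w \<ominus> w \<otimes> x) \<oplus> (x \<otimes> g \<ominus> g \<otimes> x)" unfolding w_def using xc zc gc by algebra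
    then have comm: "x \<otimes> z \<ominus> z \<otimes> x = x \<otimes> w \<ominus> w \<otimes> x" unfolding comm_U_Trig[OF x g(1)] using xc gc wc by simp
    \<comment> \<open>\<open>b* b = a b\<close> and \<open>a* a = b a\<close>, to which the trace property applies.\<close>
    define a where "a = x\<^sup>\<star> \<otimes> w\<^sup>\<star>"
    define b where "b = w \<otimes> x"
    have ab: "a \<in> comm_U" "b \<in> comm_U" "a \<in> carrier A" "b \<in> carrier A"
      using x wM xc wc by (auto simp: a_def b_def intro: comm_U_mult comm_U_adj)
    have ba: "b\<^sup>\<star> = a" "a\<^sup>\<star> = b" using xc wc by (simp_all add: a_def b_def adj_mult)
    have "e\<^sup>2 > 0" using e by simp
    from comm_U_asym_trace[OF ab(1,2) this] g(2,3)
    show "\<forall>\<^sub>F N in sequentially. \<parallel>(x \<otimes> z \<ominus> z \<otimes> x) \<otimes> S [^] (N::nat)\<parallel> \<le> (2 * \<parallel>x\<parallel> + 1) * e"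
    proof eventually_elim
      case (elim N)
      define s where "s = S [^] N"
      have s: "s \<in> carrier A" "s\<^sup>\<star> = S\<^sup>\<star> [^] N" by (simp_all add: s_def adj_nat_pow)
      have w1: "\<parallel>w \<otimes> s\<parallel> \<le> e" "\<parallel>w\<^sup>\<star> \<otimes> s\<parallel> \<le> e" using elim(2,3) unfolding ws s_def by (simp_all add: w_def)
      have as: "\<parallel>a \<otimes> s\<parallel> \<le> \<parallel>x\<parallel> * e"
        using w1 xc wc s by (simp add: a_def m_assoc) (intro cnorm_mult_le, auto)
      have "(\<parallel>b \<otimes> s\<parallel>)\<^sup>2 = \<parallel>(b \<otimes> s)\<^sup>\<star> \<otimes> (b \<otimes> s)\<parallel>" using ab s by (simp add: cstar_identity)
      also have "(b \<otimes> s)\<^sup>\<star> \<otimes> (b \<otimes> s) = s\<^sup>\<star> \<otimes> ((a \<otimes> b \<ominus> b \<otimes> a) \<otimes> s) \<oplus> (a \<otimes> s)\<^sup>\<star> \<otimes> (a \<otimes> s)"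
      proof -
        have "(b \<otimes> s)\<^sup>\<star> \<otimes> (b \<otimes> s) = s\<^sup>\<star> \<otimes> (a \<otimes> (b \<otimes> s))"
          "(a \<otimes> s)\<^sup>\<star> \<otimes> (a \<otimes> s) = s\<^sup>\<star> \<otimes> (b \<otimes> (a \<otimes> s))"
          using ab s(1) by (simp_all add: adj_mult ba m_assoc)
        moreover have "t \<otimes> (a \<otimes> (b \<otimes> s)) = t \<otimes> ((a \<otimes> b \<ominus> b \<otimes> a) \<otimes> s) \<oplus> t \<otimes> (b \<otimes> (a \<otimes> s))"
          if "t \<in> carrier A" for t using that ab(3,4) s(1) by algebra
        ultimately show ?thesis using s(1) by simp
      qed
      also have "\<parallel>\<dots>\<parallel> \<le> \<parallel>s\<^sup>\<star> \<otimes> ((a \<otimes> b \<ominus> b \<otimes> a) \<otimes> s)\<parallel> + \<parallel>(a \<otimes> s)\<^sup>\<star> \<otimes> (a \<otimes> s)\<parallel>"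
        using ab s(1) by (intro cnorm_triangle) auto
      also have "\<dots> \<le> e\<^sup>2 + (\<parallel>x\<parallel> * e)\<^sup>2"
        using elim(1) as ab s xc unfolding s(2) s_def[symmetric]
        by (intro add_mono) (simp_all add: cstar_identity power_mono s_def)
      also have "\<dots> \<le> ((\<parallel>x\<parallel> + 1) * e)\<^sup>2"
        using xn e by (simp add: power2_eq_square algebra_simps)
      finally have bs: "\<parallel>b \<otimes> s\<parallel> \<le> (\<parallel>x\<parallel> + 1) * e" by (rule power2_le_imp_le) (use xn e in simp)
      have "(x \<otimes> z \<ominus> z \<otimes> x) \<otimes> s = x \<otimes> (w \<otimes> s) \<ominus> b \<otimes> s"
        unfolding comm b_def using xc wc s(1) by (simp add: minus_scl l_distr m_assoc smult_mult_left)
      then have "\<parallel>(x \<otimes> z \<ominus> z \<otimes> x) \<otimes> s\<parallel> \<le> \<parallel>x \<otimes> (w \<otimes> s)\<parallel> + \<parallel>b \<otimes> s\<parallel>"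
        using xc wc ab s(1) by (simp add: cnorm_triangle_minus)
      also have "\<dots> \<le> \<parallel>x\<parallel> * e + (\<parallel>x\<parallel> + 1) * e"
        using w1 xc wc s(1) by (intro add_mono[OF _ bs] cnorm_mult_le) auto
      finally show ?case by (simp add: s_def algebra_simps)
    qed
  qed
  then show ?thesis using eq_if_minus_eq_zero xc zc by blast
qed

text \<open>The element \<open>d = s S* + U s S* U*\<close> maps the range of \<open>S\<close> by \<open>s S*\<close> and is extended to the range of \<open>U S\<close>
so as to commute with \<open>U\<close>.\<close>

lemma comm_U_factor:
  assumes s: "s \<in> carrier A" "s\<^sup>\<star> \<otimes> s = \<one>" and sU: "\<And>k. s \<otimes> Up k = Up (2 * k) \<otimes> s"
    and orth: "s\<^sup>\<star> \<otimes> (Up 1 \<otimes> s) = \<zero>"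
  shows "\<exists>d\<in>comm_U. d\<^sup>\<star> \<otimes> d = \<one> \<and> s = d \<otimes> S"
proof -
  define d where "d = s \<otimes> S\<^sup>\<star> \<oplus> Up 1 \<otimes> (s \<otimes> (S\<^sup>\<star> \<otimes> Up (-1)))"
  have dc: "d \<in> carrier A" using s by (simp add: d_def)
  have "s = d \<otimes> S" using s by (simp add: d_def l_distr m_assoc adjS_Up_S)
  moreover have "d \<otimes> U = U \<otimes> d"
  proof -
    have e: "S\<^sup>\<star> \<otimes> Up 1 = Up 1 \<otimes> (S\<^sup>\<star> \<otimes> Up (-1))"
      using adjS_Up_left[of "Up (-1)" 1] by simp
    have "d \<otimes> Up 1 = s \<otimes> (S\<^sup>\<star> \<otimes> Up 1) \<oplus> Up 1 \<otimes> (s \<otimes> S\<^sup>\<star>)"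
      using s by (simp add: d_def l_distr m_assoc)
    also have "s \<otimes> (S\<^sup>\<star> \<otimes> Up 1) = (s \<otimes> Up 1) \<otimes> (S\<^sup>\<star> \<otimes> Up (-1))" unfolding e using s by (simp add: m_assoc)
    also have "\<dots> = Up 2 \<otimes> (s \<otimes> (S\<^sup>\<star> \<otimes> Up (-1)))" unfolding sU using s by (simp add: m_assoc)
    finally have "d \<otimes> Up 1 = Up 1 \<otimes> d" using s by (simp add: d_def r_distr a_comm)
    then show ?thesis by (simp only: Up_1)
  qed
  moreover have "d\<^sup>\<star> \<otimes> d = \<one>"
  proof -
    have orth': "s\<^sup>\<star> \<otimes> (Up (-1) \<otimes> s) = \<zero>" using arg_cong[OF orth, of "adj A"] s by (simp add: adj_mult m_assoc)
    have l: "s\<^sup>\<star> \<otimes> (s \<otimes> x) = x" "s\<^sup>\<star> \<otimes> (Up 1 \<otimes> (s \<otimes> x)) = \<zero>" "s\<^sup>\<star> \<otimes> (Up (-1) \<otimes> (s \<otimes> x)) = \<zero>"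
      if "x \<in> carrier A" for x
    proof -
      have "s\<^sup>\<star> \<otimes> (s \<otimes> x) = (s\<^sup>\<star> \<otimes> s) \<otimes> x" "s\<^sup>\<star> \<otimes> (Up 1 \<otimes> (s \<otimes> x)) = (s\<^sup>\<star> \<otimes> (Up 1 \<otimes> s)) \<otimes> x"
        "s\<^sup>\<star> \<otimes> (Up (-1) \<otimes> (s \<otimes> x)) = (s\<^sup>\<star> \<otimes> (Up (-1) \<otimes> s)) \<otimes> x" using s(1) that by (simp_all add: m_assoc)
      then show "s\<^sup>\<star> \<otimes> (s \<otimes> x) = x" "s\<^sup>\<star> \<otimes> (Up 1 \<otimes> (s \<otimes> x)) = \<zero>" "s\<^sup>\<star> \<otimes> (Up (-1) \<otimes> (s \<otimes> x)) = \<zero>"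
        unfolding s(2) orth orth' using that by simp_all
    qed
    have "d\<^sup>\<star> = S \<otimes> s\<^sup>\<star> \<oplus> Up 1 \<otimes> (S \<otimes> (s\<^sup>\<star> \<otimes> Up (-1)))"
      using s by (simp add: d_def adj_add adj_mult m_assoc)
    then have "d\<^sup>\<star> \<otimes> d = S \<otimes> S\<^sup>\<star> \<oplus> Up 1 \<otimes> (S \<otimes> (S\<^sup>\<star> \<otimes> Up (-1)))"
      using s by (simp add: d_def l_distr r_distr m_assoc l)
    then show ?thesis using resolution' by simp
  qed
  ultimately show ?thesis using dc by (auto simp: comm_U_def simp del: comm_U_closed)
qed

context
  fixes f assumes f: "f \<in> star_hom A A" and fU: "f U = U"
begin

text \<open>\<open>f(S^(n+1)) = f(S) d S^n\<close>, and \<open>f(S) d\<close> satisfies the relations that \<open>comm_U_factor\<close> requires.\<close>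

lemma hom_fixing_U_S_pow: "\<exists>d\<in>comm_U. d\<^sup>\<star> \<otimes> d = \<one> \<and> f (S [^] (n::nat)) = d \<otimes> S [^] n"
proof (induction n)
  case 0 then show ?case using star_homD(4)[OF f] by (intro bexI[of _ \<one>]) auto
next
  case (Suc n)
  then obtain d where d: "d \<in> comm_U" "d\<^sup>\<star> \<otimes> d = \<one>" "f (S [^] n) = d \<otimes> S [^] n" by blast
  note dc = comm_U_closed[OF d(1)]
  define t where "t = f S"
  have tc: "t \<in> carrier A" using star_homD(1)[OF f S] by (simp add: t_def)
  have fUp: "f (Up k) = Up k" for k by (rule star_hom_Up[OF f fU])
  have tUp: "t \<otimes> Up k = Up (2 * k) \<otimes> t" for k
    using arg_cong[OF S_Up[of k], of f] by (simp add: star_homD[OF f] fUp t_def)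
  have tt: "t\<^sup>\<star> \<otimes> t = \<one>" using arg_cong[OF S_isometry, of f] by (simp add: star_homD[OF f] t_def del: S_cancel)
  have to: "t\<^sup>\<star> \<otimes> (Up 1 \<otimes> t) = \<zero>"
    using arg_cong[OF adjS_Up_S[of 1], of f] by (simp add: star_homD[OF f] fUp star_hom_zero[OF f] t_def)
  have "\<exists>d'\<in>comm_U. d'\<^sup>\<star> \<otimes> d' = \<one> \<and> t \<otimes> d = d' \<otimes> S"
  proof (rule comm_U_factor)
    have "(t \<otimes> d)\<^sup>\<star> \<otimes> (t \<otimes> d) = d\<^sup>\<star> \<otimes> ((t\<^sup>\<star> \<otimes> t) \<otimes> d)" using tc dc by (simp add: adj_mult m_assoc)
    then show "(t \<otimes> d)\<^sup>\<star> \<otimes> (t \<otimes> d) = \<one>" unfolding tt using dc d by simp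
    have "(t \<otimes> d)\<^sup>\<star> \<otimes> (Up 1 \<otimes> (t \<otimes> d)) = d\<^sup>\<star> \<otimes> ((t\<^sup>\<star> \<otimes> (Up 1 \<otimes> t)) \<otimes> d)" using tc dc by (simp add: adj_mult m_assoc)
    then show "(t \<otimes> d)\<^sup>\<star> \<otimes> (Up 1 \<otimes> (t \<otimes> d)) = \<zero>" unfolding to using dc by simp
    have "(t \<otimes> d) \<otimes> Up k = (t \<otimes> Up k) \<otimes> d" for k using tc dc comm_U_Up[OF d(1)] by (simp add: m_assoc)
    then show "(t \<otimes> d) \<otimes> Up k = Up (2 * k) \<otimes> (t \<otimes> d)" for k unfolding tUp using tc dc by (simp add: m_assoc)
  qed (use tc dc in simp)
  then obtain d' where d': "d' \<in> comm_U" "d'\<^sup>\<star> \<otimes> d' = \<one>" "t \<otimes> d = d' \<otimes> S" by blast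
  have p: "S [^] Suc n = S \<otimes> S [^] n" by (rule nat_pow_Suc2) simp
  have "f (S [^] Suc n) = (t \<otimes> d) \<otimes> S [^] n"
    unfolding p using tc dc by (simp add: star_homD[OF f] d(3) m_assoc flip: t_def)
  also have "\<dots> = d' \<otimes> S [^] Suc n" unfolding d'(3) p using d'(1) by (simp add: m_assoc)
  finally show ?case using d' by blast
qed

text \<open>By commutativity of the commutant, \<open>\<parallel>f(y) S^n\<parallel> = \<parallel>f(y) d S^n\<parallel> = \<parallel>f(y S^n)\<parallel>\<close>, so \<open>f\<close> does not increase the
seminorm. It is the identity on trigonometric polynomials, and these are dense.\<close>

lemma hom_fixing_U_comm_U: assumes x: "x \<in> comm_U" shows "f x = x"
proof -
  note xc = comm_U_closed[OF x]
  have fM: "f y \<in> comm_U" if "y \<in> comm_U" for y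
  proof (rule comm_U_I)
    show "f y \<otimes> Up k = Up k \<otimes> f y" for k
      using arg_cong[OF comm_U_Up[OF that, of k], of f] that
      by (simp add: star_homD[OF f] star_hom_Up[OF f fU])
  qed (use that in \<open>simp add: star_homD(1)[OF f]\<close>)
  have le: "\<parallel>f y \<otimes> S [^] n\<parallel> \<le> \<parallel>y \<otimes> S [^] n\<parallel>" if y: "y \<in> comm_U" for y and n :: nat
  proof -
    note yc = comm_U_closed[OF y]
    obtain d where d: "d \<in> comm_U" "d\<^sup>\<star> \<otimes> d = \<one>" "f (S [^] n) = d \<otimes> S [^] n"
      using hom_fixing_U_S_pow by blast
    have "\<parallel>f y \<otimes> S [^] n\<parallel> = \<parallel>d \<otimes> (f y \<otimes> S [^] n)\<parallel>"
      using d fM[OF y] by (simp add: isometry_mult_cnorm)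
    also have "d \<otimes> (f y \<otimes> S [^] n) = (d \<otimes> f y) \<otimes> S [^] n" using d(1) fM[OF y] by (simp add: m_assoc)
    also have "\<dots> = (f y \<otimes> d) \<otimes> S [^] n" using comm_U_commute[OF d(1) fM[OF y]] by simp
    also have "\<dots> = f (y \<otimes> S [^] n)" using d(1) fM[OF y] yc by (simp add: star_homD[OF f] d(3) m_assoc)
    also have "\<parallel>\<dots>\<parallel> \<le> \<parallel>y \<otimes> S [^] n\<parallel>" using yc by (intro star_hom_contractive f) simp
    finally show ?thesis .
  qed
  have "f x \<ominus> x = \<zero>"
  proof (rule comm_U_eq_zero_if_small[where K = 2])
    show "f x \<ominus> x \<in> comm_U" using fM x by (intro comm_U_minus)
    fix e :: real assume e: "e > 0"
    obtain g where g: "g \<in> Trig" "\<forall>\<^sub>F N in sequentially. \<parallel>(x \<ominus> g) \<otimes> S [^] (N::nat)\<parallel> \<le> e"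
      using comm_U_approx_Trig[OF x e] by blast
    note gM = Trig_comm_U[OF g(1)] and gc = comm_U_closed[OF Trig_comm_U[OF g(1)]]
    have "Trig \<subseteq> {y \<in> carrier A. f y = y}"
      unfolding Trig_def
      by (intro cspan_subset) (auto simp: subspace_def star_homD[OF f] star_hom_zero[OF f] star_hom_Up[OF f fU])
    then have fg: "f g = g" using g(1) by blast
    show "\<forall>\<^sub>F N in sequentially. \<parallel>(f x \<ominus> x) \<otimes> S [^] (N::nat)\<parallel> \<le> 2 * e"
      using g(2)
    proof eventually_elim
      case (elim N)
      have fc: "f x \<in> carrier A" "f (x \<ominus> g) \<in> carrier A" using xc gc by (simp_all add: star_homD(1)[OF f])
      have "f x \<ominus> x = (f x \<ominus> g) \<ominus> (x \<ominus> g)" using fc xc gc by algebra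
      also have "f x \<ominus> g = f (x \<ominus> g)" using xc gc by (simp add: star_hom_minus[OF f] fg)
      finally have "(f x \<ominus> x) \<otimes> S [^] N = f (x \<ominus> g) \<otimes> S [^] N \<ominus> (x \<ominus> g) \<otimes> S [^] N"
        using fc xc gc by (simp add: minus_scl l_distr smult_mult_left)
      then have "\<parallel>(f x \<ominus> x) \<otimes> S [^] N\<parallel> \<le> \<parallel>f (x \<ominus> g) \<otimes> S [^] N\<parallel> + \<parallel>(x \<ominus> g) \<otimes> S [^] N\<parallel>"
        using fc xc gc by (simp add: cnorm_triangle_minus)
      then show ?case using le[OF comm_U_minus[OF x gM], of N] elim by linarith
    qed
  qed simp
  then show ?thesis using eq_if_minus_eq_zero xc star_homD(1)[OF f] by blast
qed

end

section \<open>Automorphisms fixing U and their centralizer\<close>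

lemma homs_fixing_U_commute:
  assumes f: "f \<in> star_hom A A" "f U = U" and g: "g \<in> star_hom A A" "g U = U" and x: "x \<in> carrier A"
  shows "f (g x) = g (f x)"
proof -
  obtain d where d: "d \<in> comm_U" "f S = d \<otimes> S" using hom_fixing_U_S_pow[OF f, of 1] by auto
  obtain e where e: "e \<in> comm_U" "g S = e \<otimes> S" using hom_fixing_U_S_pow[OF g, of 1] by auto
  have "f (g S) = e \<otimes> (d \<otimes> S)"
    using d e by (simp add: star_homD[OF f(1)] hom_fixing_U_comm_U[OF f])
  also have "\<dots> = (e \<otimes> d) \<otimes> S" using d e by (simp add: m_assoc)
  also have "\<dots> = (d \<otimes> e) \<otimes> S" using comm_U_commute[OF d(1) e(1)] by simp
  also have "\<dots> = g (f S)"
    using d e by (simp add: star_homD[OF g(1)] hom_fixing_U_comm_U[OF g] m_assoc)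
  finally show ?thesis using star_hom_eqI[OF star_hom_comp[OF f(1) g(1)] star_hom_comp[OF g(1) f(1)] _ _ x] f g by simp
qed

lemma Trig_compress: "g \<in> Trig \<Longrightarrow> \<exists>c. \<forall>\<^sub>F N in sequentially. S\<^sup>\<star> [^] N \<otimes> (g \<otimes> S [^] (N::nat)) = c \<odot> \<one>"
  unfolding Trig_def
proof (induction rule: cspan.induct)
  case zero then show ?case by (intro exI[of _ 0]) simp
next
  case (base x)
  then obtain k where k: "x = Up k" by blast
  have "\<forall>\<^sub>F N in sequentially. S\<^sup>\<star> [^] N \<otimes> (x \<otimes> S [^] N) = (if k = 0 then 1 else 0) \<odot> \<one>"
    using eventually_ge_at_top[of "nat \<bar>k\<bar>"]
  proof eventually_elim
    case (elim N)
    have "\<not> 2 ^ N dvd k" if "k \<noteq> 0"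
    proof
      assume "2 ^ N dvd k"
      then have "2 ^ N \<le> \<bar>k\<bar>" using dvd_imp_le_int[OF that] by fastforce
      moreover have "\<bar>k\<bar> \<le> int N" using elim by linarith
      moreover have "int N < 2 ^ N" using of_nat_less_two_power[of N] by simp
      ultimately show False by linarith
    qed
    then show ?case unfolding k adjS_pow_Up_S_pow by auto
  qed
  then show ?case by blast
next
  case (add x y)
  then obtain c d where "\<forall>\<^sub>F N in sequentially. S\<^sup>\<star> [^] N \<otimes> (x \<otimes> S [^] N) = c \<odot> \<one>"
    "\<forall>\<^sub>F N in sequentially. S\<^sup>\<star> [^] N \<otimes> (y \<otimes> S [^] N) = d \<odot> \<one>" by blast
  then have "\<forall>\<^sub>F N in sequentially. S\<^sup>\<star> [^] N \<otimes> ((x \<oplus> y) \<otimes> S [^] N) = (c + d) \<odot> \<one>"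
  proof eventually_elim
    case (elim N)
    have "x \<in> carrier A" "y \<in> carrier A"
      using cspan_closed[OF add.hyps(1)] cspan_closed[OF add.hyps(2)] by (simp_all add: image_subset_iff)
    then show ?case using elim by (simp add: l_distr r_distr scl_add)
  qed
  then show ?case by blast
next
  case (scale x k)
  then obtain c where "\<forall>\<^sub>F N in sequentially. S\<^sup>\<star> [^] N \<otimes> (x \<otimes> S [^] N) = c \<odot> \<one>" by blast
  then have "\<forall>\<^sub>F N in sequentially. S\<^sup>\<star> [^] N \<otimes> ((k \<odot> x) \<otimes> S [^] N) = (k * c) \<odot> \<one>"
  proof eventually_elim
    case (elim N)
    have "x \<in> carrier A" using cspan_closed[OF scale.hyps] by (simp add: image_subset_iff)
    then show ?case using elim by (simp add: smult_mult_left smult_mult_right scl_scl)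
  qed
  then show ?case by blast
qed

text \<open>A central \<open>z\<close> is unchanged by compression with \<open>S^N\<close>, while the trigonometric polynomial that
approximates it is compressed to its constant coefficient. Hence \<open>z\<close> is a limit of scalars.\<close>

lemma center_scalar:
  assumes z: "z \<in> carrier A" and comm: "\<And>y. y \<in> carrier A \<Longrightarrow> z \<otimes> y = y \<otimes> z"
  shows "\<exists>c. z = c \<odot> \<one>"
proof -
  have zM: "z \<in> comm_U" using z comm by (intro comm_U_I) auto
  have near: "\<exists>c. \<parallel>z \<ominus> c \<odot> \<one>\<parallel> \<le> e" if e: "e > 0" for e
  proof -
    obtain g where g: "g \<in> Trig" "\<forall>\<^sub>F N in sequentially. \<parallel>(z \<ominus> g) \<otimes> S [^] (N::nat)\<parallel> \<le> e"
      using comm_U_approx_Trig[OF zM e] by blast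
    note gc = comm_U_closed[OF Trig_comm_U[OF g(1)]]
    obtain c where c: "\<forall>\<^sub>F N in sequentially. S\<^sup>\<star> [^] N \<otimes> (g \<otimes> S [^] (N::nat)) = c \<odot> \<one>"
      using Trig_compress[OF g(1)] by blast
    obtain N :: nat where N: "\<parallel>(z \<ominus> g) \<otimes> S [^] N\<parallel> \<le> e" "S\<^sup>\<star> [^] N \<otimes> (g \<otimes> S [^] N) = c \<odot> \<one>"
      using eventually_conj[OF g(2) c] unfolding eventually_sequentially by blast
    have "S\<^sup>\<star> [^] N \<otimes> (z \<otimes> S [^] N) = z" using comm[of "S [^] N"] z by simp
    then have "z \<ominus> c \<odot> \<one> = S\<^sup>\<star> [^] N \<otimes> ((z \<ominus> g) \<otimes> S [^] N)"
      unfolding N(2)[symmetric] using z gc by (simp add: minus_scl l_distr r_distr smult_mult_left smult_mult_right)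
    then have "\<parallel>z \<ominus> c \<odot> \<one>\<parallel> \<le> 1 * e" using N(1) z gc by (simp only:) (intro cnorm_mult_le, auto)
    then show ?thesis by auto
  qed
  have "\<exists>c. \<forall>n. \<parallel>z \<ominus> c n \<odot> \<one>\<parallel> \<le> 1 / Suc n"
    using near by (intro choice allI) simp
  then obtain c where c: "\<And>n. \<parallel>z \<ominus> c n \<odot> \<one>\<parallel> \<le> 1 / Suc n" by blast
  have diff: "cmod (a - b) \<le> \<parallel>z \<ominus> a \<odot> \<one>\<parallel> + \<parallel>z \<ominus> b \<odot> \<one>\<parallel>" for a b
  proof -
    have "cmod (a - b) = \<parallel>(a - b) \<odot> \<one>\<parallel>" by (simp add: cnorm_smult)
    also have "(a - b) \<odot> \<one> = a \<odot> \<one> \<ominus> b \<odot> \<one>" using scl_add[of \<one> a "- b"] by (simp add: minus_scl scl_scl)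
    also have "\<parallel>\<dots>\<parallel> \<le> \<parallel>a \<odot> \<one> \<ominus> z\<parallel> + \<parallel>z \<ominus> b \<odot> \<one>\<parallel>" using z by (intro cnorm_dist_triangle) auto
    finally show ?thesis using z cnorm_minus_commute[of "a \<odot> \<one>" z] by simp
  qed
  have lim0: "(\<lambda>n. 1 / real (Suc n)) \<longlonglongrightarrow> 0" using LIMSEQ_Suc[OF lim_1_over_n] by simp
  have "Cauchy c"
  proof (rule metric_CauchyI)
    fix e :: real assume "e > 0"
    then have e2: "e / 2 > 0" by simp
    obtain M where M: "\<And>n. n \<ge> M \<Longrightarrow> 1 / real (Suc n) < e / 2"
      using order_tendstoD(2)[OF lim0 e2] unfolding eventually_sequentially by blast
    have "dist (c m) (c n) < e" if "m \<ge> M" "n \<ge> M" for m n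
      using diff[of "c m" "c n"] c[of m] c[of n] M[OF that(1)] M[OF that(2)] unfolding dist_norm by linarith
    then show "\<exists>M. \<forall>m\<ge>M. \<forall>n\<ge>M. dist (c m) (c n) < e" by blast
  qed
  then obtain l where l: "c \<longlonglongrightarrow> l" using Cauchy_convergent convergent_def by blast
  have "z = l \<odot> \<one>"
  proof (rule eq_if_cnorm_minus_small[where C = 2])
    fix e :: real assume e: "e > 0"
    have "\<forall>\<^sub>F n in sequentially. dist (c n) l < e" using tendstoD[OF l e] .
    then obtain n where n: "dist (c n) l < e" "1 / real (Suc n) < e"
      using eventually_conj[OF _ order_tendstoD(2)[OF lim0 e]] unfolding eventually_sequentially by blast
    have "\<parallel>z \<ominus> l \<odot> \<one>\<parallel> \<le> \<parallel>z \<ominus> c n \<odot> \<one>\<parallel> + \<parallel>c n \<odot> \<one> \<ominus> l \<odot> \<one>\<parallel>" using z by (intro cnorm_dist_triangle) auto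
    also have "c n \<odot> \<one> \<ominus> l \<odot> \<one> = (c n - l) \<odot> \<one>" using scl_add[of \<one> "c n" "- l"] by (simp add: minus_scl scl_scl)
    also have "\<parallel>\<dots>\<parallel> = dist (c n) l" by (simp add: cnorm_smult dist_norm)
    finally show "\<parallel>z \<ominus> l \<odot> \<one>\<parallel> \<le> 2 * e" using n c[of n] by linarith
  qed (use z in auto)
  then show ?thesis by blast
qed

text \<open>The automorphisms fixing the C*-algebra generated by \<open>U\<close> pointwise; by continuity it suffices that
they fix \<open>U\<close>.\<close>

abbreviation Fix_U :: "('a \<Rightarrow> 'a) set" where
  "Fix_U \<equiv> cstar_auto_fixing A (cstar_generated A {U})"

lemma Fix_U_iff: "f \<in> Fix_U \<longleftrightarrow> f \<in> cstar_auto A \<and> f U = U"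
proof (intro iffI conjI)
  assume f: "f \<in> Fix_U"
  then show "f \<in> cstar_auto A" by (simp add: cstar_auto_fixing_def)
  have "U \<in> cstar_generated A {U}" unfolding cstar_generated_def by blast
  then show "f U = U" using f by (simp add: cstar_auto_fixing_def)
next
  assume f: "f \<in> cstar_auto A \<and> f U = U"
  then have "{U} \<subseteq> {x \<in> carrier A. f x = x}" by simp
  moreover have "cstar_subalgebra {x \<in> carrier A. f x = x} A"
    using f cstar_subalgebra_equalizer[OF _ id_star_hom] by (auto simp: cstar_auto_def)
  ultimately have "cstar_generated A {U} \<subseteq> {x \<in> carrier A. f x = x}" by (intro cstar_generated_subset)
  then show "f \<in> Fix_U" using f by (auto simp: cstar_auto_fixing_def)
qed

lemma subgroup_Fix_U: "subgroup Fix_U (cstar_AutoGroup A)"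
proof -
  interpret G: group "cstar_AutoGroup A" by (rule group_cstar_AutoGroup)
  have one: "\<one>\<^bsub>cstar_AutoGroup A\<^esub> = restrict (\<lambda>x. x) (carrier A)"
    by (simp add: cstar_AutoGroup_def BijGroup_def)
  show ?thesis
  proof (rule G.subgroupI)
    show "Fix_U \<subseteq> carrier (cstar_AutoGroup A)" by (auto simp: Fix_U_iff)
    have "\<one>\<^bsub>cstar_AutoGroup A\<^esub> \<in> Fix_U" using G.one_closed by (simp add: Fix_U_iff one)
    then show "Fix_U \<noteq> {}" by blast
  next
    fix f assume f: "f \<in> Fix_U"
    then have fa: "f \<in> cstar_auto A" "f U = U" by (simp_all add: Fix_U_iff)
    let ?g = "inv\<^bsub>cstar_AutoGroup A\<^esub> f"
    have g: "?g \<in> cstar_auto A" using G.inv_closed[of f] fa by simp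
    have "compose (carrier A) ?g f = restrict (\<lambda>x. x) (carrier A)"
      using G.l_inv[of f] fa g by (simp add: AutoGroup_mult one)
    from fun_cong[OF this, of U] have "?g U = U" using fa(2) by (simp add: compose_def)
    then show "?g \<in> Fix_U" using g by (simp add: Fix_U_iff)
  next
    fix f g assume "f \<in> Fix_U" "g \<in> Fix_U"
    then have *: "f \<in> cstar_auto A" "f U = U" "g \<in> cstar_auto A" "g U = U" by (simp_all add: Fix_U_iff)
    then show "f \<otimes>\<^bsub>cstar_AutoGroup A\<^esub> g \<in> Fix_U"
      using G.m_closed[of f g] by (simp add: Fix_U_iff AutoGroup_mult compose_def)
  qed
qed

lemma abelian_Fix_U: "abelian_subgroup Fix_U (cstar_AutoGroup A)"
  unfolding abelian_subgroup_def
proof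
  show sub: "subgroup Fix_U (cstar_AutoGroup A)" by (rule subgroup_Fix_U)
  have "group ((cstar_AutoGroup A)\<lparr>carrier := Fix_U\<rparr>)"
    by (rule subgroup.subgroup_is_group[OF sub group_cstar_AutoGroup])
  then show "comm_group ((cstar_AutoGroup A)\<lparr>carrier := Fix_U\<rparr>)"
  proof (rule group.group_comm_groupI)
    fix f g assume "f \<in> carrier ((cstar_AutoGroup A)\<lparr>carrier := Fix_U\<rparr>)" "g \<in> carrier ((cstar_AutoGroup A)\<lparr>carrier := Fix_U\<rparr>)"
    then have *: "f \<in> cstar_auto A" "f U = U" "g \<in> cstar_auto A" "g U = U" by (simp_all add: Fix_U_iff)
    then have "f \<in> star_hom A A" "g \<in> star_hom A A" by (auto simp: cstar_auto_def)
    then have "compose (carrier A) f g = compose (carrier A) g f"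
      using homs_fixing_U_commute * by (auto simp: compose_def)
    then show "f \<otimes>\<^bsub>(cstar_AutoGroup A)\<lparr>carrier := Fix_U\<rparr>\<^esub> g = g \<otimes>\<^bsub>(cstar_AutoGroup A)\<lparr>carrier := Fix_U\<rparr>\<^esub> f"
      using * by (simp add: AutoGroup_mult)
  qed
qed

text \<open>The inverse of \<open>1 - U/2\<close>, as the fixed point of the contraction \<open>y \<mapsto> 1 + U y / 2\<close>.\<close>

lemma Blaschke_resolvent_exists: "\<exists>r\<in>comm_U. (\<one> \<ominus> (1/2) \<odot> Up 1) \<otimes> r = \<one>"
proof -
  define F where "F y = \<one> \<oplus> (1/2) \<odot> (Up 1 \<otimes> y)" for y
  have cl: "norm_closed comm_U" unfolding comm_U_def by (rule norm_closed_commutant) simp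
  have "\<exists>y\<in>comm_U. F y = y"
  proof (rule Banach_fixed_point[OF cl comm_U_one, of F "1/2"])
    show "F y \<in> comm_U" if "y \<in> comm_U" for y
      unfolding F_def using that by (intro comm_U_add comm_U_scl comm_U_mult) auto
    fix x y assume "x \<in> comm_U" "y \<in> comm_U"
    then have xy: "x \<in> carrier A" "y \<in> carrier A" by auto
    have "F x \<ominus> F y = (1/2) \<odot> (Up 1 \<otimes> (x \<ominus> y)) \<oplus> (\<one> \<ominus> \<one>)"
      unfolding F_def using xy by (simp add: minus_scl scl_distr scl_scl r_distr smult_mult_right a_ac del: minus_self)
    then show "\<parallel>F x \<ominus> F y\<parallel> \<le> 1 / 2 * \<parallel>x \<ominus> y\<parallel>" using xy by (simp add: cnorm_smult)
  qed auto
  then obtain r where r: "r \<in> comm_U" "F r = r" by blast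
  have rc: "r \<in> carrier A" "Up 1 \<otimes> r \<in> carrier A" using r(1) by auto
  have "(\<one> \<ominus> (1/2) \<odot> Up 1) \<otimes> r = r \<ominus> (1/2) \<odot> (Up 1 \<otimes> r)"
    using rc by (simp add: minus_scl l_distr smult_mult_left)
  also have "\<dots> = F r \<ominus> (1/2) \<odot> (Up 1 \<otimes> r)" unfolding r(2) ..
  also have "\<dots> = \<one> \<oplus> ((1/2) \<odot> (Up 1 \<otimes> r) \<ominus> (1/2) \<odot> (Up 1 \<otimes> r))"
    unfolding F_def using rc by (simp add: a_minus_def a_assoc)
  also have "\<dots> = \<one>" using rc by simp
  finally show ?thesis using r(1) by blast
qed

lemma trig_coeffs_unique:
  assumes eq: "(a \<odot> \<one> \<oplus> b \<odot> Up 1) \<oplus> c \<odot> Up 2 = (a' \<odot> \<one> \<oplus> b' \<odot> Up 1) \<oplus> c' \<odot> Up 2"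
  shows "a = a'" "b = b'"
proof -
  define F where "F l g = S\<^sup>\<star> [^] (0 + 2 :: nat) \<otimes> (Up l \<otimes> (g \<otimes> S [^] (0 + 2 :: nat)))" for l g
  have F: "F 0 ((a \<odot> \<one> \<oplus> b \<odot> Up 1) \<oplus> c \<odot> Up 2) = a \<odot> \<one>"
    "F (-1) ((a \<odot> \<one> \<oplus> b \<odot> Up 1) \<oplus> c \<odot> Up 2) = b \<odot> \<one>" for a b c
    unfolding F_def using adjS_pow_Up_small[of _ 0]
    by (simp_all add: l_distr r_distr smult_mult_left smult_mult_right m_assoc del: nat_pow_Suc add_2_eq_Suc' add_0)
  show "a = a'" using F(1)[of a b c] F(1)[of a' b' c'] eq by (intro scl_one_inject) simp
  show "b = b'" using F(2)[of a b c] F(2)[of a' b' c'] eq by (intro scl_one_inject) simp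
qed

text \<open>Since \<open>\<alpha>\<close> commutes with \<open>Ad w\<close> and is surjective, \<open>w\<close> and \<open>\<alpha>(w)\<close> implement the same inner automorphism and
differ by a central factor.\<close>

lemma commuting_auto_eigen:
  assumes \<alpha>: "\<alpha> \<in> cstar_auto A" and comm: "\<And>f x. f \<in> Fix_U \<Longrightarrow> x \<in> carrier A \<Longrightarrow> \<alpha> (f x) = f (\<alpha> x)"
    and w: "w \<in> comm_U" "w\<^sup>\<star> \<otimes> w = \<one>"
  shows "\<exists>c. \<alpha> w = c \<odot> w"
proof -
  have h: "\<alpha> \<in> star_hom A A" and surj: "\<alpha> ` carrier A = carrier A"
    using \<alpha> by (auto simp: cstar_auto_def Bij_def bij_betw_def)
  note wc = comm_U_closed[OF w(1)]
  have w2: "w \<otimes> w\<^sup>\<star> = \<one>" using comm_U_commute[OF w(1) comm_U_adj[OF w(1)]] w(2) by simp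
  note cw = unitary_cancel[OF wc w(2) w2]
  have "Ad w (Up 1) = w \<otimes> (w\<^sup>\<star> \<otimes> Up 1)" using comm_U_Up[OF comm_U_adj[OF w(1)], of 1] by (simp add: Ad_def)
  then have AdF: "Ad w \<in> Fix_U" using Ad_auto[OF wc w(2) w2] cw by (simp add: Fix_U_iff Up_1)
  define v where "v = \<alpha> w"
  have v: "v \<in> carrier A" "v\<^sup>\<star> \<otimes> v = \<one>" "v \<otimes> v\<^sup>\<star> = \<one>"
    using wc w(2) w2 star_homD(4)[OF h]
    by (simp_all add: v_def star_homD(1)[OF h] flip: star_homD(2,5)[OF h])
  note cv = unitary_cancel[OF v]
  have key: "v \<otimes> (y \<otimes> v\<^sup>\<star>) = w \<otimes> (y \<otimes> w\<^sup>\<star>)" if y: "y \<in> carrier A" for y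
  proof -
    obtain x where x: "x \<in> carrier A" "y = \<alpha> x" using y surj by blast
    have "\<alpha> (Ad w x) = Ad w y" using comm[OF AdF x(1)] x by simp
    then show ?thesis using x y wc by (simp add: Ad_def star_homD[OF h] v_def)
  qed
  have "\<exists>c. w\<^sup>\<star> \<otimes> v = c \<odot> \<one>"
  proof (rule center_scalar)
    fix y assume y: "y \<in> carrier A"
    have "w\<^sup>\<star> \<otimes> v \<otimes> y = w\<^sup>\<star> \<otimes> ((v \<otimes> (y \<otimes> v\<^sup>\<star>)) \<otimes> v)" using y v wc by (simp add: m_assoc)
    also have "\<dots> = y \<otimes> (w\<^sup>\<star> \<otimes> v)" unfolding key[OF y] using y v(1) wc by (simp add: m_assoc cw)
    finally show "w\<^sup>\<star> \<otimes> v \<otimes> y = y \<otimes> (w\<^sup>\<star> \<otimes> v)" .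
  qed (use wc v in simp)
  then obtain c where "w\<^sup>\<star> \<otimes> v = c \<odot> \<one>" by blast
  then have "w \<otimes> (w\<^sup>\<star> \<otimes> v) = c \<odot> w" using wc by (simp add: smult_mult_right)
  then have "\<alpha> w = c \<odot> w" using cw(2)[OF v(1)] by (simp add: v_def)
  then show ?thesis by blast
qed

text \<open>The unitary \<open>w = Q P^(-1)\<close> with \<open>Q = U - 1/2\<close> and \<open>P = 1 - U/2\<close> is a multiple of its image \<open>Q' P'^(-1)\<close>
under \<open>U \<mapsto> c U\<close>. Clearing denominators leaves an identity between quadratic polynomials in \<open>U\<close>, whose
constant and linear coefficients force \<open>c = 1\<close>.\<close>

lemma commuting_auto_fixes_U:
  assumes \<alpha>: "\<alpha> \<in> cstar_auto A" and comm: "\<And>f x. f \<in> Fix_U \<Longrightarrow> x \<in> carrier A \<Longrightarrow> \<alpha> (f x) = f (\<alpha> x)"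
  shows "\<alpha> U = U"
proof -
  have h: "\<alpha> \<in> star_hom A A" using \<alpha> by (auto simp: cstar_auto_def)
  have UM: "Up 1 \<in> comm_U" "(Up 1)\<^sup>\<star> \<otimes> Up 1 = \<one>" by simp_all
  obtain c where c: "\<alpha> (Up 1) = c \<odot> Up 1" using commuting_auto_eigen[OF \<alpha> comm UM] by blast
  obtain r where r: "r \<in> comm_U" "(\<one> \<ominus> (1/2) \<odot> Up 1) \<otimes> r = \<one>" using Blaschke_resolvent_exists by blast
  note rc = comm_U_closed[OF r(1)]
  define P where "P = \<one> \<ominus> (1/2) \<odot> Up 1"
  define Q where "Q = Up 1 \<ominus> (1/2) \<odot> \<one>"
  have PM: "P \<in> comm_U" "Q \<in> comm_U" using UM(1) by (auto simp: P_def Q_def intro!: comm_U_minus comm_U_scl)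
  note PQ = comm_U_closed[OF PM(1)] comm_U_closed[OF PM(2)]
  have Pr: "P \<otimes> r = \<one>" "r \<otimes> P = \<one>" using r(2) comm_U_commute[OF PM(1) r(1)] by (simp_all add: P_def)
  define w where "w = Q \<otimes> r"
  have wM: "w \<in> comm_U" using PM r(1) by (simp add: w_def comm_U_mult)
  have QQ: "Q\<^sup>\<star> \<otimes> Q = P\<^sup>\<star> \<otimes> P"
    by (simp add: P_def Q_def minus_scl adj_add adj_smult l_distr r_distr smult_mult_left smult_mult_right scl_scl scl_distr a_ac)
  have "w\<^sup>\<star> \<otimes> w = r\<^sup>\<star> \<otimes> ((Q\<^sup>\<star> \<otimes> Q) \<otimes> r)" using PQ rc by (simp add: w_def adj_mult m_assoc)
  also have "\<dots> = (P \<otimes> r)\<^sup>\<star> \<otimes> (P \<otimes> r)" unfolding QQ using PQ rc by (simp add: adj_mult m_assoc)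
  finally have w1: "w\<^sup>\<star> \<otimes> w = \<one>" unfolding Pr by simp
  obtain k where k: "\<alpha> w = k \<odot> w" using commuting_auto_eigen[OF \<alpha> comm wM w1] by blast
  define P' where "P' = \<one> \<ominus> (c/2) \<odot> Up 1"
  define Q' where "Q' = c \<odot> Up 1 \<ominus> (1/2) \<odot> \<one>"
  have PQ': "P' \<in> carrier A" "Q' \<in> carrier A" by (simp_all add: P'_def Q'_def)
  have \<alpha>P: "\<alpha> P = P'" "\<alpha> Q = Q'"
    using c by (simp_all add: P_def Q_def P'_def Q'_def star_hom_minus[OF h] star_homD[OF h] scl_scl)
  define r' where "r' = \<alpha> r"
  have r': "r' \<in> carrier A" "r' \<otimes> P' = \<one>"
    using rc PQ Pr(2) star_homD(4)[OF h] by (simp_all add: r'_def star_homD(1)[OF h] flip: \<alpha>P star_homD(2)[OF h])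
  have PP: "P' \<otimes> P = P \<otimes> P'"
    by (simp add: P_def P'_def minus_scl l_distr r_distr smult_mult_left smult_mult_right scl_scl scl_distr a_ac mult_ac)
  have "Q' \<otimes> r' = k \<odot> (Q \<otimes> r)" using k PQ rc by (simp add: w_def star_homD[OF h] \<alpha>P r'_def)
  then have "Q' \<otimes> r' \<otimes> (P' \<otimes> P) = k \<odot> (Q \<otimes> r) \<otimes> (P \<otimes> P')" unfolding PP by simp
  moreover have "Q' \<otimes> r' \<otimes> (P' \<otimes> P) = Q' \<otimes> ((r' \<otimes> P') \<otimes> P)" using PQ PQ' r'(1) by (simp add: m_assoc)
  moreover have "k \<odot> (Q \<otimes> r) \<otimes> (P \<otimes> P') = k \<odot> (Q \<otimes> ((r \<otimes> P) \<otimes> P'))"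
    using PQ PQ' rc by (simp add: m_assoc smult_mult_left)
  ultimately have eq: "Q' \<otimes> P = k \<odot> (Q \<otimes> P')" unfolding r'(2) Pr(2) using PQ PQ' by simp
  have L: "Q' \<otimes> P = ((-1/2) \<odot> \<one> \<oplus> (c + 1/4) \<odot> Up 1) \<oplus> (- c/2) \<odot> Up 2"
    unfolding Q'_def P_def
    by (simp add: minus_scl l_distr r_distr smult_mult_left smult_mult_right scl_scl scl_distr scl_add a_ac)
  have R: "k \<odot> (Q \<otimes> P') = ((- k/2) \<odot> \<one> \<oplus> (k + k*c/4) \<odot> Up 1) \<oplus> (- k*c/2) \<odot> Up 2"
    unfolding Q_def P'_def
    by (simp add: minus_scl l_distr r_distr smult_mult_left smult_mult_right scl_scl scl_distr scl_add a_ac)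
  have "-1/2 = - k/2" "c + 1/4 = k + k*c/4"
    using trig_coeffs_unique[OF eq[unfolded L R]] by blast+
  then have "c = 1" by (simp add: field_simps)
  then show ?thesis using c by (simp add: Up_1)
qed

lemma maximal_abelian_Fix_U: "maximal_abelian_subgroup Fix_U (cstar_AutoGroup A)"
  unfolding maximal_abelian_subgroup_def
proof (intro conjI allI impI abelian_Fix_U)
  fix K assume K: "abelian_subgroup K (cstar_AutoGroup A) \<and> Fix_U \<subseteq> K"
  have sub: "K \<subseteq> cstar_auto A" using K subgroup.subset[of K "cstar_AutoGroup A"] by (auto simp: abelian_subgroup_def)
  have cg: "comm_group ((cstar_AutoGroup A)\<lparr>carrier := K\<rparr>)" using K by (simp add: abelian_subgroup_def)
  interpret K: comm_group "(cstar_AutoGroup A)\<lparr>carrier := K\<rparr>" by (rule cg)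
  have "K \<subseteq> Fix_U"
  proof
    fix \<alpha> assume \<alpha>: "\<alpha> \<in> K"
    then have \<alpha>a: "\<alpha> \<in> cstar_auto A" using sub by blast
    have "\<alpha> U = U"
    proof (rule commuting_auto_fixes_U[OF \<alpha>a])
      fix f x assume f: "f \<in> Fix_U" and x: "x \<in> carrier A"
      have fK: "f \<in> K" "f \<in> cstar_auto A" using f K by (auto simp: Fix_U_iff)
      have "compose (carrier A) \<alpha> f = compose (carrier A) f \<alpha>"
        using K.m_comm[of \<alpha> f] \<alpha> fK \<alpha>a by (simp add: AutoGroup_mult)
      from fun_cong[OF this, of x] show "\<alpha> (f x) = f (\<alpha> x)" using x by (simp add: compose_def)
    qed
    then show "\<alpha> \<in> Fix_U" using \<alpha>a by (simp add: Fix_U_iff)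
  qed
  then show "K = Fix_U" using K by blast
qed

end

theorem theorem6p16:
  fixes A :: "'a cstar_alg" and U S\<^sub>2 :: 'a
  assumes "is_Q2 A U S\<^sub>2"
  shows "maximal_abelian_subgroup (cstar_auto_fixing A (cstar_generated A {U})) (cstar_AutoGroup A)"
proof -
  interpret two_adic A U S\<^sub>2
    using assms by (auto simp: is_Q2_def two_adic_def two_adic_axioms_def)
  show ?thesis by (rule maximal_abelian_Fix_U)
qed

end
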